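(* Let $E$ be a vector bundle of fibre dimension $m$ over a base manifold $X$ of dimension $n$, and let $R_1\subset J_1(E)$ be a first order linear involutive and analytic system such that the projection $\pi^1_0:R_1\to E$ is an epimorphism. Let $\beta^1_1\le\dots\le\beta^n_1$ denote the numbers of equations of class $1,\dots,n$ of the system in solved form, the equations of class $i$ being solved with respect to $y^1_i,\dots,y^{\beta^i_1}_i$, and let $x_0\in X$. Then there exists one analytic solution $y^k=f^k(x)$ (near $x_0$), and only one, such that: 1) $f^1(x),\dots,f^{\beta^1_1}(x)$ are equal to $\beta^1_1$ given constants when $x=x_0$; 2) for $i=1,\dots,n-1$, $f^{\beta^i_1+1}(x),\dots,f^{\beta^{i+1}_1}(x)$ are equal to $\beta^{i+1}_1-\beta^i_1$ given analytic functions of $x^1,\dots,x^i$ when $x^{i+1}=x^{i+1}_0,\dots,x^n=x^n_0$; 3) $f^{\beta^n_1+1}(x),\dots,f^m(x)$ are $m-\beta^n_1$ given analytic functions of $x^1,\dots,x^n$.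
   Context: $J_1(E)$ is the first jet bundle of $E$, with local coordinates $(x^i,y^k,y^k_i)$, $i=1,\dots,n$, $k=1,\dots,m$. A linear first order system is a vector subbundle $R_1\subset J_1(E)$ defined by linear equations in $(y^k,y^k_i)$ with coefficients depending on $x$; it is analytic when these coefficients are analytic. A solution is a local section $y^k=f^k(x)$ of $E$ such that $(f^k,\partial_if^k)$ satisfies the equations. The condition that $\pi^1_0:R_1\to E$ is an epimorphism means that the system contains no zero order equation. The jet $y^k_i$ is of class $i$. In suitable ($\delta$-regular) coordinates, obtained by a linear change of the independent variables if necessary, solve the maximum number $\beta^n_1$ of equations with respect to the jets of class $n$, then the maximum number $\beta^{n-1}_1$ of remaining equations with respect to the jets of class $n-1$, and so on down to class $1$. An equation of class $i$ has multiplicative variables $x^1,\dots,x^i$ and non-multiplicative variables $x^{i+1},\dots,x^n$. The system is involutive if its first prolongation (the equations together with all their first formal derivatives) is obtained by prolonging each equation only with respect to its multiplicative variables. The coordinates and the ordering of the unknowns are chosen so that the equations of class $i$ are solved with respect to $y^1_i,\dots,y^{\beta^i_1}_i$. *)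

theory Defs
  imports "HOL-Analysis.Analysis"
begin

(* Everything is local on X, so the bundle is written in a chart: the base is an open
   subset of real^'n and the fibre is real^'m.  Both index types are finite linear
   orders and pos is the order isomorphism onto {1..CARD}, so that x^i is the
   component x $ j with pos j = i, and likewise for y^k. *)

definition pos :: "'a::{finite,linorder} \<Rightarrow> nat" where
  "pos a = card {..a}"

(* Abbreviates real^'n because that syntax inserts the bare sort finite for 'n, which
   clashes with a sort annotation {finite,linorder} elsewhere in the same type. *)

type_synonym 'n rvec = "real^'n"

(* Real analyticity in several variables.  The index \<alpha> is a multi-index; has_sum
   is unordered, i.e. absolute, convergence. *)

definition real_analytic_at ::
  "(real^'n \<Rightarrow> 'b::real_normed_vector) \<Rightarrow> real^'n \<Rightarrow> bool" where
  "real_analytic_at f a \<longleftrightarrow>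
     (\<exists>c :: ('n \<Rightarrow> nat) \<Rightarrow> 'b. \<exists>r>0. \<forall>x\<in>ball a r.
        ((\<lambda>\<alpha>. (\<Prod>i\<in>UNIV. (x $ i - a $ i) ^ \<alpha> i) *\<^sub>R c \<alpha>) has_sum f x) UNIV)"

definition real_analytic_on ::
  "(real^'n \<Rightarrow> 'b::real_normed_vector) \<Rightarrow> (real^'n) set \<Rightarrow> bool" where
  "real_analytic_on f U \<longleftrightarrow> (\<forall>x\<in>U. real_analytic_at f x)"

(* Fibre coordinates of J_1(E) and J_2(E): in (y, p) and (y, p, q), y $ k is y^k,
   p $ k $ i is y^k_i, and q $ k $ i $ j is y^k_{ij}; symmetry of q in i, j is
   required separately. *)

type_synonym ('n, 'm) jet1 = "(real^'m) \<times> (real^'n^'m)"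
type_synonym ('n, 'm) jet2 = "(real^'m) \<times> (real^'n^'m) \<times> (real^'n^'n^'m)"

definition j1 :: "('n::finite rvec \<Rightarrow> 'm::finite rvec) \<Rightarrow> 'n rvec \<Rightarrow> ('n, 'm) jet1" where
  "j1 f x = (f x, jacobian f (at x))"

(* A linear first order equation is given by its coefficients C x = (a(x), b(x)):
     C x \<bullet> (y, p) = (\<Sum>k. a_k(x) y^k) + (\<Sum>k i. b_k^i(x) y^k_i) = 0. *)

type_synonym ('n, 'm) lin_eq = "'n rvec \<Rightarrow> ('n, 'm) jet1"

(* The formal derivative d_j of the left-hand side of such an equation: differentiate the
   coefficients in x^j, and replace y^k by y^k_j and y^k_i by y^k_{ij}. *)

definition formal_deriv ::
  "'n::finite \<Rightarrow> ('n, 'm::finite) lin_eq \<Rightarrow> 'n rvec \<Rightarrow> ('n, 'm) jet2 \<Rightarrow> real" where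
  "formal_deriv j C x = (\<lambda>(y, p, q).
     frechet_derivative C (at x) (axis j 1) \<bullet> (y, p)
     + C x \<bullet> (\<chi> k. p $ k $ j, \<chi> k i. q $ k $ i $ j))"

(* A system R_1 is the family x \<mapsto> R x of its fibres. *)

definition analytic_linear_system ::
  "'n::finite rvec set \<Rightarrow> ('n rvec \<Rightarrow> ('n, 'm::finite) jet1 set) \<Rightarrow> bool" where
  "analytic_linear_system U R \<longleftrightarrow>
     (\<exists>\<Phi> :: ('n, 'm) lin_eq set. finite \<Phi> \<and> (\<forall>C\<in>\<Phi>. real_analytic_on C U) \<and>
        (\<forall>x\<in>U. R x = {z. \<forall>C\<in>\<Phi>. C x \<bullet> z = 0})) \<and>
     (\<exists>d. \<forall>x\<in>U. dim (R x) = d)"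

(* y^k_i is one of the jets of class i with respect to which the equations are solved. *)

definition principal ::
  "(nat \<Rightarrow> nat) \<Rightarrow> 'n::{finite,linorder} \<Rightarrow> 'm::{finite,linorder} \<Rightarrow> bool" where
  "principal \<beta> i k \<longleftrightarrow> pos k \<le> \<beta> (pos i)"

(* S i k is the equation of class i solved with respect to y^k_i.  It contains no jet of
   class greater than i and no other principal jet of class i.  Principal jets of lower
   class may still occur in it, so this covers in particular the completely reduced form.
   The vanishing of the jets of higher class expresses that at each class the maximum
   number of equations has been solved. *)

definition solved_form ::
  "'n::{finite,linorder} rvec set \<Rightarrow> ('n rvec \<Rightarrow> ('n, 'm::{finite,linorder}) jet1 set) \<Rightarrow>
   (nat \<Rightarrow> nat) \<Rightarrow> ('n \<Rightarrow> 'm \<Rightarrow> ('n, 'm) lin_eq) \<Rightarrow> bool" where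
  "solved_form U R \<beta> S \<longleftrightarrow>
     (\<forall>i\<in>{1..CARD('n)}. \<beta> i \<le> CARD('m)) \<and>
     (\<forall>i k. principal \<beta> i k \<longrightarrow>
        real_analytic_on (S i k) U \<and>
        (\<forall>x\<in>U. snd (S i k x) $ k $ i = 1 \<and>
           (\<forall>l. l \<noteq> k \<and> principal \<beta> i l \<longrightarrow> snd (S i k x) $ l $ i = 0) \<and>
           (\<forall>l j. i < j \<longrightarrow> snd (S i k x) $ l $ j = 0))) \<and>
     (\<forall>x\<in>U. R x = {z. \<forall>i k. principal \<beta> i k \<longrightarrow> S i k x \<bullet> z = 0})"

(* The points over x of J_2(E) which satisfy the equations S i k together with their
   formal derivatives d_j for all j with J i j. *)

definition prolonged_by ::
  "('n \<Rightarrow> 'n \<Rightarrow> bool) \<Rightarrow> (nat \<Rightarrow> nat) \<Rightarrow> ('n \<Rightarrow> 'm \<Rightarrow> ('n, 'm) lin_eq) \<Rightarrow>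
   'n::{finite,linorder} rvec \<Rightarrow> ('n, 'm::{finite,linorder}) jet2 set" where
  "prolonged_by J \<beta> S x = {(y, p, q).
     (\<forall>k i j. q $ k $ i $ j = q $ k $ j $ i) \<and>
     (\<forall>i k. principal \<beta> i k \<longrightarrow>
        S i k x \<bullet> (y, p) = 0 \<and>
        (\<forall>j. J i j \<longrightarrow> formal_deriv j (S i k) x (y, p, q) = 0))}"

(* The multiplicative variables of an equation of class i are the x^j with j \<le> i.
   The left-hand side below is the full first prolongation; since R has constant rank, it
   depends only on R and not on the equations S used to describe it. *)

definition involutive ::
  "'n::{finite,linorder} rvec set \<Rightarrow> (nat \<Rightarrow> nat) \<Rightarrow>
   ('n \<Rightarrow> 'm::{finite,linorder} \<Rightarrow> ('n, 'm) lin_eq) \<Rightarrow> bool" where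
  "involutive U \<beta> S \<longleftrightarrow>
     (\<forall>x\<in>U. prolonged_by (\<lambda>i j. True) \<beta> S x = prolonged_by (\<lambda>i j. j \<le> i) \<beta> S x)"

(* A function of x^1, ..., x^i only, viewed as a function on real^'n. *)

definition depends_on_first :: "nat \<Rightarrow> ('n::{finite,linorder} rvec \<Rightarrow> real) \<Rightarrow> bool" where
  "depends_on_first i g \<longleftrightarrow>
     (\<forall>x x'. (\<forall>j. pos j \<le> i \<longrightarrow> x $ j = x' $ j) \<longrightarrow> g x = g x')"

definition analytic_solution_near ::
  "'n::finite rvec \<Rightarrow> ('n rvec \<Rightarrow> ('n, 'm::finite) jet1 set) \<Rightarrow> ('n rvec \<Rightarrow> 'm rvec) \<Rightarrow> bool" where
  "analytic_solution_near x0 R f \<longleftrightarrow>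
     real_analytic_at f x0 \<and> (\<forall>\<^sub>F x in nhds x0. j1 f x \<in> R x)"

(* The three kinds of prescribed data: constants c, functions \<phi> on the slices through x0,
   and functions \<psi> of all variables. *)

definition initial_conditions ::
  "'n::{finite,linorder} rvec \<Rightarrow> (nat \<Rightarrow> nat) \<Rightarrow> ('m::{finite,linorder} \<Rightarrow> real) \<Rightarrow>
   ('m \<Rightarrow> 'n rvec \<Rightarrow> real) \<Rightarrow> ('m \<Rightarrow> 'n rvec \<Rightarrow> real) \<Rightarrow> ('n rvec \<Rightarrow> 'm rvec) \<Rightarrow> bool" where
  "initial_conditions x0 \<beta> c \<phi> \<psi> f \<longleftrightarrow>
     (\<forall>k. pos k \<le> \<beta> 1 \<longrightarrow> f x0 $ k = c k) \<and>
     (\<forall>i\<in>{1..<CARD('n)}. \<forall>k. \<beta> i < pos k \<and> pos k \<le> \<beta> (i + 1) \<longrightarrow>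
        (\<forall>\<^sub>F x in nhds x0. (\<forall>j. i < pos j \<longrightarrow> x $ j = x0 $ j) \<longrightarrow> f x $ k = \<phi> k x)) \<and>
     (\<forall>k. \<beta> CARD('n) < pos k \<longrightarrow> (\<forall>\<^sub>F x in nhds x0. f x $ k = \<psi> k x))"

end

theory Submission
  imports Defs
begin

text \<open>
  Write \<open>V\<^sub>i\<close> for the slice through \<open>x\<^sub>0\<close> on which the coordinates after the \<open>i\<close>-th are frozen, so that
  \<open>V\<^sub>0 = {x\<^sub>0}\<close> and \<open>V\<^sub>n\<close> is the whole space.  The solution is built by climbing from \<open>V\<^sub>0\<close> to \<open>V\<^sub>n\<close>.

  Suppose that an analytic \<open>f\<close> takes the prescribed data and satisfies the equations of class less
  than \<open>i\<close> on the slice of index \<open>i - 1\<close>.  The equations of class \<open>i\<close> contain no derivative in a variable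
  beyond the \<open>i\<close>-th, so, once the parametric unknowns are kept as they are, they form a linear
  Cauchy--Kovalevskaya system with evolution variable \<open>x\<^sup>i\<close> for the unknowns with respect to which
  they are solved.  Hence \<open>f\<close> can be corrected, without changing it on the hyperplane through \<open>x\<^sub>0\<close>
  where \<open>x\<^sup>i\<close> is frozen, to a function which satisfies the equations of class \<open>i\<close> near \<open>x\<^sub>0\<close>
  (\<open>solve_class\<close>).  The prescribed data survive: data for a corrected unknown live on a slice
  contained in that hyperplane.

  The equations of lower class still hold on the slice of index \<open>i - 1\<close>; that they hold on \<open>V\<^sub>i\<close> is where
  involutivity enters.  It makes the derivative in the non-multiplicative direction \<open>i\<close> of an equation of
  lower class a combination, with analytic coefficients, of the equations and their multiplicative
  derivatives, and by the triangular shape of the solved form only equations of class at most \<open>i\<close>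
  take part (\<open>compatibility_relation\<close>).  Evaluated on the 2-jet of a function, this is a
  homogeneous Cauchy--Kovalevskaya system in \<open>x\<^sup>i\<close> for the residuals of the equations of lower class, so
  these residuals vanish on \<open>V\<^sub>i\<close> because they vanish on the preceding slice (\<open>residuals_vanish\<close>).
  Uniqueness climbs the same ladder: the difference of two solutions vanishes at \<open>x\<^sub>0\<close>, and the
  equations of class \<open>i\<close> carry its vanishing from one slice to the next (\<open>unique_class\<close>).

  The analysis is done on Taylor coefficients.  A Cauchy--Kovalevskaya system in the variable \<open>t\<close>
  determines the coefficient at \<open>\<alpha>\<close> recursively in \<open>\<alpha> t\<close>, which gives uniqueness at once.  Convergence
  follows by comparison with a multiple of the geometric series of \<open>Q (\<lambda> x\<^sup>t + \<Sum> x\<^sup>j)\<close>, the sum running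
  over \<open>j\<close> other than \<open>t\<close>.  Its coefficients are \<open>\<lambda>\<close> to the \<open>\<alpha> t\<close> times \<open>Q\<close> to the \<open>|\<alpha>|\<close> times the multinomial
  coefficient.  Every partial derivative acts on the multinomial coefficients by the same factor
  \<open>|\<alpha>| + 1\<close>, up to the index shift, so that the
  derivative in \<open>t\<close> of the comparison series is \<open>\<lambda>\<close> times any other one; a large \<open>\<lambda>\<close> absorbs
  the coefficients of the system (\<open>ck_formal_solution_geometric\<close>).
\<close>

section \<open>Power series in several variables\<close>

definition mpow :: "real^'n \<Rightarrow> ('n \<Rightarrow> nat) \<Rightarrow> real" where
  "mpow x \<alpha> = (\<Prod>i\<in>UNIV. (x $ i) ^ \<alpha> i)"

definition mdeg :: "('n::finite \<Rightarrow> nat) \<Rightarrow> nat" where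
  "mdeg \<alpha> = (\<Sum>i\<in>UNIV. \<alpha> i)"

definition inc :: "'n \<Rightarrow> ('n \<Rightarrow> nat) \<Rightarrow> ('n \<Rightarrow> nat)" where
  "inc j \<alpha> = \<alpha>(j := Suc (\<alpha> j))"

definition pseries :: "(('n \<Rightarrow> nat) \<Rightarrow> 'b::banach) \<Rightarrow> real^'n \<Rightarrow> 'b" where
  "pseries c x = (\<Sum>\<^sub>\<infinity>\<alpha>. mpow x \<alpha> *\<^sub>R c \<alpha>)"

text \<open>
  This condition is stable under every operation that is needed below and, unlike a convergence
  requirement, it does not mention a radius.  It characterises convergence near the origin.
\<close>

definition geometric :: "(('n::finite \<Rightarrow> nat) \<Rightarrow> 'b::real_normed_vector) \<Rightarrow> bool" where
  "geometric c \<longleftrightarrow> (\<exists>M R. M \<ge> 0 \<and> R > 0 \<and> (\<forall>\<alpha>. norm (c \<alpha>) \<le> M * R ^ mdeg \<alpha>))"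

definition dcoeff :: "'n \<Rightarrow> (('n \<Rightarrow> nat) \<Rightarrow> 'b::real_vector) \<Rightarrow> ('n \<Rightarrow> nat) \<Rightarrow> 'b" where
  "dcoeff j c \<alpha> = real (Suc (\<alpha> j)) *\<^sub>R c (inc j \<alpha>)"

lemma mdeg_inc [simp]: "mdeg (inc j \<alpha>) = Suc (mdeg (\<alpha> :: 'n::finite \<Rightarrow> nat))"
proof -
  have "mdeg (inc j \<alpha>) = (\<Sum>i\<in>UNIV. \<alpha> i + (if i = j then 1 else 0))"
    unfolding mdeg_def inc_def by (rule sum.cong) auto
  then show ?thesis by (simp add: sum.distrib mdeg_def)
qed

lemma inc_nth: "inc j \<alpha> i = (if i = j then Suc (\<alpha> i) else \<alpha> i)"
  by (simp add: inc_def)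

lemma inj_inc: "inj (inc j)"
proof (rule injI, rule ext)
  fix \<alpha> \<beta> :: "'a \<Rightarrow> nat" and i assume "inc j \<alpha> = inc j \<beta>"
  then have "inc j \<alpha> i = inc j \<beta> i" by simp
  then show "\<alpha> i = \<beta> i" by (simp add: inc_nth split: if_splits)
qed

lemma range_inc: "range (inc j) = {\<alpha>. \<alpha> j > 0}"
proof -
  have "\<alpha> \<in> range (inc j)" if "\<alpha> j > 0" for \<alpha>
    by (rule range_eqI[of _ _ "\<alpha>(j := \<alpha> j - 1)"]) (use that in \<open>auto simp: inc_def\<close>)
  then show ?thesis by (auto simp: inc_nth)
qed

lemma inc_cases: 
  assumes "\<alpha> j > 0" obtains \<beta> where "\<alpha> = inc j \<beta>"
  using assms range_inc[of j] by blast

lemma mpow_bound: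
  fixes x :: "real^'n"
  assumes "norm x \<le> \<rho>"
  shows "\<bar>mpow x \<alpha>\<bar> \<le> \<rho> ^ mdeg \<alpha>"
proof -
  have "\<bar>mpow x \<alpha>\<bar> = (\<Prod>i\<in>UNIV. \<bar>x $ i\<bar> ^ \<alpha> i)"
    by (simp add: mpow_def abs_prod power_abs)
  also have "\<dots> \<le> (\<Prod>i\<in>(UNIV::'n set). \<rho> ^ \<alpha> i)"
    by (intro prod_mono) (use assms component_le_norm_cart[of x] in \<open>auto intro!: power_mono intro: order_trans\<close>)
  finally show ?thesis by (simp add: power_sum mdeg_def)
qed

text \<open>
  A finite set of multi-indices sits in a box, where the sum factors into one-variable geometric sums.
  The bound is independent of the set, so it serves both for summability and for estimating
  finite convolutions.
\<close>

lemma sum_geometric_le: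
  fixes F :: "('n::finite \<Rightarrow> nat) set" and q :: real
  assumes "finite F" "0 \<le> q" "q < 1"
  shows "(\<Sum>\<alpha>\<in>F. q ^ mdeg \<alpha>) \<le> (1 / (1 - q)) ^ CARD('n)"
proof -
  define N where "N = Max (insert 0 ((\<lambda>(\<alpha>, i). \<alpha> i) ` (F \<times> UNIV)))"
  have N: "\<alpha> i \<le> N" if "\<alpha> \<in> F" for \<alpha> i
    unfolding N_def using that assms(1) by (intro Max_ge) (auto intro!: image_eqI[of _ _ "(\<alpha>, i)"])
  have "(\<Sum>\<alpha>\<in>F. q ^ mdeg \<alpha>) \<le> (\<Sum>\<alpha>\<in>PiE (UNIV :: 'n set) (\<lambda>_. {..N}). q ^ mdeg \<alpha>)"
  proof (rule sum_mono2)
    show "finite ((UNIV :: 'n set) \<rightarrow>\<^sub>E {..N})" by (rule finite_PiE) auto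
  qed (use N assms in \<open>auto simp: PiE_def\<close>)
  also have "\<dots> = (\<Prod>i\<in>(UNIV::'n set). \<Sum>k\<le>N. q ^ k)"
    by (subst prod_sum_PiE) (auto simp: mdeg_def power_sum)
  also have "\<dots> \<le> (\<Prod>i\<in>(UNIV::'n set). 1 / (1 - q))"
  proof (intro prod_mono conjI)
    have "(\<Sum>k\<le>N. q ^ k) \<le> (\<Sum>k. q ^ k)"
      by (intro sum_le_suminf summable_geometric) (use assms in auto)
    then show "(\<Sum>k\<le>N. q ^ k) \<le> 1 / (1 - q)" using assms by (simp add: suminf_geometric)
  qed (use assms in \<open>auto intro: sum_nonneg\<close>)
  finally show ?thesis by simp
qed

lemma geometric_summable:
  fixes q :: real
  assumes "0 \<le> q" "q < 1"
  shows "(\<lambda>\<alpha> :: 'n::finite \<Rightarrow> nat. q ^ mdeg \<alpha>) summable_on UNIV"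
  by (rule nonneg_bdd_above_summable_on)
     (use assms sum_geometric_le[where 'n='n] in \<open>auto intro!: bdd_aboveI2\<close>)

lemma pseries_abs_summable:
  fixes c :: "('n::finite \<Rightarrow> nat) \<Rightarrow> 'b::banach"
  assumes c: "\<And>\<alpha>. norm (c \<alpha>) \<le> M * R ^ mdeg \<alpha>" and "0 \<le> R" "norm x * R < 1"
  shows "(\<lambda>\<alpha>. mpow x \<alpha> *\<^sub>R c \<alpha>) abs_summable_on UNIV"
proof (rule Infinite_Sum.abs_summable_on_comparison_test')
  show "(\<lambda>\<alpha> :: 'n \<Rightarrow> nat. (norm x * R) ^ mdeg \<alpha> * M) summable_on UNIV"
    by (intro summable_on_cmult_left geometric_summable) (use assms in auto)
  fix \<alpha>
  have "norm (mpow x \<alpha> *\<^sub>R c \<alpha>) \<le> norm x ^ mdeg \<alpha> * (M * R ^ mdeg \<alpha>)"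
    unfolding norm_scaleR by (intro mult_mono mpow_bound c) auto
  then show "norm (mpow x \<alpha> *\<^sub>R c \<alpha>) \<le> (norm x * R) ^ mdeg \<alpha> * M"
    by (simp add: power_mult_distrib mult_ac)
qed

lemma eventually_small:
  assumes "0 < R"
  shows "\<forall>\<^sub>F x :: real^'n in nhds a. norm (x - a) * R < 1"
proof -
  have "((\<lambda>x. norm (x - a) * R) \<longlongrightarrow> norm (a - a) * R) (nhds a)"
    by (intro tendsto_intros filterlim_ident)
  then show ?thesis by (rule order_tendstoD) simp
qed

lemma geometric_common:
  fixes c :: "('n::finite \<Rightarrow> nat) \<Rightarrow> 'b::real_normed_vector"
    and d :: "('n::finite \<Rightarrow> nat) \<Rightarrow> 'c::real_normed_vector"
  assumes "geometric c" "geometric d"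
  obtains M R where "M \<ge> 0" "R > 0" "\<And>\<alpha>. norm (c \<alpha>) \<le> M * R ^ mdeg \<alpha>"
    "\<And>\<alpha>. norm (d \<alpha>) \<le> M * R ^ mdeg \<alpha>"
proof -
  from assms obtain M1 R1 M2 R2 where *: "M1 \<ge> 0" "R1 > 0" "M2 \<ge> 0" "R2 > 0"
    "\<And>\<alpha>. norm (c \<alpha>) \<le> M1 * R1 ^ mdeg \<alpha>" "\<And>\<alpha>. norm (d \<alpha>) \<le> M2 * R2 ^ mdeg \<alpha>"
    unfolding geometric_def by metis
  have "M1 * R1 ^ mdeg \<alpha> \<le> max M1 M2 * max R1 R2 ^ mdeg \<alpha>"
    "M2 * R2 ^ mdeg \<alpha> \<le> max M1 M2 * max R1 R2 ^ mdeg \<alpha>" for \<alpha> :: "'n \<Rightarrow> nat"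
    using * by (auto intro!: mult_mono power_mono)
  then have "norm (c \<alpha>) \<le> max M1 M2 * max R1 R2 ^ mdeg \<alpha>"
    "norm (d \<alpha>) \<le> max M1 M2 * max R1 R2 ^ mdeg \<alpha>" for \<alpha>
    using *(5,6)[of \<alpha>] order_trans by blast+
  then show thesis using * by (intro that[of "max M1 M2" "max R1 R2"]) auto
qed

lemma geometric_linear:
  assumes "bounded_linear L" "geometric c"
  shows "geometric (\<lambda>\<alpha>. L (c \<alpha>))"
proof -
  obtain M R where *: "M \<ge> 0" "R > 0" "\<And>\<alpha>. norm (c \<alpha>) \<le> M * R ^ mdeg \<alpha>"
    using assms(2) unfolding geometric_def by metis
  obtain K where K: "K \<ge> 0" "\<And>x. norm (L x) \<le> norm x * K"
    using bounded_linear.nonneg_bounded[OF assms(1)] by metis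
  have "norm (L (c \<alpha>)) \<le> (M * K) * R ^ mdeg \<alpha>" for \<alpha>
    using order_trans[OF K(2)[of "c \<alpha>"] mult_right_mono[OF *(3)[of \<alpha>] K(1)]] by (simp add: mult_ac)
  then show ?thesis unfolding geometric_def using * K
    by (intro exI[of _ "M * K"] exI[of _ R]) auto
qed

lemma geometric_add:
  assumes "geometric c" "geometric d"
  shows "geometric (\<lambda>\<alpha>. c \<alpha> + d \<alpha>)"
proof -
  obtain M R where *: "M \<ge> 0" "R > 0" "\<And>\<alpha>. norm (c \<alpha>) \<le> M * R ^ mdeg \<alpha>"
    "\<And>\<alpha>. norm (d \<alpha>) \<le> M * R ^ mdeg \<alpha>"
    by (rule geometric_common[OF assms]) (rule that)
  have "norm (c \<alpha> + d \<alpha>) \<le> (2 * M) * R ^ mdeg \<alpha>" for \<alpha>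
    using norm_triangle_ineq[of "c \<alpha>" "d \<alpha>"] *(3,4)[of \<alpha>] by simp
  then show ?thesis unfolding geometric_def using *
    by (intro exI[of _ "2 * M"] exI[of _ R]) auto
qed

text \<open>
  Differentiation costs a factor \<open>\<alpha> j + 1\<close>, which is at most \<open>2\<close> to the power of the degree and so can be
  charged to the ratio.
\<close>

lemma dcoeff_bound:
  fixes c :: "('n::finite \<Rightarrow> nat) \<Rightarrow> 'b::real_normed_vector"
  assumes "\<And>\<alpha>. norm (c \<alpha>) \<le> M * R ^ mdeg \<alpha>" "M \<ge> 0" "R > 0"
  shows "norm (dcoeff j c \<alpha>) \<le> (M * R) * (2 * R) ^ mdeg \<alpha>"
proof -
  have "\<alpha> j \<le> mdeg \<alpha>" unfolding mdeg_def by (rule member_le_sum) auto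
  moreover have "Suc (mdeg \<alpha>) \<le> 2 ^ mdeg \<alpha>" using less_exp[of "mdeg \<alpha>"] by linarith
  ultimately have "Suc (\<alpha> j) \<le> 2 ^ mdeg \<alpha>" by linarith
  then have "real (Suc (\<alpha> j)) \<le> 2 ^ mdeg \<alpha>" by (metis of_nat_le_iff of_nat_numeral of_nat_power)
  then have "norm (dcoeff j c \<alpha>) \<le> 2 ^ mdeg \<alpha> * (M * R ^ mdeg (inc j \<alpha>))"
    unfolding dcoeff_def norm_scaleR by (intro mult_mono assms(1)) (use assms in auto)
  then show ?thesis by (simp add: power_mult_distrib mult_ac)
qed

lemma geometric_dcoeff:
  assumes "geometric c"
  shows "geometric (dcoeff j c)"
proof -
  obtain M R where *: "M \<ge> 0" "R > 0" "\<And>\<alpha>. norm (c \<alpha>) \<le> M * R ^ mdeg \<alpha>"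
    using assms unfolding geometric_def by metis
  then have "norm (dcoeff j c \<alpha>) \<le> (M * R) * (2 * R) ^ mdeg \<alpha>" for \<alpha>
    by (intro dcoeff_bound)
  moreover have "M * R \<ge> 0" "2 * R > 0" using * by auto
  ultimately show ?thesis unfolding geometric_def by blast
qed

text \<open>
  The partial derivative of a monomial.  The subtraction in the exponent is truncated only where the first
  factor is \<open>0\<close>.
\<close>

definition dmono :: "'n \<Rightarrow> real^'n \<Rightarrow> ('n \<Rightarrow> nat) \<Rightarrow> real" where
  "dmono j x \<alpha> = real (\<alpha> j) * (x $ j) ^ (\<alpha> j - 1) * (\<Prod>i\<in>UNIV-{j}. (x $ i) ^ \<alpha> i)"

lemma dmono_inc: "dmono j x (inc j \<alpha>) = real (Suc (\<alpha> j)) * mpow x \<alpha>"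
proof -
  have "mpow x \<alpha> = x $ j ^ \<alpha> j * (\<Prod>i\<in>UNIV-{j}. (x $ i) ^ \<alpha> i)"
    unfolding mpow_def by (rule prod.remove) auto
  moreover have "(\<Prod>i\<in>UNIV-{j}. (x $ i) ^ inc j \<alpha> i) = (\<Prod>i\<in>UNIV-{j}. (x $ i) ^ \<alpha> i)"
    by (rule prod.cong) (auto simp: inc_nth)
  ultimately show ?thesis by (simp add: dmono_def inc_nth)
qed

lemma mpow_has_derivative:
  fixes x :: "real^'n"
  shows "((\<lambda>x. mpow x \<alpha>) has_derivative (\<lambda>h. \<Sum>j\<in>UNIV. h $ j * dmono j x \<alpha>)) (at x within S)"
proof -
  have "((\<lambda>x. mpow x \<alpha>) has_derivative 
     (\<lambda>h. \<Sum>j\<in>UNIV. (real (\<alpha> j) * h $ j * (x $ j) ^ (\<alpha> j - 1)) * (\<Prod>i\<in>UNIV-{j}. (x $ i) ^ \<alpha> i))) (at x within S)"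
    unfolding mpow_def
    by (rule has_derivative_prod, rule has_derivative_power, rule bounded_linear_imp_has_derivative)
       (rule bounded_linear_vec_nth)
  then show ?thesis by (simp add: dmono_def mult_ac)
qed

lemma termwise_partial_has_sum:
  fixes c :: "('n::finite \<Rightarrow> nat) \<Rightarrow> 'b::banach"
  assumes c: "\<And>\<alpha>. norm (c \<alpha>) \<le> M * R ^ mdeg \<alpha>" "M \<ge> 0" "R > 0" "norm x * (2 * R) < 1"
  shows "((\<lambda>\<alpha>. dmono j x \<alpha> *\<^sub>R c \<alpha>) has_sum pseries (dcoeff j c) x) UNIV"
proof -
  have "(\<lambda>\<alpha>. mpow x \<alpha> *\<^sub>R dcoeff j c \<alpha>) abs_summable_on UNIV"
    by (rule pseries_abs_summable[where M="M*R" and R="2*R"], rule dcoeff_bound) (use c in auto)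
  then have "((\<lambda>\<alpha>. mpow x \<alpha> *\<^sub>R dcoeff j c \<alpha>) has_sum pseries (dcoeff j c) x) UNIV"
    unfolding pseries_def by (rule has_sum_infsum[OF abs_summable_summable])
  then have "((\<lambda>\<alpha>. dmono j x (inc j \<alpha>) *\<^sub>R c (inc j \<alpha>)) has_sum pseries (dcoeff j c) x) UNIV"
    by (simp add: dmono_inc dcoeff_def mult_ac)
  then have "((\<lambda>\<alpha>. dmono j x \<alpha> *\<^sub>R c \<alpha>) has_sum pseries (dcoeff j c) x) (range (inc j))"
    by (subst has_sum_reindex[OF inj_inc]) (simp add: o_def)
  then show ?thesis
    by (subst has_sum_cong_neutral[where g="\<lambda>\<alpha>. dmono j x \<alpha> *\<^sub>R c \<alpha>" and T="range (inc j)"])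
       (auto simp: range_inc dmono_def)
qed

lemma termwise_partial_bound:
  fixes c :: "('n::finite \<Rightarrow> nat) \<Rightarrow> 'b::banach"
  assumes c: "\<And>\<alpha>. norm (c \<alpha>) \<le> M * R ^ mdeg \<alpha>" "M \<ge> 0" "R > 0" "norm x \<le> \<rho>" "\<rho> > 0"
  shows "norm (dmono j x \<alpha> *\<^sub>R c \<alpha>) \<le> M / (2 * \<rho>) * (\<rho> * (2 * R)) ^ mdeg \<alpha>"
proof (cases "\<alpha> j = 0")
  case True
  have "0 \<le> M / (2 * \<rho>) * (\<rho> * (2 * R)) ^ mdeg \<alpha>"
    by (intro mult_nonneg_nonneg divide_nonneg_nonneg zero_le_power) (use c(2-5) in auto)
  with True show ?thesis by (simp add: dmono_def)
next
  case False
  then obtain \<beta> where \<beta>: "\<alpha> = inc j \<beta>" by (metis inc_cases neq0_conv)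
  have "norm (dmono j x \<alpha> *\<^sub>R c \<alpha>) = \<bar>mpow x \<beta>\<bar> * norm (dcoeff j c \<beta>)"
    unfolding \<beta> dmono_inc dcoeff_def by (simp add: abs_mult)
  also have "\<dots> \<le> \<rho> ^ mdeg \<beta> * ((M * R) * (2 * R) ^ mdeg \<beta>)"
    by (intro mult_mono mpow_bound dcoeff_bound) (use c(2-5) in \<open>auto intro: c(1)\<close>)
  also have "\<dots> = M / (2 * \<rho>) * (\<rho> * (2 * R)) ^ mdeg \<alpha>"
    using \<open>\<rho> > 0\<close> by (simp add: \<beta> power_mult_distrib)
  finally show ?thesis .
qed

lemma ex_enumeration: "\<exists>e :: nat \<Rightarrow> ('n::finite \<Rightarrow> nat). bij e"
proof -
  have "infinite (UNIV :: ('n \<Rightarrow> nat) set)"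
  proof -
    have "inj (\<lambda>k. (\<lambda>_. k) :: 'n \<Rightarrow> nat)" by (rule injI) (metis)
    then show ?thesis by (meson finite_imageD finite_subset infinite_UNIV_nat subset_UNIV)
  qed
  then show ?thesis using bij_betw_from_nat_into[of "UNIV :: ('n \<Rightarrow> nat) set"] by auto
qed

text \<open>
  Termwise differentiation.  All termwise partial derivatives are dominated on a ball by one
  summable family, so the series of derivatives converges uniformly there; the multi-indices are
  enumerated because the theorem on differentiating a series is about sequences.
\<close>

lemma pseries_has_derivative:
  fixes c :: "('n::finite \<Rightarrow> nat) \<Rightarrow> 'b::banach"
  assumes c: "\<And>\<alpha>. norm (c \<alpha>) \<le> M * R ^ mdeg \<alpha>" "M \<ge> 0" "R > 0" and x: "norm x * (2 * R) < 1"
  shows "(pseries c has_derivative (\<lambda>h. \<Sum>j\<in>UNIV. h $ j *\<^sub>R pseries (dcoeff j c) x)) (at x)"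
proof -
  define r where "r = 1 / (2 * R)"
  obtain \<rho> where \<rho>: "norm x < \<rho>" "\<rho> < r"
    using dense[of "norm x" r] x c by (auto simp: r_def field_simps)
  have "\<rho> > 0" using \<rho> by (smt (verit) norm_ge_zero)
  have \<rho>R: "\<rho> * (2 * R) < 1" using \<rho> c by (simp add: r_def field_simps)
  define B where "B = ball (0 :: real^'n) \<rho>"
  have Bn: "norm y < \<rho>" if "y \<in> B" for y using that by (simp add: B_def)
  have Bs: "norm y * (2 * R) < 1" if "y \<in> B" for y
    using mult_strict_right_mono[OF Bn[OF that], of "2 * R"] \<rho>R c by linarith
  obtain e :: "nat \<Rightarrow> ('n \<Rightarrow> nat)" where e: "bij e" using ex_enumeration by blast
  define T where "T j n y = dmono j y (e n) *\<^sub>R c (e n)" for j n y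
  have sumsT: "(\<lambda>n. T j n y) sums pseries (dcoeff j c) y" if "y \<in> B" for j y
    unfolding T_def using termwise_partial_has_sum[OF c Bs[OF that], of j]
    by (intro has_sum_imp_sums) (subst has_sum_reindex_bij_betw[OF e, where f="\<lambda>\<alpha>. dmono j y \<alpha> *\<^sub>R c \<alpha>"], simp)
  have sums0: "(\<lambda>n. mpow y (e n) *\<^sub>R c (e n)) sums pseries c y" if "y \<in> B" for y
  proof -
    have "norm y * R < 1"
      using Bs[OF that] mult_nonneg_nonneg[of "norm y" R] c by simp
    then have "(\<lambda>\<alpha>. mpow y \<alpha> *\<^sub>R c \<alpha>) abs_summable_on UNIV"
      by (intro pseries_abs_summable[where M=M and R=R]) (use c in auto)
    then have "((\<lambda>\<alpha>. mpow y \<alpha> *\<^sub>R c \<alpha>) has_sum pseries c y) UNIV"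
      unfolding pseries_def by (rule has_sum_infsum[OF abs_summable_summable])
    then show ?thesis
      by (intro has_sum_imp_sums) (subst has_sum_reindex_bij_betw[OF e, where f="\<lambda>\<alpha>. mpow y \<alpha> *\<^sub>R c \<alpha>"], simp)
  qed
  have unif: "uniform_limit B (\<lambda>n y. \<Sum>i<n. T j i y) (pseries (dcoeff j c)) sequentially" for j
  proof -
    have "uniform_limit B (\<lambda>n y. \<Sum>i<n. T j i y) (\<lambda>y. suminf (\<lambda>i. T j i y)) sequentially"
    proof (rule Weierstrass_m_test)
      show "norm (T j n y) \<le> M / (2 * \<rho>) * (\<rho> * (2 * R)) ^ mdeg (e n)" if "y \<in> B" for n y
        unfolding T_def by (rule termwise_partial_bound) (use c Bn[OF that] \<open>\<rho> > 0\<close> in auto)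
      have "(\<lambda>\<alpha> :: 'n \<Rightarrow> nat. M / (2 * \<rho>) * (\<rho> * (2 * R)) ^ mdeg \<alpha>) summable_on UNIV"
        by (intro summable_on_cmult_right geometric_summable) (use c \<rho>R \<open>\<rho> > 0\<close> in auto)
      then show "summable (\<lambda>n. M / (2 * \<rho>) * (\<rho> * (2 * R)) ^ mdeg (e n))"
        by (intro summable_on_imp_summable) (subst summable_on_reindex_bij_betw[OF e], simp)
    qed
    then show ?thesis
      by (rule uniform_limit_cong'[THEN iffD1, rotated 2]) (use sums_unique[OF sumsT] in auto)
  qed
  have "\<exists>g. \<forall>y\<in>B. (\<lambda>n. mpow y (e n) *\<^sub>R c (e n)) sums (g y) \<and>
      (g has_derivative (\<lambda>h. \<Sum>j\<in>UNIV. h $ j *\<^sub>R pseries (dcoeff j c) y)) (at y within B)"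
  proof (rule has_derivative_series)
    show "convex B" by (simp add: B_def)
    show "((\<lambda>x. mpow x (e n) *\<^sub>R c (e n)) has_derivative (\<lambda>h. \<Sum>j\<in>UNIV. h $ j *\<^sub>R T j n y)) (at y within B)" for n y
      unfolding T_def
      by (rule has_derivative_eq_rhs[OF has_derivative_scaleR_left[OF mpow_has_derivative]])
         (simp add: scaleR_sum_left)
    show "\<forall>\<^sub>F n in sequentially. \<forall>y\<in>B. \<forall>h. norm ((\<Sum>i<n. \<Sum>j\<in>UNIV. h $ j *\<^sub>R T j i y) -
          (\<Sum>j\<in>UNIV. h $ j *\<^sub>R pseries (dcoeff j c) y)) \<le> \<epsilon> * norm h" if "\<epsilon> > 0" for \<epsilon>
    proof -
      define \<delta> where "\<delta> = \<epsilon> / CARD('n)"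
      have "\<delta> > 0" using that by (simp add: \<delta>_def)
      then have "\<forall>\<^sub>F n in sequentially. \<forall>j. \<forall>y\<in>B. dist (\<Sum>i<n. T j i y) (pseries (dcoeff j c) y) < \<delta>"
        using unif by (intro eventually_all_finite) (auto simp: uniform_limit_iff)
      then show ?thesis
      proof eventually_elim
        case (elim n)
        show ?case
        proof (intro ballI allI)
          fix y h assume "y \<in> B"
          have "(\<Sum>i<n. \<Sum>j\<in>UNIV. h $ j *\<^sub>R T j i y) - (\<Sum>j\<in>UNIV. h $ j *\<^sub>R pseries (dcoeff j c) y)
             = (\<Sum>j\<in>UNIV. h $ j *\<^sub>R ((\<Sum>i<n. T j i y) - pseries (dcoeff j c) y))"
            by (subst sum.swap) (simp add: scaleR_sum_right scaleR_diff_right sum_subtractf)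
          also have "norm \<dots> \<le> (\<Sum>j\<in>(UNIV::'n set). norm h * \<delta>)"
          proof (rule sum_norm_le)
            fix j show "norm (h $ j *\<^sub>R ((\<Sum>i<n. T j i y) - pseries (dcoeff j c) y)) \<le> norm h * \<delta>"
              unfolding norm_scaleR
              using elim \<open>y \<in> B\<close> component_le_norm_cart[of h j]
              by (intro mult_mono) (auto simp: dist_norm intro: less_imp_le)
          qed
          also have "\<dots> = \<epsilon> * norm h" by (simp add: \<delta>_def)
          finally show "norm ((\<Sum>i<n. \<Sum>j\<in>UNIV. h $ j *\<^sub>R T j i y) - (\<Sum>j\<in>UNIV. h $ j *\<^sub>R pseries (dcoeff j c) y)) \<le> \<epsilon> * norm h" .
        qed
      qed
    qed
    show "x \<in> B" using \<rho> by (simp add: B_def)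
    then show "(\<lambda>n. mpow x (e n) *\<^sub>R c (e n)) sums pseries c x" by (rule sums0)
  qed
  then obtain g where g: "\<And>y. y \<in> B \<Longrightarrow> (\<lambda>n. mpow y (e n) *\<^sub>R c (e n)) sums (g y)"
    "\<And>y. y \<in> B \<Longrightarrow> (g has_derivative (\<lambda>h. \<Sum>j\<in>UNIV. h $ j *\<^sub>R pseries (dcoeff j c) y)) (at y within B)"
    by blast
  have "x \<in> B" "open B" using \<rho> by (auto simp: B_def)
  have "(g has_derivative (\<lambda>h. \<Sum>j\<in>UNIV. h $ j *\<^sub>R pseries (dcoeff j c) x)) (at x)"
    using g(2)[OF \<open>x \<in> B\<close>] at_within_open[OF \<open>x \<in> B\<close> \<open>open B\<close>] by simp
  then show ?thesis
    by (rule has_derivative_transform_within_open[OF _ \<open>open B\<close> \<open>x \<in> B\<close>])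
       (use g(1) sums0 sums_unique2 in blast)
qed

definition below :: "('n \<Rightarrow> nat) \<Rightarrow> ('n \<Rightarrow> nat) set" where
  "below \<alpha> = PiE UNIV (\<lambda>i. {..\<alpha> i})"

definition conv :: "(('n \<Rightarrow> nat) \<Rightarrow> real) \<Rightarrow> (('n \<Rightarrow> nat) \<Rightarrow> real) \<Rightarrow> ('n \<Rightarrow> nat) \<Rightarrow> real" where
  "conv c d \<alpha> = (\<Sum>\<gamma>\<in>below \<alpha>. c \<gamma> * d (\<lambda>i. \<alpha> i - \<gamma> i))"

text \<open>
  The function and its Taylor coefficients are kept together, with neighbourhoods left to the filter:
  this avoids all bookkeeping of radii of convergence.
\<close>

definition expansion :: "(real^'n \<Rightarrow> 'b::banach) \<Rightarrow> real^'n \<Rightarrow> (('n \<Rightarrow> nat) \<Rightarrow> 'b) \<Rightarrow> bool" where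
  "expansion f a c \<longleftrightarrow> geometric c \<and> (\<forall>\<^sub>F x in nhds a. f x = pseries c (x - a))"

definition partial :: "'n \<Rightarrow> (real^'n \<Rightarrow> 'b::real_normed_vector) \<Rightarrow> real^'n \<Rightarrow> 'b" where
  "partial j f x = frechet_derivative f (at x) (axis j 1)"

lemma below_iff: "\<gamma> \<in> below \<alpha> \<longleftrightarrow> (\<forall>i. \<gamma> i \<le> \<alpha> i)"
  by (auto simp: below_def PiE_def)

lemma finite_below [simp]: "finite (below (\<alpha> :: 'n::finite \<Rightarrow> nat))"
  unfolding below_def by (rule finite_PiE) auto

lemma mdeg_diff:
  assumes "\<gamma> \<in> below \<alpha>"
  shows "mdeg \<gamma> + mdeg (\<lambda>i. \<alpha> i - \<gamma> i) = mdeg \<alpha>"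
  unfolding mdeg_def sum.distrib[symmetric]
  by (rule sum.cong) (use assms in \<open>auto simp: below_iff\<close>)

lemma mpow_diff:
  assumes "\<gamma> \<in> below \<alpha>"
  shows "mpow x \<gamma> * mpow x (\<lambda>i. \<alpha> i - \<gamma> i) = mpow x \<alpha>"
  unfolding mpow_def prod.distrib[symmetric]
  by (rule prod.cong) (use assms in \<open>auto simp: below_iff simp flip: power_add\<close>)

lemma card_below_le: "card (below \<alpha>) \<le> 2 ^ mdeg (\<alpha> :: 'n::finite \<Rightarrow> nat)"
proof -
  have "card (below \<alpha>) = (\<Prod>i\<in>UNIV. Suc (\<alpha> i))"
    unfolding below_def by (subst card_PiE) auto
  also have "\<dots> \<le> (\<Prod>i\<in>UNIV. 2 ^ \<alpha> i)"
    by (rule prod_mono) (auto intro: Suc_leI less_exp)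
  finally show ?thesis by (simp add: mdeg_def power_sum)
qed

text \<open>
  A finite partial sum near the limit stays near it when one more term is added.
\<close>

lemma has_sum_terms_bounded:
  fixes f :: "'i \<Rightarrow> 'b::real_normed_vector"
  assumes "(f has_sum s) A"
  obtains M where "\<And>a. a \<in> A \<Longrightarrow> norm (f a) \<le> M"
proof -
  have "\<forall>\<^sub>F F in finite_subsets_at_top A. dist (sum f F) s < 1"
    using assms unfolding has_sum_def by (rule tendstoD) simp
  then obtain X where X: "finite X" "X \<subseteq> A"
    "\<And>Y. finite Y \<Longrightarrow> X \<subseteq> Y \<Longrightarrow> Y \<subseteq> A \<Longrightarrow> dist (sum f Y) s < 1"
    unfolding eventually_finite_subsets_at_top by (elim exE conjE) (rule that, auto)
  have "norm (f a) \<le> (\<Sum>x\<in>X. norm (f x)) + 2" if "a \<in> A" for a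
  proof (cases "a \<in> X")
    case True
    then have "norm (f a) \<le> (\<Sum>x\<in>X. norm (f x))" by (intro member_le_sum) (use X in auto)
    then show ?thesis by simp
  next
    case False
    then have "f a = (sum f (insert a X) - s) - (sum f X - s)" using X by simp
    moreover have "dist (sum f (insert a X)) s < 1" "dist (sum f X) s < 1"
      using X(1,2) that by (auto intro!: X(3))
    ultimately have "norm (f a) \<le> 2"
      using norm_triangle_ineq4[of "sum f (insert a X) - s" "sum f X - s"] unfolding dist_norm by simp
    then show ?thesis by (simp add: add_increasing sum_nonneg)
  qed
  then show thesis by (rule that)
qed

text \<open>
  For the forward direction the series is evaluated at one point off all coordinate hyperplanes; its
  terms are bounded there, which is a geometric bound for the coefficients.
\<close>

lemma real_analytic_at_iff_expansion:
  fixes f :: "real^'n \<Rightarrow> 'b::banach"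
  shows "real_analytic_at f a \<longleftrightarrow> (\<exists>c. expansion f a c)"
proof
  assume "real_analytic_at f a"
  then obtain c r where "r > 0" and
    r: "\<And>x. x \<in> ball a r \<Longrightarrow> ((\<lambda>\<alpha>. mpow (x - a) \<alpha> *\<^sub>R c \<alpha>) has_sum f x) UNIV"
    unfolding real_analytic_at_def mpow_def vector_minus_component by blast
  \<comment> \<open>a point of the ball all of whose coordinates differ from those of the centre by the same amount\<close>
  define t where "t = r / (2 * CARD('n))"
  have "t > 0" using \<open>r > 0\<close> by (simp add: t_def)
  define x where "x = a + (\<chi> i. t)"
  have "norm (\<chi> i. t :: real^'n) \<le> (\<Sum>i\<in>(UNIV::'n set). t)"
    using norm_le_l1_cart[of "\<chi> i. t :: real^'n"] \<open>t > 0\<close> by simp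
  also have "\<dots> < r" using \<open>r > 0\<close> by (simp add: t_def)
  finally have "x \<in> ball a r" by (simp add: x_def dist_norm)
  then obtain M where M: "\<And>\<alpha>. norm (mpow (x - a) \<alpha> *\<^sub>R c \<alpha>) \<le> M"
    using has_sum_terms_bounded[OF r] by (metis UNIV_I)
  have "mpow (x - a) \<alpha> = t ^ mdeg \<alpha>" for \<alpha>
    by (simp add: mpow_def x_def mdeg_def power_sum)
  then have *: "t ^ mdeg \<alpha> * norm (c \<alpha>) \<le> M" for \<alpha>
    using M[of \<alpha>] \<open>t > 0\<close> by simp
  have "norm (c \<alpha>) \<le> M * (1 / t) ^ mdeg \<alpha>" for \<alpha>
    using *[of \<alpha>] \<open>t > 0\<close> by (simp add: power_one_over field_simps)
  moreover have "M \<ge> 0" using M norm_ge_zero order_trans by blast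
  moreover have "1 / t > 0" using \<open>t > 0\<close> by simp
  ultimately have "geometric c" unfolding geometric_def by blast
  moreover have "\<forall>\<^sub>F x in nhds a. f x = pseries c (x - a)"
    using eventually_nhds_ball[OF \<open>r > 0\<close>, of a]
    by eventually_elim (use infsumI[OF r] in \<open>auto simp: pseries_def\<close>)
  ultimately show "\<exists>c. expansion f a c" unfolding expansion_def by blast
next
  assume "\<exists>c. expansion f a c"
  then obtain c where "geometric c" and c: "\<forall>\<^sub>F x in nhds a. f x = pseries c (x - a)"
    unfolding expansion_def by blast
  then obtain M R where MR: "M \<ge> 0" "R > 0" "\<And>\<alpha>. norm (c \<alpha>) \<le> M * R ^ mdeg \<alpha>"
    unfolding geometric_def by blast
  from c eventually_small[OF \<open>R > 0\<close>, of a]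
  have "\<forall>\<^sub>F x in nhds a. ((\<lambda>\<alpha>. mpow (x - a) \<alpha> *\<^sub>R c \<alpha>) has_sum f x) UNIV"
  proof eventually_elim
    case (elim x)
    then show ?case
      using has_sum_infsum[OF abs_summable_summable[OF pseries_abs_summable[of c M R "x - a"]]] MR
      by (simp add: pseries_def)
  qed
  then obtain r where "r > 0" "\<forall>x\<in>ball a r. ((\<lambda>\<alpha>. mpow (x - a) \<alpha> *\<^sub>R c \<alpha>) has_sum f x) UNIV"
    unfolding eventually_nhds_metric by (auto simp: dist_commute)
  then show "real_analytic_at f a"
    unfolding real_analytic_at_def mpow_def vector_minus_component by blast
qed

lemma expansion_cong:
  assumes "expansion f a c" "\<forall>\<^sub>F x in nhds a. g x = f x"
  shows "expansion g a c"
  using assms unfolding expansion_def by (auto elim: eventually_elim2)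

lemma expansion_has_sum:
  assumes "expansion f a c"
  shows "\<forall>\<^sub>F x in nhds a. (\<lambda>\<alpha>. norm (mpow (x - a) \<alpha> *\<^sub>R c \<alpha>)) summable_on UNIV \<and>
     ((\<lambda>\<alpha>. mpow (x - a) \<alpha> *\<^sub>R c \<alpha>) has_sum f x) UNIV"
proof -
  obtain M R where MR: "M \<ge> 0" "R > 0" "\<And>\<alpha>. norm (c \<alpha>) \<le> M * R ^ mdeg \<alpha>"
    using assms unfolding geometric_def expansion_def by blast
  have "\<forall>\<^sub>F x in nhds a. f x = pseries c (x - a)" using assms by (simp add: expansion_def)
  with eventually_small[OF \<open>R > 0\<close>, of a] show ?thesis
  proof eventually_elim
    case (elim x)
    then have "(\<lambda>\<alpha>. norm (mpow (x - a) \<alpha> *\<^sub>R c \<alpha>)) summable_on UNIV"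
      by (intro pseries_abs_summable[OF MR(3)]) (use MR in auto)
    from this has_sum_infsum[OF abs_summable_summable[OF this]] elim show ?case
      by (simp add: pseries_def)
  qed
qed

lemma expansionI:
  assumes "geometric c" "\<forall>\<^sub>F x in nhds a. ((\<lambda>\<alpha>. mpow (x - a) \<alpha> *\<^sub>R c \<alpha>) has_sum f x) UNIV"
  shows "expansion f a c"
  unfolding expansion_def
  using assms by (auto elim!: eventually_mono simp: pseries_def dest!: infsumI)

lemma expansion_linear:
  assumes "bounded_linear L" "expansion f a c"
  shows "expansion (\<lambda>x. L (f x)) a (\<lambda>\<alpha>. L (c \<alpha>))"
proof (rule expansionI)
  show "geometric (\<lambda>\<alpha>. L (c \<alpha>))" using assms by (auto simp: expansion_def intro: geometric_linear)
  from expansion_has_sum[OF assms(2)]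
  show "\<forall>\<^sub>F x in nhds a. ((\<lambda>\<alpha>. mpow (x - a) \<alpha> *\<^sub>R L (c \<alpha>)) has_sum L (f x)) UNIV"
    by eventually_elim
       (use has_sum_bounded_linear[OF assms(1)] in \<open>fastforce simp: linear_simps(5)[OF assms(1)]\<close>)
qed

lemma expansion_add:
  assumes "expansion f a c" "expansion g a d"
  shows "expansion (\<lambda>x. f x + g x) a (\<lambda>\<alpha>. c \<alpha> + d \<alpha>)"
proof (rule expansionI)
  show "geometric (\<lambda>\<alpha>. c \<alpha> + d \<alpha>)" using assms by (auto simp: expansion_def intro: geometric_add)
  from expansion_has_sum[OF assms(1)] expansion_has_sum[OF assms(2)]
  show "\<forall>\<^sub>F x in nhds a. ((\<lambda>\<alpha>. mpow (x - a) \<alpha> *\<^sub>R (c \<alpha> + d \<alpha>)) has_sum (f x + g x)) UNIV"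
    by eventually_elim (auto simp: scaleR_add_right intro: has_sum_add)
qed

lemma expansion_const:
  fixes a :: "real^'n" and k :: "'b::banach"
  shows "expansion (\<lambda>_. k) a (\<lambda>\<alpha>. if \<alpha> = (\<lambda>_. 0) then k else 0)"
proof (rule expansionI)
  have "norm (if \<alpha> = (\<lambda>_. 0) then k else 0) \<le> norm k * 1 ^ mdeg \<alpha>" for \<alpha> :: "'n \<Rightarrow> nat" by auto
  then show "geometric (\<lambda>\<alpha> :: 'n \<Rightarrow> nat. if \<alpha> = (\<lambda>_. 0) then k else 0)"
    unfolding geometric_def by (intro exI[of _ "norm k"] exI[of _ 1]) auto
  have "((\<lambda>\<alpha>. mpow (x - a) \<alpha> *\<^sub>R (if \<alpha> = (\<lambda>_. 0) then k else 0)) has_sum k) UNIV" for x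
    by (rule has_sum_finite_neutralI[of "{\<lambda>_. 0}"]) (auto simp: mpow_def)
  then show "\<forall>\<^sub>F x in nhds a. ((\<lambda>\<alpha>. mpow (x - a) \<alpha> *\<^sub>R (if \<alpha> = (\<lambda>_. 0) then k else 0)) has_sum k) UNIV"
    by simp
qed

lemma expansion_zero: "expansion (\<lambda>_. 0) a (\<lambda>_. 0)"
  using expansion_const[of 0 a] by simp

lemma expansion_sum:
  assumes "\<And>i. i \<in> I \<Longrightarrow> expansion (f i) a (c i)"
  shows "expansion (\<lambda>x. \<Sum>i\<in>I. f i x) a (\<lambda>\<alpha>. \<Sum>i\<in>I. c i \<alpha>)"
  using assms by (induction I rule: infinite_finite_induct) (auto intro: expansion_add expansion_zero)

lemma geometric_conv:
  assumes "geometric c" "geometric d"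
  shows "geometric (conv c d)"
proof -
  obtain M R where MR: "M \<ge> 0" "R > 0" and c: "\<And>\<alpha>. norm (c \<alpha>) \<le> M * R ^ mdeg \<alpha>"
    and d: "\<And>\<alpha>. norm (d \<alpha>) \<le> M * R ^ mdeg \<alpha>"
    by (rule geometric_common[OF assms]) (rule that)
  have "norm (conv c d \<alpha>) \<le> (M * M) * (2 * R) ^ mdeg \<alpha>" for \<alpha>
  proof -
    have "norm (conv c d \<alpha>) \<le> (\<Sum>\<gamma>\<in>below \<alpha>. (M * M) * R ^ mdeg \<alpha>)"
      unfolding conv_def
    proof (rule sum_norm_le)
      fix \<gamma> assume \<gamma>: "\<gamma> \<in> below \<alpha>"
      have "norm (c \<gamma> * d (\<lambda>i. \<alpha> i - \<gamma> i)) \<le> (M * R ^ mdeg \<gamma>) * (M * R ^ mdeg (\<lambda>i. \<alpha> i - \<gamma> i))"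
        unfolding norm_mult by (intro mult_mono c d) (use MR in auto)
      also have "\<dots> = (M * M) * R ^ mdeg \<alpha>"
        by (simp add: mdeg_diff[OF \<gamma>, symmetric] power_add)
      finally show "norm (c \<gamma> * d (\<lambda>i. \<alpha> i - \<gamma> i)) \<le> (M * M) * R ^ mdeg \<alpha>" .
    qed
    also have "\<dots> = real (card (below \<alpha>)) * ((M * M) * R ^ mdeg \<alpha>)" by simp
    also have "\<dots> \<le> 2 ^ mdeg \<alpha> * ((M * M) * R ^ mdeg \<alpha>)"
    proof (rule mult_right_mono)
      show "real (card (below \<alpha>)) \<le> 2 ^ mdeg \<alpha>"
        using card_below_le[of \<alpha>] by (metis of_nat_le_iff of_nat_numeral of_nat_power)
    qed (use MR in auto)
    finally show ?thesis by (simp add: power_mult_distrib mult_ac)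
  qed
  moreover have "M * M \<ge> 0" "2 * R > 0" using MR by auto
  ultimately show ?thesis unfolding geometric_def by blast
qed

lemma has_sum_product_real:
  fixes f :: "'i \<Rightarrow> real" and g :: "'j \<Rightarrow> real"
  assumes "(\<lambda>x. norm (f x)) summable_on A" "(f has_sum s) A" "(\<lambda>x. norm (g x)) summable_on B" "(g has_sum t) B"
  shows "((\<lambda>(x, y). f x * g y) has_sum (s * t)) (A \<times> B)"
proof (rule has_sum_SigmaI)
  show "((\<lambda>y. case (x, y) of (x, y) \<Rightarrow> f x * g y) has_sum (f x * t)) B" for x
    using assms(4) by (auto intro: has_sum_cmult_right)
  show "((\<lambda>x. f x * t) has_sum (s * t)) A" using assms(2) by (rule has_sum_cmult_left)
  have "(\<lambda>p. norm (case p of (x, y) \<Rightarrow> f x * g y)) summable_on A \<times> B"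
  proof (subst Infinite_Sum.abs_summable_on_Sigma_iff, intro conjI ballI)
    show "(\<lambda>y. norm (case (x, y) of (x, y) \<Rightarrow> f x * g y)) summable_on B" for x
      using assms(3) by (auto simp: abs_mult intro: summable_on_cmult_right)
    have "(\<lambda>x. norm (norm (f x) * infsum (\<lambda>y. norm (g y)) B)) summable_on A"
      using summable_on_cmult_left[OF assms(1), of "\<bar>infsum (\<lambda>y. norm (g y)) B\<bar>"] by (simp add: abs_mult)
    then show "(\<lambda>x. norm (\<Sum>\<^sub>\<infinity>y\<in>B. norm (case (x, y) of (x, y) \<Rightarrow> f x * g y))) summable_on A"
      by (simp add: abs_mult infsum_cmult_right')
  qed
  then show "(\<lambda>(x, y). f x * g y) summable_on A \<times> B" by (rule abs_summable_summable)
qed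

text \<open>
  The product of the two absolutely convergent series is a series over pairs \<open>(\<gamma>, \<delta>)\<close>.  Regrouping it by
  \<open>\<alpha> = \<gamma> + \<delta>\<close> leaves finite inner sums, the convolution.
\<close>

lemma expansion_mult:
  fixes f g :: "real^'n \<Rightarrow> real"
  assumes "expansion f a c" "expansion g a d"
  shows "expansion (\<lambda>x. f x * g x) a (conv c d)"
proof (rule expansionI)
  show "geometric (conv c d)" using assms by (auto simp: expansion_def intro: geometric_conv)
  from expansion_has_sum[OF assms(1)] expansion_has_sum[OF assms(2)]
  show "\<forall>\<^sub>F x in nhds a. ((\<lambda>\<alpha>. mpow (x - a) \<alpha> *\<^sub>R conv c d \<alpha>) has_sum (f x * g x)) UNIV"
  proof eventually_elim
    case (elim x)
    let ?P = "\<lambda>(\<gamma>, \<delta>). (mpow (x - a) \<gamma> *\<^sub>R c \<gamma>) * (mpow (x - a) \<delta> *\<^sub>R d \<delta>)"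
    let ?Q = "\<lambda>(\<alpha>, \<gamma>). mpow (x - a) \<alpha> * (c \<gamma> * d (\<lambda>i. \<alpha> i - \<gamma> i))"
    have "(?P has_sum (f x * g x)) (UNIV \<times> UNIV)"
      by (intro has_sum_product_real) (use elim in auto)
    also have "?this \<longleftrightarrow> (?Q has_sum (f x * g x)) (Sigma UNIV below)"
    proof (rule has_sum_reindex_bij_witness[where j="\<lambda>(\<gamma>, \<delta>). (\<lambda>i. \<gamma> i + \<delta> i, \<gamma>)"
            and i="\<lambda>(\<alpha>, \<gamma>). (\<gamma>, \<lambda>i. \<alpha> i - \<gamma> i)"])
      fix p :: "('n \<Rightarrow> nat) \<times> ('n \<Rightarrow> nat)"
      obtain \<gamma> \<delta> where p: "p = (\<gamma>, \<delta>)" by (cases p)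
      have "\<gamma> \<in> below (\<lambda>i. \<gamma> i + \<delta> i)" by (simp add: below_iff)
      from mpow_diff[OF this, of "x - a"]
      show "?Q (case p of (\<gamma>, \<delta>) \<Rightarrow> (\<lambda>i. \<gamma> i + \<delta> i, \<gamma>)) = ?P p"
        by (simp add: p mult_ac)
    qed (auto simp: below_iff fun_eq_iff)
    finally show ?case
      by (rule has_sum_SigmaD) (auto simp: conv_def sum_distrib_left)
  qed
qed

lemma expansion_has_derivative:
  assumes "expansion f a c"
  shows "\<forall>\<^sub>F x in nhds a. (f has_derivative (\<lambda>h. \<Sum>j\<in>UNIV. h $ j *\<^sub>R pseries (dcoeff j c) (x - a))) (at x)"
proof -
  obtain M R where MR: "M \<ge> 0" "R > 0" "\<And>\<alpha>. norm (c \<alpha>) \<le> M * R ^ mdeg \<alpha>"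
    using assms unfolding geometric_def expansion_def by blast
  have "\<forall>\<^sub>F x in nhds a. \<forall>\<^sub>F y in nhds x. f y = pseries c (y - a)"
    using assms by (simp add: expansion_def eventually_eventually)
  moreover have "\<forall>\<^sub>F x in nhds a. norm (x - a) * (2 * R) < 1"
    by (rule eventually_small) (use MR in auto)
  ultimately show ?thesis
  proof eventually_elim
    case (elim x)
    have "(pseries c has_derivative (\<lambda>h. \<Sum>j\<in>UNIV. h $ j *\<^sub>R pseries (dcoeff j c) (x - a))) (at (x - a))"
      by (rule pseries_has_derivative[OF MR(3)]) (use MR elim in auto)
    then have "((\<lambda>y. pseries c (y - a)) has_derivative (\<lambda>h. \<Sum>j\<in>UNIV. h $ j *\<^sub>R pseries (dcoeff j c) (x - a))) (at x)"
      by (rule has_derivative_compose[of "\<lambda>y. y - a" "\<lambda>h. h" x UNIV, rotated])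
         (auto intro!: derivative_eq_intros)
    moreover obtain S where "open S" "x \<in> S" "\<And>y. y \<in> S \<Longrightarrow> f y = pseries c (y - a)"
      using elim(1) unfolding eventually_nhds by blast
    ultimately show ?case
      by (metis (no_types, lifting) has_derivative_transform_within_open)
  qed
qed

lemma expansion_partial:
  assumes "expansion f a c"
  shows "expansion (partial j f) a (dcoeff j c)"
  unfolding expansion_def
proof
  show "geometric (dcoeff j c)" using assms by (auto simp: expansion_def intro: geometric_dcoeff)
  from expansion_has_derivative[OF assms]
  show "\<forall>\<^sub>F x in nhds a. partial j f x = pseries (dcoeff j c) (x - a)"
  proof eventually_elim
    case (elim x)
    have "partial j f x = (\<Sum>i\<in>UNIV. axis j 1 $ i *\<^sub>R pseries (dcoeff i c) (x - a))"
      unfolding partial_def frechet_derivative_at[OF elim, symmetric] by (rule refl)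
    also have "\<dots> = (\<Sum>i\<in>UNIV. if i = j then pseries (dcoeff i c) (x - a) else 0)"
      by (rule sum.cong) (auto simp: axis_def)
    finally show ?case by simp
  qed
qed

text \<open>
  Induction on the degree: the constant coefficient is a value of the function, and any other
  coefficient is, up to a positive factor, a coefficient of smaller degree of a partial derivative.
\<close>

lemma expansion_zero_coeffs:
  fixes c :: "('n::finite \<Rightarrow> nat) \<Rightarrow> 'b::banach"
  assumes "expansion (\<lambda>_. 0) a c"
  shows "c \<alpha> = 0"
  using assms
proof (induction "mdeg \<alpha>" arbitrary: \<alpha> c)
  case 0
  then have \<alpha>: "\<alpha> = (\<lambda>_. 0)" by (auto simp: mdeg_def)
  have "\<forall>\<^sub>F x in nhds a. 0 = pseries c (x - a)" using 0 by (simp add: expansion_def)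
  then have "0 = pseries c 0" using eventually_nhds_x_imp_x by fastforce
  also have "pseries c 0 = (\<Sum>\<^sub>\<infinity>\<alpha>\<in>{\<lambda>_. 0}. mpow 0 \<alpha> *\<^sub>R c \<alpha>)"
    unfolding pseries_def
  proof (rule infsum_cong_neutral)
    fix \<alpha> :: "'n \<Rightarrow> nat" assume "\<alpha> \<in> UNIV - {\<lambda>_. 0}"
    then obtain i where "\<alpha> i \<noteq> 0" by auto
    then have "mpow 0 \<alpha> = 0" unfolding mpow_def by (intro prod_zero) (auto intro!: bexI[of _ i])
    then show "mpow 0 \<alpha> *\<^sub>R c \<alpha> = 0" by simp
  qed auto
  also have "\<dots> = c \<alpha>" by (simp add: mpow_def \<alpha>)
  finally show ?case by simp
next
  case (Suc n)
  then have "mdeg \<alpha> \<noteq> 0" by simp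
  then have "\<exists>j. \<alpha> j \<noteq> 0" unfolding mdeg_def by (meson sum.neutral)
  then obtain j \<beta> where \<beta>: "\<alpha> = inc j \<beta>" by (metis inc_cases neq0_conv)
  have "expansion (partial j (\<lambda>_. 0)) a (dcoeff j c)" using Suc.prems by (rule expansion_partial)
  then have "expansion (\<lambda>_. 0) a (dcoeff j c)" by (simp add: partial_def[abs_def])
  moreover have "n = mdeg \<beta>" using Suc.hyps(2) \<beta> by simp
  ultimately have "dcoeff j c \<beta> = 0" using Suc.hyps(1) by blast
  then show ?case by (simp add: dcoeff_def \<beta>)
qed

lemma expansion_unique:
  assumes "expansion f a c" "expansion g a d" "\<forall>\<^sub>F x in nhds a. f x = g x"
  shows "c = d"
proof
  fix \<alpha>
  have "expansion (\<lambda>x. f x + - g x) a (\<lambda>\<alpha>. c \<alpha> + - d \<alpha>)"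
    by (intro expansion_add assms(1) expansion_linear[OF bounded_linear_minus[OF bounded_linear_ident] assms(2)])
  then have "expansion (\<lambda>_. 0) a (\<lambda>\<alpha>. c \<alpha> + - d \<alpha>)"
    by (rule expansion_cong) (use assms(3) in \<open>auto elim: eventually_mono\<close>)
  from expansion_zero_coeffs[OF this, of \<alpha>] show "c \<alpha> = d \<alpha>" by simp
qed

section \<open>Restriction to coordinate slices\<close>

text \<open>
  Functions on the slice \<open>x $ j = a $ j\<close> for \<open>j \<in> Z\<close> are treated as functions on the whole space that do
  not depend on these coordinates, by composing with the projection onto the slice.  On coefficients
  this keeps the multi-indices that vanish on \<open>Z\<close>.
\<close>

definition prj :: "'n set \<Rightarrow> real^'n \<Rightarrow> real^'n \<Rightarrow> real^'n" where
  "prj Z a x = (\<chi> j. if j \<in> Z then a $ j else x $ j)"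

definition restr :: "'n set \<Rightarrow> (('n \<Rightarrow> nat) \<Rightarrow> 'b::zero) \<Rightarrow> ('n \<Rightarrow> nat) \<Rightarrow> 'b" where
  "restr Z c \<alpha> = (if \<forall>j\<in>Z. \<alpha> j = 0 then c \<alpha> else 0)"

lemma prj_nth [simp]: "prj Z a x $ j = (if j \<in> Z then a $ j else x $ j)"
  by (simp add: prj_def)

lemma prj_eq: "(\<forall>j\<in>Z. x $ j = a $ j) \<Longrightarrow> prj Z a x = x"
  by (simp add: vec_eq_iff)

lemma eventually_prj:
  assumes "\<forall>\<^sub>F x in nhds a. P x"
  shows "\<forall>\<^sub>F x in nhds a. P (prj Z a x)"
proof -
  obtain d where "d > 0" and d: "\<And>x. dist x a < d \<Longrightarrow> P x"
    using assms unfolding eventually_nhds_metric by blast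
  have "dist (prj Z a x) a \<le> dist x a" for x
    unfolding dist_norm by (rule norm_le_componentwise_cart) auto
  then show ?thesis unfolding eventually_nhds_metric using d \<open>d > 0\<close> le_less_trans by blast
qed

lemma eventually_slice_iff:
  "(\<forall>\<^sub>F x in nhds a. (\<forall>j\<in>Z. x $ j = a $ j) \<longrightarrow> P x) \<longleftrightarrow> (\<forall>\<^sub>F x in nhds a. P (prj Z a x))"
proof
  assume "\<forall>\<^sub>F x in nhds a. (\<forall>j\<in>Z. x $ j = a $ j) \<longrightarrow> P x"
  from eventually_prj[OF this, of Z] show "\<forall>\<^sub>F x in nhds a. P (prj Z a x)" by simp
next
  assume "\<forall>\<^sub>F x in nhds a. P (prj Z a x)"
  then show "\<forall>\<^sub>F x in nhds a. (\<forall>j\<in>Z. x $ j = a $ j) \<longrightarrow> P x"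
    by eventually_elim (auto simp: prj_eq)
qed

lemma expansion_prj:
  fixes c :: "('n::finite \<Rightarrow> nat) \<Rightarrow> 'b::banach"
  assumes "expansion f a c"
  shows "expansion (\<lambda>x. f (prj Z a x)) a (restr Z c)"
  unfolding expansion_def
proof
  obtain M R where MR: "M \<ge> 0" "R > 0" "\<And>\<alpha>. norm (c \<alpha>) \<le> M * R ^ mdeg \<alpha>"
    using assms unfolding geometric_def expansion_def by blast
  then have "norm (restr Z c \<alpha>) \<le> M * R ^ mdeg \<alpha>" for \<alpha>
    by (simp add: restr_def)
  then show "geometric (restr Z c)" unfolding geometric_def using MR by blast
  have *: "pseries c (prj Z a x - a) = pseries (restr Z c) (x - a)" for x
    unfolding pseries_def
  proof (rule infsum_cong)
    fix \<alpha> :: "'n \<Rightarrow> nat"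
    show "mpow (prj Z a x - a) \<alpha> *\<^sub>R c \<alpha> = mpow (x - a) \<alpha> *\<^sub>R restr Z c \<alpha>"
    proof (cases "\<forall>j\<in>Z. \<alpha> j = 0")
      case True
      have "mpow (prj Z a x - a) \<alpha> = mpow (x - a) \<alpha>"
        unfolding mpow_def by (rule prod.cong) (use True in auto)
      then show ?thesis using True by (simp add: restr_def)
    next
      case False
      then obtain j where "j \<in> Z" "\<alpha> j \<noteq> 0" by blast
      then have "mpow (prj Z a x - a) \<alpha> = 0"
        unfolding mpow_def by (intro prod_zero) (auto intro!: bexI[of _ j])
      then show ?thesis using False by (auto simp: restr_def)
    qed
  qed
  have "\<forall>\<^sub>F x in nhds a. f x = pseries c (x - a)" using assms by (simp add: expansion_def)
  from eventually_prj[OF this, of Z]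
  show "\<forall>\<^sub>F x in nhds a. f (prj Z a x) = pseries (restr Z c) (x - a)" by (simp add: *)
qed

text \<open>
  This turns all statements about vanishing on a slice into statements about coefficients.
\<close>

lemma vanishes_on_slice_iff:
  assumes "expansion f a c"
  shows "(\<forall>\<^sub>F x in nhds a. (\<forall>j\<in>Z. x $ j = a $ j) \<longrightarrow> f x = 0) \<longleftrightarrow> (\<forall>\<alpha>. (\<forall>j\<in>Z. \<alpha> j = 0) \<longrightarrow> c \<alpha> = 0)"
proof -
  have "(\<forall>\<^sub>F x in nhds a. f (prj Z a x) = 0) \<longleftrightarrow> restr Z c = (\<lambda>_. 0)"
  proof
    assume "\<forall>\<^sub>F x in nhds a. f (prj Z a x) = 0"
    then show "restr Z c = (\<lambda>_. 0)"
      by (rule expansion_unique[OF expansion_prj[OF assms] expansion_zero])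
  next
    assume "restr Z c = (\<lambda>_. 0)"
    then have "expansion (\<lambda>x. f (prj Z a x)) a (\<lambda>_. 0)" using expansion_prj[OF assms, of Z] by simp
    then show "\<forall>\<^sub>F x in nhds a. f (prj Z a x) = 0" by (simp add: expansion_def pseries_def)
  qed
  then show ?thesis unfolding eventually_slice_iff by (auto simp: restr_def fun_eq_iff)
qed

lemma dcoeff_restr:
  assumes "j \<notin> Z"
  shows "dcoeff j (restr Z c) = restr Z (dcoeff j c)"
  using assms by (auto simp: dcoeff_def restr_def fun_eq_iff inc_nth)

lemma dcoeff_commute: "dcoeff i (dcoeff j c) = dcoeff j (dcoeff i c)"
proof -
  have "inc j (inc i \<alpha>) = inc i (inc j \<alpha>)" for \<alpha> by (auto simp: inc_def fun_eq_iff)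
  then show ?thesis by (intro ext) (simp add: dcoeff_def inc_nth mult.commute)
qed

section \<open>Linear Cauchy--Kovalevskaya systems\<close>

definition multinom :: "('n::finite \<Rightarrow> nat) \<Rightarrow> real" where
  "multinom \<alpha> = fact (mdeg \<alpha>) / (\<Prod>i\<in>UNIV. fact (\<alpha> i))"

lemma multinom_nonneg: "0 \<le> multinom \<alpha>"
  unfolding multinom_def by (intro divide_nonneg_nonneg prod_nonneg) auto

text \<open>
  The right-hand side does not depend on \<open>j\<close>: on the comparison series all partial derivatives are equally
  large, apart from the weight given to the evolution variable.
\<close>

lemma multinom_inc:
  "real (Suc (\<alpha> j)) * multinom (inc j \<alpha>) = real (Suc (mdeg \<alpha>)) * multinom \<alpha>"
proof -
  have "(\<Prod>i\<in>UNIV. fact (inc j \<alpha> i) :: real) = fact (Suc (\<alpha> j)) * (\<Prod>i\<in>UNIV-{j}. fact (inc j \<alpha> i))"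
    by (subst prod.remove[of UNIV j]) (auto simp: inc_nth)
  also have "(\<Prod>i\<in>UNIV-{j}. fact (inc j \<alpha> i) :: real) = (\<Prod>i\<in>UNIV-{j}. fact (\<alpha> i))"
    by (rule prod.cong) (auto simp: inc_nth)
  also have "fact (Suc (\<alpha> j)) * \<dots> = real (Suc (\<alpha> j)) * (\<Prod>i\<in>UNIV. fact (\<alpha> i))"
    using prod.remove[of UNIV j "\<lambda>i. fact (\<alpha> i) :: real"] by simp
  finally have *: "(\<Prod>i\<in>UNIV. fact (inc j \<alpha> i) :: real) = real (Suc (\<alpha> j)) * (\<Prod>i\<in>UNIV. fact (\<alpha> i))" .
  have "real (Suc k) * (x / (real (Suc k) * p)) = x / p" for k and x p :: real
    by (simp del: of_nat_Suc)
  then show ?thesis unfolding multinom_def * by (simp del: of_nat_Suc add: fact_Suc)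
qed

lemma multinom_le_inc: "multinom \<alpha> \<le> multinom (inc j \<alpha>)"
proof -
  have "\<alpha> j \<le> mdeg \<alpha>" unfolding mdeg_def by (rule member_le_sum) auto
  then have "real (Suc (\<alpha> j)) * multinom \<alpha> \<le> real (Suc (mdeg \<alpha>)) * multinom \<alpha>"
    by (intro mult_right_mono multinom_nonneg) auto
  also have "\<dots> = real (Suc (\<alpha> j)) * multinom (inc j \<alpha>)" by (rule multinom_inc[symmetric])
  finally show ?thesis by (rule mult_left_le_imp_le) simp
qed

lemma multinom_mono: "multinom \<delta> \<le> multinom (\<lambda>i. \<delta> i + \<gamma> i)"
proof (induction "mdeg \<gamma>" arbitrary: \<gamma>)
  case 0
  then have "\<gamma> = (\<lambda>_. 0)" by (auto simp: mdeg_def)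
  then show ?case by simp
next
  case (Suc n)
  then have "mdeg \<gamma> \<noteq> 0" by simp
  then have "\<exists>j. \<gamma> j \<noteq> 0" unfolding mdeg_def by (meson sum.neutral)
  then obtain j \<beta> where \<beta>: "\<gamma> = inc j \<beta>" by (metis inc_cases neq0_conv)
  have "n = mdeg \<beta>" using Suc.hyps(2) \<beta> by simp
  then have "multinom \<delta> \<le> multinom (\<lambda>i. \<delta> i + \<beta> i)" by (rule Suc.hyps(1))
  also have "\<dots> \<le> multinom (inc j (\<lambda>i. \<delta> i + \<beta> i))" by (rule multinom_le_inc)
  also have "inc j (\<lambda>i. \<delta> i + \<beta> i) = (\<lambda>i. \<delta> i + \<gamma> i)" by (auto simp: \<beta> inc_nth)
  finally show ?case .
qed

text \<open>
  Lowering the largest exponent \<open>\<alpha> j\<close> by one divides the multinomial coefficient by \<open>|\<alpha>| / \<alpha> j\<close>, which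
  is at most the number of variables.
\<close>

lemma multinom_le_power: "multinom \<alpha> \<le> real CARD('n) ^ mdeg (\<alpha> :: 'n::finite \<Rightarrow> nat)"
proof (induction "mdeg \<alpha>" arbitrary: \<alpha>)
  case 0
  then have "\<alpha> = (\<lambda>_. 0)" by (auto simp: mdeg_def)
  then show ?case by (simp add: multinom_def mdeg_def)
next
  case (Suc n)
  obtain j where j: "\<And>i. \<alpha> i \<le> \<alpha> j"
    using Max_in[of "range \<alpha>"] Max_ge[of "range \<alpha>"] by (metis finite finite_imageI UNIV_not_empty image_is_empty rangeE rangeI)
  have le: "mdeg \<alpha> \<le> CARD('n) * \<alpha> j"
    unfolding mdeg_def using sum_bounded_above[of UNIV \<alpha> "\<alpha> j"] j by simp
  have "\<alpha> j > 0" using le Suc.hyps(2) by (cases "\<alpha> j = 0") auto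
  then obtain \<beta> where \<beta>: "\<alpha> = inc j \<beta>" by (rule inc_cases)
  have IH: "multinom \<beta> \<le> real CARD('n) ^ mdeg \<beta>"
    by (rule Suc.hyps(1)) (use Suc.hyps(2) \<beta> in simp)
  have "Suc (mdeg \<beta>) \<le> CARD('n) * Suc (\<beta> j)" using le by (simp add: \<beta> inc_nth)
  then have le': "real (Suc (mdeg \<beta>)) \<le> real CARD('n) * real (Suc (\<beta> j))"
    by (metis of_nat_le_iff of_nat_mult)
  have "real (Suc (\<beta> j)) * multinom \<alpha> = real (Suc (mdeg \<beta>)) * multinom \<beta>"
    unfolding \<beta> by (rule multinom_inc)
  also have "\<dots> \<le> (real CARD('n) * real (Suc (\<beta> j))) * real CARD('n) ^ mdeg \<beta>"
    by (intro mult_mono le' IH multinom_nonneg) auto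
  also have "\<dots> = real (Suc (\<beta> j)) * real CARD('n) ^ mdeg \<alpha>" by (simp add: \<beta>)
  finally show ?case by (rule mult_left_le_imp_le) simp
qed

text \<open>
  The coefficients of the right-hand side of a linear system \<open>\<partial>\<^sub>t u = \<Sum> A \<partial>\<^sub>j u + B u + h\<close>, where \<open>j\<close> runs
  over \<open>J\<close>.
\<close>

definition ck_rhs ::
  "('s::finite \<Rightarrow> 's \<Rightarrow> 'n::finite \<Rightarrow> ('n \<Rightarrow> nat) \<Rightarrow> real) \<Rightarrow> ('s \<Rightarrow> 's \<Rightarrow> ('n \<Rightarrow> nat) \<Rightarrow> real) \<Rightarrow>
   ('s \<Rightarrow> ('n \<Rightarrow> nat) \<Rightarrow> real) \<Rightarrow> 'n set \<Rightarrow> ('s \<Rightarrow> ('n \<Rightarrow> nat) \<Rightarrow> real) \<Rightarrow> 's \<Rightarrow> ('n \<Rightarrow> nat) \<Rightarrow> real" where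
  "ck_rhs A B h J c s \<alpha> = (\<Sum>s'\<in>UNIV. \<Sum>j\<in>J. conv (A s s' j) (dcoeff j (c s')) \<alpha>)
     + (\<Sum>s'\<in>UNIV. conv (B s s') (c s') \<alpha>) + h s \<alpha>"

text \<open>
  The coefficients at \<open>\<alpha>\<close> of the right-hand side involve only coefficients of the unknowns with exponent at
  most \<open>\<alpha> t\<close> in the evolution variable, whereas the left-hand side involves the exponent
  \<open>\<alpha> t + 1\<close>.  Hence the system is a recursion on that exponent.
\<close>

lemma ck_rhs_local:
  assumes "t \<notin> J" "\<And>s' \<beta>. \<beta> t \<le> \<alpha> t \<Longrightarrow> c s' \<beta> = d s' \<beta>"
  shows "ck_rhs A B h J c s \<alpha> = ck_rhs A B h J d s \<alpha>"
proof -
  have "conv (A s s' j) (dcoeff j (c s')) \<alpha> = conv (A s s' j) (dcoeff j (d s')) \<alpha>" if "j \<in> J" for s' j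
  proof -
    have "t \<noteq> j" using assms(1) that by auto
    then have "dcoeff j (c s') (\<lambda>i. \<alpha> i - \<gamma> i) = dcoeff j (d s') (\<lambda>i. \<alpha> i - \<gamma> i)" for \<gamma>
      unfolding dcoeff_def using assms(2)[of "inc j (\<lambda>i. \<alpha> i - \<gamma> i)" s'] by (simp add: inc_nth)
    then show ?thesis unfolding conv_def by simp
  qed
  moreover have "conv (B s s') (c s') \<alpha> = conv (B s s') (d s') \<alpha>" for s'
    unfolding conv_def using assms(2) by (intro sum.cong refl arg_cong2[where f="(*)"]) simp
  ultimately show ?thesis unfolding ck_rhs_def by simp
qed

lemma ck_formal_solution:
  fixes A :: "'s::finite \<Rightarrow> 's \<Rightarrow> 'n::finite \<Rightarrow> ('n \<Rightarrow> nat) \<Rightarrow> real"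
  assumes "t \<notin> J"
  obtains c where "\<And>s \<alpha>. \<alpha> t = 0 \<Longrightarrow> c s \<alpha> = 0"
    "\<And>s \<alpha>. dcoeff t (c s) \<alpha> = ck_rhs A B h J c s \<alpha>"
proof -
  define F where "F c = (\<lambda>(s, \<alpha>). if \<alpha> t = 0 then 0
     else ck_rhs A B h J (\<lambda>s \<alpha>. c (s, \<alpha>)) s (\<alpha>(t := \<alpha> t - 1)) / real (\<alpha> t))" for c
  define r where "r = Wellfounded.measure (\<lambda>(s :: 's, \<alpha> :: 'n \<Rightarrow> nat). \<alpha> t)"
  have "F c p = F d p" if "\<forall>q. (q, p) \<in> r \<longrightarrow> c q = d q" for c d p
  proof -
    obtain s \<alpha> where p: "p = (s, \<alpha>)" by (cases p)
    have "ck_rhs A B h J (\<lambda>s \<alpha>. c (s, \<alpha>)) s (\<alpha>(t := \<alpha> t - 1))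
        = ck_rhs A B h J (\<lambda>s \<alpha>. d (s, \<alpha>)) s (\<alpha>(t := \<alpha> t - 1))" if "\<alpha> t \<noteq> 0"
      by (rule ck_rhs_local[OF assms]) (use \<open>\<forall>q. _\<close> that in \<open>auto simp: p r_def\<close>)
    then show ?thesis by (auto simp: F_def p)
  qed
  then have "adm_wf r F" unfolding adm_wf_def by blast
  moreover have "wf r" unfolding r_def by (rule wf_measure)
  ultimately have unroll: "wfrec r F = F (wfrec r F)" by (intro wfrec_fixpoint)
  define c where "c s \<alpha> = wfrec r F (s, \<alpha>)" for s \<alpha>
  have c: "c s \<alpha> = (if \<alpha> t = 0 then 0 else ck_rhs A B h J c s (\<alpha>(t := \<alpha> t - 1)) / real (\<alpha> t))" for s \<alpha>
    unfolding c_def by (subst unroll) (simp add: F_def)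
  show thesis
  proof (rule that)
    show "c s \<alpha> = 0" if "\<alpha> t = 0" for s \<alpha> using c[of s \<alpha>] that by simp
    show "dcoeff t (c s) \<alpha> = ck_rhs A B h J c s \<alpha>" for s \<alpha>
    proof -
      have "(inc t \<alpha>)(t := inc t \<alpha> t - 1) = \<alpha>" by (auto simp: inc_def)
      then show ?thesis unfolding dcoeff_def by (subst c) (simp add: inc_nth)
    qed
  qed
qed

text \<open>
  Multiplication by a series with ratio \<open>R\<close> only costs a constant factor if the other series may grow
  with the ratio \<open>2 R\<close>: the convolution is then a geometric sum of ratio \<open>1/2\<close> in each variable.
\<close>

lemma conv_bound:
  fixes \<beta> :: "'n::finite \<Rightarrow> nat"
  assumes a: "\<And>\<gamma>. \<bar>a \<gamma>\<bar> \<le> M * R ^ mdeg \<gamma>" and "M \<ge> 0" "R > 0" "D \<ge> 0"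
    and d: "\<And>\<gamma>. \<gamma> \<in> below \<beta> \<Longrightarrow> \<bar>d (\<lambda>i. \<beta> i - \<gamma> i)\<bar> * (2 * R) ^ mdeg \<gamma> \<le> D"
  shows "\<bar>conv a d \<beta>\<bar> \<le> M * D * 2 ^ CARD('n)"
proof -
  have "\<bar>conv a d \<beta>\<bar> \<le> (\<Sum>\<gamma>\<in>below \<beta>. \<bar>a \<gamma> * d (\<lambda>i. \<beta> i - \<gamma> i)\<bar>)"
    unfolding conv_def by (rule sum_abs)
  also have "\<dots> \<le> (\<Sum>\<gamma>\<in>below \<beta>. M * D * (1/2) ^ mdeg \<gamma>)"
  proof (rule sum_mono)
    fix \<gamma> assume "\<gamma> \<in> below \<beta>"
    from d[OF this] have "\<bar>d (\<lambda>i. \<beta> i - \<gamma> i)\<bar> \<le> D / (2 * R) ^ mdeg \<gamma>"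
      using \<open>R > 0\<close> by (simp add: pos_le_divide_eq)
    then have "\<bar>a \<gamma> * d (\<lambda>i. \<beta> i - \<gamma> i)\<bar> \<le> (M * R ^ mdeg \<gamma>) * (D / (2 * R) ^ mdeg \<gamma>)"
      unfolding abs_mult using assms(2,3) by (intro mult_mono a) auto
    also have "\<dots> = M * D * (1/2) ^ mdeg \<gamma>"
      using \<open>R > 0\<close> by (simp add: power_mult_distrib power_one_over field_simps)
    finally show "\<bar>a \<gamma> * d (\<lambda>i. \<beta> i - \<gamma> i)\<bar> \<le> M * D * (1/2) ^ mdeg \<gamma>" .
  qed
  also have "\<dots> = M * D * (\<Sum>\<gamma>\<in>below \<beta>. (1/2) ^ mdeg \<gamma>)" by (simp add: sum_distrib_left)
  also have "\<dots> \<le> M * D * (1 / (1 - 1/2)) ^ CARD('n)"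
    using assms by (intro mult_left_mono sum_geometric_le) auto
  finally show ?thesis by simp
qed

text \<open>
  The method of majorants, as an induction on \<open>\<alpha> t\<close> for the bound
  \<open>\<bar>c s \<alpha>\<bar> \<le> M l\<^bsup>\<alpha> t\<^esup> Q\<^bsup>mdeg \<alpha>\<^esup> multinom \<alpha>\<close>.  In the step, every term of the right-hand side is at most a
  fixed multiple of a quantity \<open>D\<close>, and the left-hand side is allowed to be \<open>l D\<close>; the weight \<open>l\<close> is
  chosen to exceed the sum of these multiples.
\<close>

lemma ck_formal_solution_geometric:
  fixes c :: "'s::finite \<Rightarrow> ('n::finite \<Rightarrow> nat) \<Rightarrow> real"
  assumes A: "\<And>s s' j \<alpha>. \<bar>A s s' j \<alpha>\<bar> \<le> M * R ^ mdeg \<alpha>"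
    and B: "\<And>s s' \<alpha>. \<bar>B s s' \<alpha>\<bar> \<le> M * R ^ mdeg \<alpha>"
    and h: "\<And>s \<alpha>. \<bar>h s \<alpha>\<bar> \<le> M * R ^ mdeg \<alpha>"
    and MR: "M \<ge> 0" "R > 0" and "t \<notin> J"
    and c0: "\<And>s \<alpha>. \<alpha> t = 0 \<Longrightarrow> c s \<alpha> = 0"
    and c: "\<And>s \<alpha>. dcoeff t (c s) \<alpha> = ck_rhs A B h J c s \<alpha>"
  shows "geometric (c s)"
proof -
  define Q where "Q = 2 * R"
  define m where "m = real CARD('s)"
  \<comment> \<open>the last three summands pay for the derivative terms, the zero order terms and the inhomogeneity\<close>
  define l where "l = 1 + m * (real (card J) * (M * 2 ^ CARD('n))) + m * (M * 2 ^ CARD('n) / Q) + 1 / Q"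
  have "Q > 0" using MR by (simp add: Q_def)
  have "m \<ge> 0" by (simp add: m_def)
  have "l \<ge> 1" using MR \<open>Q > 0\<close> \<open>m \<ge> 0\<close> by (auto simp: l_def intro!: add_nonneg_nonneg)
  define E where "E \<alpha> = M * l ^ \<alpha> t * Q ^ mdeg \<alpha> * multinom \<alpha>" for \<alpha>
  have E_nonneg: "E \<alpha> \<ge> 0" for \<alpha>
    unfolding E_def using MR \<open>Q > 0\<close> \<open>l \<ge> 1\<close>
    by (intro mult_nonneg_nonneg multinom_nonneg zero_le_power) auto
  have bound: "\<bar>c s \<alpha>\<bar> \<le> E \<alpha>" for s \<alpha>
  proof (induction "\<alpha> t" arbitrary: s \<alpha> rule: less_induct)
    case less
    show ?case
    proof (cases "\<alpha> t = 0")
      case True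
      then show ?thesis using c0 E_nonneg by simp
    next
      case False
      then obtain \<beta> where \<beta>: "\<alpha> = inc t \<beta>" by (metis inc_cases neq0_conv)
      have IH: "\<bar>c s' \<delta>\<bar> \<le> E \<delta>" if "\<delta> t \<le> \<beta> t" for s' \<delta>
        by (rule less) (use that in \<open>simp add: \<beta> inc_nth\<close>)
      define D where "D = M * l ^ \<beta> t * Q ^ Suc (mdeg \<beta>) * (real (Suc (mdeg \<beta>)) * multinom \<beta>)"
      have "D \<ge> 0" unfolding D_def using MR \<open>Q > 0\<close> \<open>l \<ge> 1\<close>
        by (intro mult_nonneg_nonneg multinom_nonneg zero_le_power) auto
      have common: "M * l ^ \<delta> t * Q ^ Suc (mdeg \<delta>) * (k * multinom \<delta>) * Q ^ mdeg \<gamma> \<le> D"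
        if \<gamma>: "\<gamma> \<in> below \<beta>" and \<delta>: "\<delta> = (\<lambda>i. \<beta> i - \<gamma> i)" and k: "0 \<le> k" "k \<le> real (Suc (mdeg \<delta>))" for \<gamma> \<delta> k
      proof -
        have deg: "mdeg \<gamma> + mdeg \<delta> = mdeg \<beta>" unfolding \<delta> using \<gamma> by (rule mdeg_diff)
        have "(\<lambda>i. \<delta> i + \<gamma> i) = \<beta>" using \<gamma> by (auto simp: \<delta> below_iff fun_eq_iff)
        then have "multinom \<delta> \<le> multinom \<beta>" using multinom_mono[of \<delta> \<gamma>] by simp
        then have 1: "k * multinom \<delta> \<le> real (Suc (mdeg \<beta>)) * multinom \<beta>"
          by (intro mult_mono multinom_nonneg) (use k deg in auto)
        have 2: "l ^ \<delta> t \<le> l ^ \<beta> t" using \<open>l \<ge> 1\<close> by (intro power_increasing) (auto simp: \<delta>)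
        have "M * l ^ \<delta> t * Q ^ Suc (mdeg \<delta>) * (k * multinom \<delta>) * Q ^ mdeg \<gamma>
            = M * l ^ \<delta> t * Q ^ Suc (mdeg \<beta>) * (k * multinom \<delta>)"
          by (simp add: deg[symmetric] power_add)
        also have "\<dots> \<le> D" unfolding D_def
          using MR \<open>Q > 0\<close> \<open>l \<ge> 1\<close> k by (intro mult_mono 1 2 mult_nonneg_nonneg multinom_nonneg) auto
        finally show ?thesis .
      qed
      have 1: "\<bar>conv (A s s' j) (dcoeff j (c s')) \<beta>\<bar> \<le> M * D * 2 ^ CARD('n)" if "j \<in> J" for s' j
      proof (rule conv_bound[OF A MR \<open>D \<ge> 0\<close>])
        fix \<gamma> assume \<gamma>: "\<gamma> \<in> below \<beta>"
        define \<delta> where "\<delta> = (\<lambda>i. \<beta> i - \<gamma> i)"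
        have "j \<noteq> t" using that \<open>t \<notin> J\<close> by auto
        then have "\<bar>c s' (inc j \<delta>)\<bar> \<le> E (inc j \<delta>)"
          by (intro IH) (auto simp: inc_nth \<delta>_def)
        then have "\<bar>dcoeff j (c s') \<delta>\<bar> \<le> real (Suc (\<delta> j)) * E (inc j \<delta>)"
          unfolding dcoeff_def by (simp add: abs_mult mult_left_mono)
        also have "\<dots> = M * l ^ \<delta> t * Q ^ Suc (mdeg \<delta>) * (real (Suc (\<delta> j)) * multinom (inc j \<delta>))"
          using \<open>j \<noteq> t\<close> by (simp add: E_def inc_nth)
        also have "\<dots> = M * l ^ \<delta> t * Q ^ Suc (mdeg \<delta>) * (real (Suc (mdeg \<delta>)) * multinom \<delta>)"
          by (simp only: multinom_inc)
        finally have "\<bar>dcoeff j (c s') \<delta>\<bar> * Q ^ mdeg \<gamma>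
            \<le> M * l ^ \<delta> t * Q ^ Suc (mdeg \<delta>) * (real (Suc (mdeg \<delta>)) * multinom \<delta>) * Q ^ mdeg \<gamma>"
          using \<open>Q > 0\<close> by (intro mult_right_mono) auto
        also have "\<dots> \<le> D" by (rule common[OF \<gamma> \<delta>_def]) auto
        finally show "\<bar>dcoeff j (c s') (\<lambda>i. \<beta> i - \<gamma> i)\<bar> * (2 * R) ^ mdeg \<gamma> \<le> D"
          by (simp add: \<delta>_def Q_def)
      qed
      have 2: "\<bar>conv (B s s') (c s') \<beta>\<bar> \<le> M * (D / Q) * 2 ^ CARD('n)" for s'
      proof (rule conv_bound[OF B MR])
        show "0 \<le> D / Q" using \<open>D \<ge> 0\<close> \<open>Q > 0\<close> by simp
        fix \<gamma> assume \<gamma>: "\<gamma> \<in> below \<beta>"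
        define \<delta> where "\<delta> = (\<lambda>i. \<beta> i - \<gamma> i)"
        have "\<bar>c s' \<delta>\<bar> \<le> E \<delta>" by (intro IH) (auto simp: \<delta>_def)
        then have "(\<bar>c s' \<delta>\<bar> * Q ^ mdeg \<gamma>) * Q \<le> (E \<delta> * Q ^ mdeg \<gamma>) * Q"
          using \<open>Q > 0\<close> by (intro mult_right_mono) auto
        also have "\<dots> = M * l ^ \<delta> t * Q ^ Suc (mdeg \<delta>) * (1 * multinom \<delta>) * Q ^ mdeg \<gamma>"
          by (simp add: E_def)
        also have "\<dots> \<le> D" by (rule common[OF \<gamma> \<delta>_def]) auto
        finally show "\<bar>c s' (\<lambda>i. \<beta> i - \<gamma> i)\<bar> * (2 * R) ^ mdeg \<gamma> \<le> D / Q"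
          using \<open>Q > 0\<close> by (simp add: \<delta>_def Q_def pos_le_divide_eq)
      qed
      have 3: "\<bar>h s \<beta>\<bar> \<le> D / Q"
      proof -
        have m1: "1 \<le> multinom \<beta>" using multinom_mono[of "\<lambda>_. 0" \<beta>] by (simp add: multinom_def mdeg_def)
        have "M * R ^ mdeg \<beta> = M * 1 * R ^ mdeg \<beta> * (1 * 1)" by simp
        also have "\<dots> \<le> M * l ^ \<beta> t * Q ^ mdeg \<beta> * (real (Suc (mdeg \<beta>)) * multinom \<beta>)"
          using MR \<open>l \<ge> 1\<close> \<open>Q > 0\<close> m1 by (intro mult_mono power_mono one_le_power mult_nonneg_nonneg) (auto simp: Q_def)
        also have "\<dots> = D / Q" using \<open>Q > 0\<close> by (simp add: D_def)
        finally show ?thesis using h[of s \<beta>] by linarith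
      qed
      have "\<bar>ck_rhs A B h J c s \<beta>\<bar> \<le> \<bar>\<Sum>s'\<in>UNIV. \<Sum>j\<in>J. conv (A s s' j) (dcoeff j (c s')) \<beta>\<bar>
           + \<bar>\<Sum>s'\<in>UNIV. conv (B s s') (c s') \<beta>\<bar> + \<bar>h s \<beta>\<bar>"
        unfolding ck_rhs_def by linarith
      also have "\<dots> \<le> (\<Sum>s'\<in>(UNIV::'s set). \<Sum>j\<in>J. M * D * 2 ^ CARD('n))
           + (\<Sum>s'\<in>(UNIV::'s set). M * (D / Q) * 2 ^ CARD('n)) + D / Q"
        by (intro add_mono 3 order_trans[OF sum_abs] sum_mono 1 2)
      also have "\<dots> = (l - 1) * D"
        by (simp add: l_def m_def algebra_simps)
      also have "\<dots> \<le> l * D" using \<open>D \<ge> 0\<close> by (simp add: algebra_simps)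
      finally have "\<bar>dcoeff t (c s) \<beta>\<bar> \<le> l * D" by (simp add: c)
      also have "l * D = M * l ^ Suc (\<beta> t) * Q ^ Suc (mdeg \<beta>) * (real (Suc (mdeg \<beta>)) * multinom \<beta>)"
        by (simp add: D_def)
      also have "\<dots> = real (Suc (\<beta> t)) * E \<alpha>"
        by (simp only: multinom_inc[symmetric, of _ t] \<beta> E_def mdeg_inc) (simp add: inc_nth)
      finally have "real (Suc (\<beta> t)) * \<bar>c s \<alpha>\<bar> \<le> real (Suc (\<beta> t)) * E \<alpha>"
        by (simp add: dcoeff_def abs_mult \<beta>)
      then show ?thesis by (rule mult_left_le_imp_le) simp
    qed
  qed
  have "norm (c s \<alpha>) \<le> M * (l * Q * real CARD('n)) ^ mdeg \<alpha>" for \<alpha>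
  proof -
    have "\<alpha> t \<le> mdeg \<alpha>" unfolding mdeg_def by (rule member_le_sum) auto
    then have "l ^ \<alpha> t \<le> l ^ mdeg \<alpha>" using \<open>l \<ge> 1\<close> by (rule power_increasing)
    then have "E \<alpha> \<le> M * l ^ mdeg \<alpha> * Q ^ mdeg \<alpha> * real CARD('n) ^ mdeg \<alpha>"
      unfolding E_def using MR \<open>Q > 0\<close> \<open>l \<ge> 1\<close>
      by (intro mult_mono multinom_le_power multinom_nonneg mult_nonneg_nonneg) auto
    then show ?thesis using bound[of s \<alpha>] by (simp add: power_mult_distrib mult_ac)
  qed
  moreover have "l * Q * real CARD('n) > 0" using \<open>l \<ge> 1\<close> \<open>Q > 0\<close> by simp
  ultimately show ?thesis unfolding geometric_def using MR by blast
qed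

lemma geometric_family:
  fixes c :: "'i::finite \<Rightarrow> ('n::finite \<Rightarrow> nat) \<Rightarrow> real"
  assumes "\<And>i. geometric (c i)"
  obtains M R where "M \<ge> 0" "R > 0" "\<And>i \<alpha>. \<bar>c i \<alpha>\<bar> \<le> M * R ^ mdeg \<alpha>"
proof -
  from assms have "\<forall>i. \<exists>M R. M \<ge> 0 \<and> R > 0 \<and> (\<forall>\<alpha>. \<bar>c i \<alpha>\<bar> \<le> M * R ^ mdeg \<alpha>)"
    unfolding geometric_def real_norm_def by blast
  then obtain M R where MR: "\<And>i. M i \<ge> 0" "\<And>i. R i > 0" "\<And>i \<alpha>. \<bar>c i \<alpha>\<bar> \<le> M i * R i ^ mdeg \<alpha>"
    by metis
  have le: "M i \<le> sum M UNIV" "R i \<le> sum R UNIV" for i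
    by (rule member_le_sum; use MR(1,2) in \<open>auto intro: less_imp_le\<close>)+
  show thesis
  proof (rule that)
    show "sum M UNIV \<ge> 0" using MR(1) by (intro sum_nonneg)
    show "sum R UNIV > 0" using MR(2) by (intro sum_pos) auto
    fix i and \<alpha> :: "'n \<Rightarrow> nat"
    have "M i * R i ^ mdeg \<alpha> \<le> sum M UNIV * sum R UNIV ^ mdeg \<alpha>"
      using MR(1,2) by (intro mult_mono power_mono le sum_nonneg zero_le_power) (auto intro: less_imp_le)
    then show "\<bar>c i \<alpha>\<bar> \<le> sum M UNIV * sum R UNIV ^ mdeg \<alpha>"
      using MR(3) order_trans by blast
  qed
qed

lemma expansion_ck_rhs:
  assumes "\<And>s s' j. expansion (A s s' j) a (cA s s' j)" "\<And>s s'. expansion (B s s') a (cB s s')"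
    "\<And>s. expansion (h s) a (ch s)" "\<And>s. expansion (u s) a (c s)" "\<And>s j. j \<in> J \<Longrightarrow> expansion (du s j) a (dcoeff j (c s))"
  shows "expansion (\<lambda>x. (\<Sum>s'\<in>UNIV. \<Sum>j\<in>J. A s s' j x * du s' j x) + (\<Sum>s'\<in>UNIV. B s s' x * u s' x) + h s x)
    a (ck_rhs cA cB ch J c s)"
  unfolding ck_rhs_def[abs_def]
  by (intro expansion_add expansion_sum expansion_mult assms)

lemma expansion_coeffs_eq:
  assumes "expansion f a c" "expansion g a c"
  shows "\<forall>\<^sub>F x in nhds a. f x = g x"
  using assms unfolding expansion_def by (auto elim: eventually_elim2)

text \<open>
  Zero data on the hyperplane suffice for the intended use: other data are subtracted beforehand and
  end up in the inhomogeneous term.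
\<close>

theorem cauchy_kovalevskaya_zero_data:
  fixes A :: "'s::finite \<Rightarrow> 's \<Rightarrow> 'n::finite \<Rightarrow> real^'n \<Rightarrow> real"
  assumes A: "\<And>s s' j. real_analytic_at (A s s' j) a"
    and B: "\<And>s s'. real_analytic_at (B s s') a"
    and h: "\<And>s. real_analytic_at (h s) a" and "t \<notin> J"
  obtains w where "\<And>s. real_analytic_at (w s) a"
    "\<And>s. \<forall>\<^sub>F x in nhds a. x $ t = a $ t \<longrightarrow> w s x = 0"
    "\<And>s. \<forall>\<^sub>F x in nhds a. partial t (w s) x =
       (\<Sum>s'\<in>UNIV. \<Sum>j\<in>J. A s s' j x * partial j (w s') x) + (\<Sum>s'\<in>UNIV. B s s' x * w s' x) + h s x"
proof -
  obtain cA where cA: "\<And>s s' j. expansion (A s s' j) a (cA s s' j)"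
    using A unfolding real_analytic_at_iff_expansion by metis
  obtain cB where cB: "\<And>s s'. expansion (B s s') a (cB s s')"
    using B unfolding real_analytic_at_iff_expansion by metis
  obtain ch where ch: "\<And>s. expansion (h s) a (ch s)"
    using h unfolding real_analytic_at_iff_expansion by metis
  obtain M1 R1 where 1: "M1 \<ge> 0" "R1 > 0"
    "\<And>p \<alpha>. \<bar>(case p of (s, s', j) \<Rightarrow> cA s s' j) \<alpha>\<bar> \<le> M1 * R1 ^ mdeg \<alpha>"
    by (rule geometric_family[of "\<lambda>(s, s', j). cA s s' j"]) (use cA in \<open>auto simp: expansion_def\<close>)
  obtain M2 R2 where 2: "M2 \<ge> 0" "R2 > 0"
    "\<And>p \<alpha>. \<bar>(case p of (s, s') \<Rightarrow> cB s s') \<alpha>\<bar> \<le> M2 * R2 ^ mdeg \<alpha>"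
    by (rule geometric_family[of "\<lambda>(s, s'). cB s s'"]) (use cB in \<open>auto simp: expansion_def\<close>)
  obtain M3 R3 where 3: "M3 \<ge> 0" "R3 > 0" "\<And>s \<alpha>. \<bar>ch s \<alpha>\<bar> \<le> M3 * R3 ^ mdeg \<alpha>"
    by (rule geometric_family[of ch]) (use ch in \<open>auto simp: expansion_def\<close>)
  define M R where "M = M1 + M2 + M3" and "R = R1 + R2 + R3"
  have le: "Mi * Ri ^ k \<le> M * R ^ k" if "0 \<le> Mi" "Mi \<le> M" "0 \<le> Ri" "Ri \<le> R" for Mi Ri and k :: nat
    using that by (intro mult_mono power_mono zero_le_power) auto
  obtain c where c: "\<And>s \<alpha>. \<alpha> t = 0 \<Longrightarrow> c s \<alpha> = 0" "\<And>s \<alpha>. dcoeff t (c s) \<alpha> = ck_rhs cA cB ch J c s \<alpha>"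
    using ck_formal_solution[OF \<open>t \<notin> J\<close>] by metis
  have geo: "geometric (c s)" for s
  proof (rule ck_formal_solution_geometric[OF _ _ _ _ _ \<open>t \<notin> J\<close> c])
    show "\<bar>cA s s' j \<alpha>\<bar> \<le> M * R ^ mdeg \<alpha>" for s s' j \<alpha>
      using 1(3)[of "(s, s', j)" \<alpha>] le[of M1 R1 "mdeg \<alpha>"] 1(1,2) 2(1,2) 3(1,2)
      by (simp add: M_def R_def)
    show "\<bar>cB s s' \<alpha>\<bar> \<le> M * R ^ mdeg \<alpha>" for s s' \<alpha>
      using 2(3)[of "(s, s')" \<alpha>] le[of M2 R2 "mdeg \<alpha>"] 1(1,2) 2(1,2) 3(1,2)
      by (simp add: M_def R_def)
    show "\<bar>ch s \<alpha>\<bar> \<le> M * R ^ mdeg \<alpha>" for s \<alpha>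
      using 3(3)[of s \<alpha>] le[of M3 R3 "mdeg \<alpha>"] 1(1,2) 2(1,2) 3(1,2)
      by (simp add: M_def R_def)
    show "M \<ge> 0" "R > 0" using 1(1,2) 2(1,2) 3(1,2) by (auto simp: M_def R_def)
  qed
  define w where "w s x = pseries (c s) (x - a)" for s x
  have w: "expansion (w s) a (c s)" for s using geo by (simp add: expansion_def w_def)
  show thesis
  proof (rule that)
    show "real_analytic_at (w s) a" for s using w real_analytic_at_iff_expansion by blast
    show "\<forall>\<^sub>F x in nhds a. x $ t = a $ t \<longrightarrow> w s x = 0" for s
      using vanishes_on_slice_iff[OF w, where Z="{t}"] c(1) by simp
    have dw: "expansion (partial j (w s)) a (dcoeff j (c s))" for s j by (rule expansion_partial[OF w])
    have "dcoeff t (c s) = ck_rhs cA cB ch J c s" for s using c(2) by auto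
    with dw[of t] have "expansion (partial t (w s)) a (ck_rhs cA cB ch J c s)" for s by metis
    then show "\<forall>\<^sub>F x in nhds a. partial t (w s) x =
       (\<Sum>s'\<in>UNIV. \<Sum>j\<in>J. A s s' j x * partial j (w s') x) + (\<Sum>s'\<in>UNIV. B s s' x * w s' x) + h s x" for s
      by (rule expansion_coeffs_eq) (intro expansion_ck_rhs cA cB ch w dw)
  qed
qed

text \<open>
  The equation is only required on a slice.  All derivatives that occur are tangential to it, so
  they commute with the restriction to the slice, and the restricted coefficients satisfy a homogeneous
  recursion.
\<close>

theorem cauchy_kovalevskaya_unique_on_slice:
  fixes A :: "'s::finite \<Rightarrow> 's \<Rightarrow> 'n::finite \<Rightarrow> real^'n \<Rightarrow> real"
  assumes A: "\<And>s s' j. real_analytic_at (A s s' j) a"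
    and B: "\<And>s s'. real_analytic_at (B s s') a"
    and u: "\<And>s. real_analytic_at (u s) a"
    and tJ: "t \<notin> J" and Z: "t \<notin> Z" "J \<inter> Z = {}"
    and eq: "\<And>s. \<forall>\<^sub>F x in nhds a. (\<forall>j\<in>Z. x $ j = a $ j) \<longrightarrow> partial t (u s) x =
       (\<Sum>s'\<in>UNIV. \<Sum>j\<in>J. A s s' j x * partial j (u s') x) + (\<Sum>s'\<in>UNIV. B s s' x * u s' x)"
    and init: "\<And>s. \<forall>\<^sub>F x in nhds a. (\<forall>j\<in>insert t Z. x $ j = a $ j) \<longrightarrow> u s x = 0"
  shows "\<forall>\<^sub>F x in nhds a. (\<forall>j\<in>Z. x $ j = a $ j) \<longrightarrow> u s x = 0"
proof -
  obtain cA where cA: "\<And>s s' j. expansion (A s s' j) a (cA s s' j)"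
    using A unfolding real_analytic_at_iff_expansion by metis
  obtain cB where cB: "\<And>s s'. expansion (B s s') a (cB s s')"
    using B unfolding real_analytic_at_iff_expansion by metis
  obtain c where c: "\<And>s. expansion (u s) a (c s)"
    using u unfolding real_analytic_at_iff_expansion by metis
  define rA where "rA s s' j = restr Z (cA s s' j)" for s s' j
  define rB where "rB s s' = restr Z (cB s s')" for s s'
  define v where "v s = restr Z (c s)" for s
  have dv: "expansion (\<lambda>x. partial j (u s) (prj Z a x)) a (dcoeff j (v s))" if "j \<notin> Z" for j s
    unfolding v_def dcoeff_restr[OF that] by (intro expansion_prj expansion_partial c)
  have rec: "dcoeff t (v s) = ck_rhs rA rB (\<lambda>_ _. 0) J v s" for s
  proof (rule expansion_unique[OF dv[OF Z(1)]])
    show "expansion (\<lambda>x. (\<Sum>s'\<in>UNIV. \<Sum>j\<in>J. A s s' j (prj Z a x) * partial j (u s') (prj Z a x))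
         + (\<Sum>s'\<in>UNIV. B s s' (prj Z a x) * u s' (prj Z a x)) + 0) a (ck_rhs rA rB (\<lambda>_ _. 0) J v s)"
      by (rule expansion_ck_rhs)
         (use Z dv in \<open>auto simp: rA_def rB_def v_def intro!: expansion_prj cA cB c expansion_zero\<close>)
    show "\<forall>\<^sub>F x in nhds a. partial t (u s) (prj Z a x) =
         (\<Sum>s'\<in>UNIV. \<Sum>j\<in>J. A s s' j (prj Z a x) * partial j (u s') (prj Z a x))
         + (\<Sum>s'\<in>UNIV. B s s' (prj Z a x) * u s' (prj Z a x)) + 0"
      using eq[of s] unfolding eventually_slice_iff by simp
  qed
  have "v s \<alpha> = 0" for s \<alpha>
  proof (induction "\<alpha> t" arbitrary: s \<alpha> rule: less_induct)
    case less
    show ?case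
    proof (cases "\<alpha> t = 0")
      case True
      then show ?thesis
        using init[of s] vanishes_on_slice_iff[OF c, where Z="insert t Z"] by (auto simp: v_def restr_def)
    next
      case False
      then obtain \<beta> where \<beta>: "\<alpha> = inc t \<beta>" by (metis inc_cases neq0_conv)
      have "ck_rhs rA rB (\<lambda>_ _. 0) J v s \<beta> = ck_rhs rA rB (\<lambda>_ _. 0) J (\<lambda>_ _. 0) s \<beta>"
        by (rule ck_rhs_local[OF tJ], rule less) (auto simp: \<beta> inc_nth)
      also have "\<dots> = 0" by (simp add: ck_rhs_def conv_def dcoeff_def)
      finally have "dcoeff t (v s) \<beta> = 0" by (simp add: rec)
      then show ?thesis by (simp add: dcoeff_def \<beta>)
    qed
  qed
  then show ?thesis unfolding vanishes_on_slice_iff[OF c] v_def restr_def by metis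
qed

section \<open>Analytic functions and partial derivatives\<close>

lemma real_analytic_at_linear:
  fixes f :: "real^'n \<Rightarrow> 'b::banach"
  shows "bounded_linear L \<Longrightarrow> real_analytic_at f a \<Longrightarrow> real_analytic_at (\<lambda>x. (L (f x) :: 'c::banach)) a"
  unfolding real_analytic_at_iff_expansion using expansion_linear by blast

lemma real_analytic_at_add:
  fixes f :: "real^'n \<Rightarrow> 'b::banach"
  shows "real_analytic_at f a \<Longrightarrow> real_analytic_at g a \<Longrightarrow> real_analytic_at (\<lambda>x. f x + g x) a"
  unfolding real_analytic_at_iff_expansion using expansion_add by blast

lemma real_analytic_at_const: "real_analytic_at (\<lambda>_ :: real^'n. k :: 'b::banach) a"
  unfolding real_analytic_at_iff_expansion using expansion_const by blast

lemma real_analytic_at_sum: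
  fixes f :: "'i \<Rightarrow> real^'n \<Rightarrow> 'b::banach"
  shows "(\<And>i. i \<in> I \<Longrightarrow> real_analytic_at (f i) a) \<Longrightarrow> real_analytic_at (\<lambda>x. \<Sum>i\<in>I. f i x) a"
  by (induction I rule: infinite_finite_induct) (auto intro: real_analytic_at_add real_analytic_at_const)

lemma real_analytic_at_mult:
  fixes f g :: "real^'n \<Rightarrow> real"
  shows "real_analytic_at f a \<Longrightarrow> real_analytic_at g a \<Longrightarrow> real_analytic_at (\<lambda>x. f x * g x) a"
  unfolding real_analytic_at_iff_expansion using expansion_mult by blast

lemma real_analytic_at_uminus:
  fixes f :: "real^'n \<Rightarrow> 'b::banach"
  shows "real_analytic_at f a \<Longrightarrow> real_analytic_at (\<lambda>x. - f x) a"
  by (rule real_analytic_at_linear[OF bounded_linear_minus[OF bounded_linear_ident]])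

lemma real_analytic_at_diff:
  fixes f :: "real^'n \<Rightarrow> 'b::banach"
  shows "real_analytic_at f a \<Longrightarrow> real_analytic_at g a \<Longrightarrow> real_analytic_at (\<lambda>x. f x - g x) a"
  using real_analytic_at_add[OF _ real_analytic_at_uminus] by fastforce

lemma real_analytic_at_partial:
  fixes f :: "real^'n \<Rightarrow> 'b::banach"
  shows "real_analytic_at f a \<Longrightarrow> real_analytic_at (partial j f) a"
  unfolding real_analytic_at_iff_expansion using expansion_partial by blast

lemma real_analytic_at_componentwise:
  fixes f :: "real^'n \<Rightarrow> 'b::euclidean_space"
  shows "real_analytic_at f a \<longleftrightarrow> (\<forall>b\<in>Basis. real_analytic_at (\<lambda>x. f x \<bullet> b) a)"
proof
  assume "\<forall>b\<in>Basis. real_analytic_at (\<lambda>x. f x \<bullet> b) a"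
  then have "real_analytic_at (\<lambda>x. \<Sum>b\<in>Basis. (f x \<bullet> b) *\<^sub>R b) a"
    by (intro real_analytic_at_sum real_analytic_at_linear[OF bounded_linear_scaleR_left]) auto
  then show "real_analytic_at f a" by (simp add: euclidean_representation)
qed (auto intro: real_analytic_at_linear[OF bounded_linear_inner_left])

lemma real_analytic_at_inner:
  fixes f g :: "real^'n \<Rightarrow> 'b::euclidean_space"
  assumes "real_analytic_at f a" "real_analytic_at g a"
  shows "real_analytic_at (\<lambda>x. f x \<bullet> g x) a"
  by (subst euclidean_inner) (intro real_analytic_at_sum real_analytic_at_mult real_analytic_at_linear[OF bounded_linear_inner_left] assms)

lemma real_analytic_at_vec:
  fixes f :: "real^'n \<Rightarrow> 'b::euclidean_space^'m"
  shows "real_analytic_at f a \<longleftrightarrow> (\<forall>k. real_analytic_at (\<lambda>x. f x $ k) a)"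
proof
  assume "\<forall>k. real_analytic_at (\<lambda>x. f x $ k) a"
  then show "real_analytic_at f a"
    unfolding real_analytic_at_componentwise[of f]
    by (auto simp: Basis_vec_def inner_axis intro!: real_analytic_at_linear[OF bounded_linear_inner_left])
qed (auto intro: real_analytic_at_linear[OF bounded_linear_vec_nth])

lemma real_analytic_at_Pair:
  fixes f :: "real^'n \<Rightarrow> 'b::banach" and g :: "real^'n \<Rightarrow> 'c::banach"
  assumes "real_analytic_at f a" "real_analytic_at g a"
  shows "real_analytic_at (\<lambda>x. (f x, g x)) a"
proof -
  have "bounded_linear (\<lambda>y :: 'b. (y, 0 :: 'c))" "bounded_linear (\<lambda>y :: 'c. (0 :: 'b, y))"
    by (auto intro: bounded_linear_Pair bounded_linear_ident bounded_linear_zero)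
  from real_analytic_at_add[OF real_analytic_at_linear[OF this(1) assms(1)] real_analytic_at_linear[OF this(2) assms(2)]]
  show ?thesis by simp
qed

lemma real_analytic_at_differentiable:
  fixes f :: "real^'n \<Rightarrow> 'b::banach"
  assumes "real_analytic_at f a"
  shows "\<forall>\<^sub>F x in nhds a. f differentiable (at x)"
proof -
  obtain c where "expansion f a c" using assms real_analytic_at_iff_expansion by blast
  from expansion_has_derivative[OF this] show ?thesis
    by eventually_elim (auto simp: differentiable_def)
qed

lemma partial_commute:
  fixes f :: "real^'n \<Rightarrow> 'b::banach"
  assumes "real_analytic_at f a"
  shows "\<forall>\<^sub>F x in nhds a. partial i (partial j f) x = partial j (partial i f) x"
proof -
  obtain c where c: "expansion f a c" using assms real_analytic_at_iff_expansion by blast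
  have "expansion (partial j (partial i f)) a (dcoeff i (dcoeff j c))"
    unfolding dcoeff_commute[of i] by (intro expansion_partial c)
  then show ?thesis by (intro expansion_coeffs_eq[OF expansion_partial[OF expansion_partial[OF c]]])
qed

lemma partial_linear:
  assumes "bounded_linear L" "f differentiable (at x)"
  shows "partial j (\<lambda>x. L (f x)) x = L (partial j f x)"
proof -
  have "(f has_derivative frechet_derivative f (at x)) (at x)"
    using assms(2) frechet_derivative_works by blast
  from bounded_linear.has_derivative[OF assms(1) this]
  show ?thesis unfolding partial_def by (simp add: frechet_derivative_at[symmetric])
qed

lemma partial_add:
  assumes "f differentiable (at x)" "g differentiable (at x)"
  shows "partial j (\<lambda>x. f x + g x) x = partial j f x + partial j g x"
proof -
  have "(f has_derivative frechet_derivative f (at x)) (at x)" "(g has_derivative frechet_derivative g (at x)) (at x)"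
    using assms frechet_derivative_works by blast+
  from has_derivative_add[OF this]
  show ?thesis unfolding partial_def by (simp add: frechet_derivative_at[symmetric])
qed

lemma partial_inner:
  fixes f g :: "real^'n \<Rightarrow> 'b::euclidean_space"
  assumes "f differentiable (at x)" "g differentiable (at x)"
  shows "partial j (\<lambda>x. f x \<bullet> g x) x = f x \<bullet> partial j g x + partial j f x \<bullet> g x"
proof -
  have "(f has_derivative frechet_derivative f (at x)) (at x)" "(g has_derivative frechet_derivative g (at x)) (at x)"
    using assms frechet_derivative_works by blast+
  from has_derivative_inner[OF this]
  show ?thesis unfolding partial_def by (simp add: frechet_derivative_at[symmetric])
qed

lemma partial_cong:
  assumes "\<forall>\<^sub>F y in nhds x. f y = g y"
  shows "partial j f x = partial j g x"
proof -
  have *: "f x = g x" "\<forall>\<^sub>F y in at x. f y = g y" "\<forall>\<^sub>F y in at x. g y = f y"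
    using eventually_nhds_x_imp_x[OF assms] assms
    by (auto simp: eventually_at_filter elim: eventually_mono)
  have "(f has_derivative D) (at x) \<longleftrightarrow> (g has_derivative D) (at x)" for D
    using has_derivative_transform_eventually[of f D x UNIV g] has_derivative_transform_eventually[of g D x UNIV f] *
    by auto
  then show ?thesis unfolding partial_def frechet_derivative_def by simp
qed

section \<open>Triangular families of linear forms\<close>

text \<open>
  A form \<open>D\<close> that vanishes on the common kernel of a family of forms is a combination of them.  When the
  family is triangular with respect to vectors \<open>w t\<close>, the coefficients are found by elimination from the
  top rank downwards: the coefficient of the top form \<open>L t\<close> must be the value of \<open>D\<close> at \<open>w t\<close>, and
  \<open>D - D (w t) L t\<close> vanishes on the larger kernel of the remaining forms, because a vector \<open>z\<close> in it
  can be moved into the smaller one by subtracting a multiple of \<open>w t\<close>.  No division occurs, so the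
  coefficients depend analytically on \<open>x\<close>, and forms of high rank at which \<open>D\<close> has nothing to
  eliminate receive the coefficient \<open>0\<close>.
\<close>

lemma triangular_combination:
  fixes L :: "'t \<Rightarrow> real^'n \<Rightarrow> 'v::real_vector \<Rightarrow> real" and rank :: "'t \<Rightarrow> nat"
  assumes "finite T" and V: "subspace V" "\<And>t. t \<in> T \<Longrightarrow> w t \<in> V"
    and L: "\<And>t x. linear (L t x)" "\<And>t z. t \<in> T \<Longrightarrow> real_analytic_at (\<lambda>x. L t x z) a"
    and diag: "\<And>t x. t \<in> T \<Longrightarrow> x \<in> U \<Longrightarrow> L t x (w t) = 1"
    and off: "\<And>s t x. s \<in> T \<Longrightarrow> t \<in> T \<Longrightarrow> s \<noteq> t \<Longrightarrow> rank s \<le> rank t \<Longrightarrow> x \<in> U \<Longrightarrow> L s x (w t) = 0"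
    and D: "\<And>x. linear (D x)" "\<And>z. real_analytic_at (\<lambda>x. D x z) a"
    and zero: "\<And>x z. x \<in> U \<Longrightarrow> z \<in> V \<Longrightarrow> (\<And>t. t \<in> T \<Longrightarrow> L t x z = 0) \<Longrightarrow> D x z = 0"
    and high: "\<And>t x. t \<in> T \<Longrightarrow> rank t > \<rho> \<Longrightarrow> x \<in> U \<Longrightarrow> D x (w t) = 0"
  shows "\<exists>c. (\<forall>t\<in>T. real_analytic_at (c t) a) \<and> (\<forall>t\<in>T. \<forall>x\<in>U. rank t > \<rho> \<longrightarrow> c t x = 0) \<and>
     (\<forall>x\<in>U. \<forall>z\<in>V. D x z = (\<Sum>t\<in>T. c t x * L t x z))"
  using \<open>finite T\<close> V(2) L(2) diag off D zero high
proof (induction T arbitrary: D rule: finite_ranking_induct[where f=rank])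
  case empty
  then show ?case by auto
next
  case (insert t T)
  show ?case
  proof (cases "t \<in> T")
    case True
    then have "insert t T = T" by auto
    then show ?thesis using insert.IH[of D] insert.prems by simp
  next
    case False
    define D' where "D' x z = D x z - D x (w t) * L t x z" for x z
    have "\<exists>c. (\<forall>s\<in>T. real_analytic_at (c s) a) \<and> (\<forall>s\<in>T. \<forall>x\<in>U. rank s > \<rho> \<longrightarrow> c s x = 0) \<and>
       (\<forall>x\<in>U. \<forall>z\<in>V. D' x z = (\<Sum>s\<in>T. c s x * L s x z))"
    proof (rule insert.IH)
      show "linear (D' x)" for x
        using insert.prems(5)[of x] L(1)[of t x]
        by (intro linearI) (simp_all add: D'_def linear_add linear_scale algebra_simps)
      show "real_analytic_at (\<lambda>x. D' x z) a" for z
        unfolding D'_def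
        by (intro real_analytic_at_diff real_analytic_at_mult insert.prems(6) insert.prems(2)) auto
      show "D' x z = 0" if x: "x \<in> U" and z: "z \<in> V" and s0: "\<And>s. s \<in> T \<Longrightarrow> L s x z = 0" for x z
      proof -
        define z' where "z' = z - L t x z *\<^sub>R w t"
        have L': "L s x z' = L s x z - L t x z * L s x (w t)" for s
          using L(1)[of s x] by (simp add: z'_def linear_diff linear_scale)
        have "z' \<in> V" unfolding z'_def using V(1) z insert.prems(1)
          by (intro subspace_diff subspace_scale) auto
        moreover have "L s x z' = 0" if "s \<in> insert t T" for s
        proof (cases "s = t")
          case True
          then show ?thesis using insert.prems(3)[of t x] x by (simp add: L')
        next
          case s: False
          then have "L s x (w t) = 0" using that x insert.hyps(2)[of s] by (intro insert.prems(4)) auto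
          then show ?thesis using s that s0 by (simp add: L')
        qed
        ultimately have "D x z' = 0" using insert.prems(7)[OF x] by blast
        then show ?thesis using insert.prems(5)[of x]
          by (simp add: D'_def z'_def linear_diff linear_scale)
      qed
      show "D' x (w s) = 0" if s: "s \<in> T" "rank s > \<rho>" and x: "x \<in> U" for s x
      proof -
        have "rank t > \<rho>" using s insert.hyps(2)[of s] by simp
        then have "D x (w t) = 0" using insert.prems(8)[of t x] x by simp
        then show ?thesis using insert.prems(8)[of s x] s x by (simp add: D'_def)
      qed
    qed (use insert.prems in auto)
    then obtain c where c: "\<forall>s\<in>T. real_analytic_at (c s) a" "\<forall>s\<in>T. \<forall>x\<in>U. rank s > \<rho> \<longrightarrow> c s x = 0"
      "\<forall>x\<in>U. \<forall>z\<in>V. D' x z = (\<Sum>s\<in>T. c s x * L s x z)" by blast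
    define c' where "c' = c(t := \<lambda>x. D x (w t))"
    have "D x z = (\<Sum>s\<in>insert t T. c' s x * L s x z)" if "x \<in> U" "z \<in> V" for x z
    proof -
      have "(\<Sum>s\<in>T. c' s x * L s x z) = (\<Sum>s\<in>T. c s x * L s x z)"
        by (rule sum.cong) (use False in \<open>auto simp: c'_def\<close>)
      moreover have "D' x z = (\<Sum>s\<in>T. c s x * L s x z)" using c(3) that by blast
      ultimately show ?thesis using \<open>finite T\<close> False by (simp add: D'_def) (simp add: c'_def)
    qed
    moreover have "\<forall>s\<in>insert t T. real_analytic_at (c' s) a"
      using c(1) insert.prems(6) by (auto simp: c'_def)
    moreover have "\<forall>s\<in>insert t T. \<forall>x\<in>U. rank s > \<rho> \<longrightarrow> c' s x = 0"
      using c(2) insert.prems(8) by (auto simp: c'_def)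
    ultimately show ?thesis by blast
  qed
qed

section \<open>Positions of coordinates and 1-jets\<close>

lemma pos_less_iff: "pos i < pos j \<longleftrightarrow> i < (j :: 'a::{finite,linorder})"
proof -
  have "pos i < pos j" if "i < j" for i j :: 'a
    unfolding pos_def using that by (intro psubset_card_mono) auto
  then show ?thesis by (metis less_irrefl less_trans linorder_neqE)
qed

lemma pos_le_iff: "pos i \<le> pos j \<longleftrightarrow> i \<le> (j :: 'a::{finite,linorder})"
  using pos_less_iff[of j i] by (simp add: not_less[symmetric])

lemma pos_eq_iff [simp]: "pos i = pos j \<longleftrightarrow> i = (j :: 'a::{finite,linorder})"
  using pos_le_iff[of i j] pos_le_iff[of j i] by auto

lemma pos_bounds: "1 \<le> pos i" "pos i \<le> CARD('a)" for i :: "'a::{finite,linorder}"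
  unfolding pos_def by (auto simp: Suc_le_eq card_gt_0_iff intro!: card_mono)

lemma ex_pos:
  assumes "1 \<le> i" "i \<le> CARD('a)"
  obtains t :: "'a::{finite,linorder}" where "pos t = i"
proof -
  have "card (range (pos :: 'a \<Rightarrow> nat)) = CARD('a)"
    by (rule card_image) (auto intro: injI)
  then have "range (pos :: 'a \<Rightarrow> nat) = {1..CARD('a)}"
    by (intro card_subset_eq) (use pos_bounds in auto)
  then show thesis using assms that by (metis atLeastAtMost_iff imageE)
qed

abbreviation ev_slice :: "'n::{finite,linorder} rvec \<Rightarrow> nat \<Rightarrow> ('n rvec \<Rightarrow> bool) \<Rightarrow> bool" where
  "ev_slice a i P \<equiv> (\<forall>\<^sub>F x in nhds a. (\<forall>j\<in>{j. i < pos j}. x $ j = a $ j) \<longrightarrow> P x)"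

lemma above_pred: "{j. pos t - 1 < pos j} = insert t {j. pos t < pos (j :: 'n::{finite,linorder})}"
  using pos_bounds(1)[of t] by (auto simp: not_less simp flip: pos_eq_iff)

lemma snd_j1: "snd (j1 f x) $ k $ j = partial j f x $ k"
  by (simp add: j1_def jacobian_def matrix_def partial_def)

lemma fst_j1: "fst (j1 f x) = f x"
  by (simp add: j1_def)

lemma inner_jet1:
  fixes C z :: "('n::finite, 'm::finite) jet1"
  shows "C \<bullet> z = (\<Sum>l\<in>UNIV. fst C $ l * fst z $ l) + (\<Sum>l\<in>UNIV. \<Sum>j\<in>UNIV. snd C $ l $ j * snd z $ l $ j)"
  by (simp add: inner_prod_def inner_vec_def)

lemma jet1_eq_iff: "(z :: ('n::finite, 'm::finite) jet1) = z' \<longleftrightarrow>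
    (\<forall>l. fst z $ l = fst z' $ l) \<and> (\<forall>l j. snd z $ l $ j = snd z' $ l $ j)"
  by (auto simp: prod_eq_iff vec_eq_iff)

lemma real_analytic_at_j1:
  assumes "real_analytic_at f a"
  shows "real_analytic_at (j1 f :: _ \<Rightarrow> ('n::finite, 'm::finite) jet1) a"
proof -
  have "real_analytic_at (\<lambda>x. \<chi> k j. partial j f x $ k) a"
    unfolding real_analytic_at_vec vec_lambda_beta
    by (intro allI real_analytic_at_linear[OF bounded_linear_vec_nth] real_analytic_at_partial assms)
  from real_analytic_at_Pair[OF assms this] 
  have "real_analytic_at (\<lambda>x. (f x, \<chi> k j. partial j f x $ k)) a" .
  moreover have "j1 f = (\<lambda>x. (f x, \<chi> k j. partial j f x $ k))"
    by (auto simp: fun_eq_iff jet1_eq_iff fst_j1 snd_j1)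
  ultimately show ?thesis by simp
qed

lemma j1_add:
  assumes "f differentiable (at x)" "g differentiable (at x)"
  shows "j1 (\<lambda>x. f x + g x) x = j1 f x + j1 g x"
  by (simp add: jet1_eq_iff fst_j1 snd_j1 partial_add[OF assms])

lemma partial_vec_nth:
  assumes "f differentiable (at x)"
  shows "partial j (\<lambda>x. f x $ k) x = partial j f x $ k"
  by (rule partial_linear[OF bounded_linear_vec_nth assms])

lemma partial_vanishes_on_slice:
  fixes f :: "real^'n \<Rightarrow> 'b::banach"
  assumes "real_analytic_at f a" "\<forall>\<^sub>F x in nhds a. (\<forall>j\<in>Z. x $ j = a $ j) \<longrightarrow> f x = 0" "t \<notin> Z"
  shows "\<forall>\<^sub>F x in nhds a. (\<forall>j\<in>Z. x $ j = a $ j) \<longrightarrow> partial t f x = 0"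
proof -
  obtain c where c: "expansion f a c" using assms(1) real_analytic_at_iff_expansion by blast
  have "c \<alpha> = 0" if "\<forall>j\<in>Z. \<alpha> j = 0" for \<alpha>
    using assms(2) that unfolding vanishes_on_slice_iff[OF c] by blast
  moreover have "\<forall>j\<in>Z. inc t \<alpha> j = 0" if "\<forall>j\<in>Z. \<alpha> j = 0" for \<alpha>
    using that assms(3) by (auto simp: inc_nth)
  ultimately show ?thesis
    unfolding vanishes_on_slice_iff[OF expansion_partial[OF c]] by (auto simp: dcoeff_def)
qed

definition residual :: "('n, 'm) lin_eq \<Rightarrow> ('n::finite rvec \<Rightarrow> 'm::finite rvec) \<Rightarrow> 'n rvec \<Rightarrow> real" where
  "residual C f x = C x \<bullet> j1 f x"

lemma real_analytic_at_residual:
  assumes "real_analytic_at C a" "real_analytic_at f a"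
  shows "real_analytic_at (residual C f) a"
  unfolding residual_def[abs_def] by (intro real_analytic_at_inner real_analytic_at_j1 assms)

lemma residual_add:
  assumes "real_analytic_at f a" "real_analytic_at g a"
  shows "\<forall>\<^sub>F x in nhds a. residual C (\<lambda>x. f x + g x) x = residual C f x + residual C g x"
  using real_analytic_at_differentiable[OF assms(1)] real_analytic_at_differentiable[OF assms(2)]
  by eventually_elim (simp add: residual_def j1_add inner_add_right)

lemma real_analytic_at_coeff:
  fixes C :: "('n::finite, 'm::finite) lin_eq"
  assumes "real_analytic_at C a"
  shows "real_analytic_at (\<lambda>x. fst (C x) $ l) a" "real_analytic_at (\<lambda>x. snd (C x) $ l $ j) a"
  using real_analytic_at_linear[OF bounded_linear_fst assms] real_analytic_at_linear[OF bounded_linear_snd assms]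
  by (simp_all add: real_analytic_at_vec)

section \<open>Systems in solved form\<close>

locale solved_system =
  fixes U :: "'n::{finite,linorder} rvec set"
    and R :: "'n rvec \<Rightarrow> ('n, 'm::{finite,linorder}) jet1 set"
    and \<beta> :: "nat \<Rightarrow> nat"
    and S :: "'n \<Rightarrow> 'm \<Rightarrow> ('n, 'm) lin_eq"
    and x0 :: "'n rvec"
  assumes open_U: "open U" and x0: "x0 \<in> U" and solved: "solved_form U R \<beta> S"
begin

lemma eventually_U: "\<forall>\<^sub>F x in nhds x0. x \<in> U"
  using open_U x0 by (rule eventually_nhds_in_open)

lemma S_analytic: "principal \<beta> i k \<Longrightarrow> x \<in> U \<Longrightarrow> real_analytic_at (S i k) x"
  using solved unfolding solved_form_def real_analytic_on_def by blast

lemma S_leading: "principal \<beta> i k \<Longrightarrow> x \<in> U \<Longrightarrow> snd (S i k x) $ k $ i = 1"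
  using solved unfolding solved_form_def by blast

lemma S_principal: "principal \<beta> i k \<Longrightarrow> x \<in> U \<Longrightarrow> l \<noteq> k \<Longrightarrow> principal \<beta> i l \<Longrightarrow> snd (S i k x) $ l $ i = 0"
  using solved unfolding solved_form_def by blast

lemma S_higher: "principal \<beta> i k \<Longrightarrow> x \<in> U \<Longrightarrow> i < j \<Longrightarrow> snd (S i k x) $ l $ j = 0"
  using solved unfolding solved_form_def by blast

lemma R_iff: "x \<in> U \<Longrightarrow> z \<in> R x \<longleftrightarrow> (\<forall>i k. principal \<beta> i k \<longrightarrow> S i k x \<bullet> z = 0)"
  using solved unfolding solved_form_def by blast

text \<open>
  Solving the equations of class \<open>t\<close> for their leading derivatives puts the following coefficients on the
  right-hand side.  Both row and column are restricted to the unknowns that the equations of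
  this class are solved for; for all other rows the system reads \<open>\<partial>\<^sub>t u = 0\<close>.
\<close>

definition coeff0 :: "'n \<Rightarrow> 'm \<Rightarrow> 'm \<Rightarrow> 'n rvec \<Rightarrow> real" where
  "coeff0 t k l x = (if principal \<beta> t k \<and> principal \<beta> t l then - (fst (S t k x) $ l) else 0)"

definition coeff1 :: "'n \<Rightarrow> 'm \<Rightarrow> 'm \<Rightarrow> 'n \<Rightarrow> 'n rvec \<Rightarrow> real" where
  "coeff1 t k l j x = (if principal \<beta> t k \<and> principal \<beta> t l then - (snd (S t k x) $ l $ j) else 0)"

lemma coeff0_analytic: "real_analytic_at (coeff0 t k l) x0"
  unfolding coeff0_def[abs_def]
  by (cases "principal \<beta> t k \<and> principal \<beta> t l")
     (auto intro!: real_analytic_at_uminus real_analytic_at_coeff S_analytic x0 real_analytic_at_const)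

lemma coeff1_analytic: "real_analytic_at (coeff1 t k l j) x0"
  unfolding coeff1_def[abs_def]
  by (cases "principal \<beta> t k \<and> principal \<beta> t l")
     (auto intro!: real_analytic_at_uminus real_analytic_at_coeff S_analytic x0 real_analytic_at_const)

text \<open>
  The normal form of an equation of class \<open>t\<close> on jets whose parametric components vanish.  It is used for
  corrections of an approximate solution and for differences of solutions, which have such jets.
\<close>

lemma S_inner_split:
  assumes k: "principal \<beta> t k" and x: "x \<in> U"
    and np: "\<And>l. \<not> principal \<beta> t l \<Longrightarrow> fst z $ l = 0" "\<And>l j. \<not> principal \<beta> t l \<Longrightarrow> j \<le> t \<Longrightarrow> snd z $ l $ j = 0"
  shows "S t k x \<bullet> z = snd z $ k $ t
     - ((\<Sum>l\<in>UNIV. \<Sum>j\<in>{j. j < t}. coeff1 t k l j x * snd z $ l $ j) + (\<Sum>l\<in>UNIV. coeff0 t k l x * fst z $ l))"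
proof -
  have "(\<Sum>l\<in>UNIV. fst (S t k x) $ l * fst z $ l) = - (\<Sum>l\<in>UNIV. coeff0 t k l x * fst z $ l)"
    unfolding sum_negf[symmetric] by (rule sum.cong) (use k np in \<open>auto simp: coeff0_def\<close>)
  moreover have "(\<Sum>j\<in>UNIV. snd (S t k x) $ l $ j * snd z $ l $ j)
      = (if l = k then snd z $ k $ t else 0) - (\<Sum>j\<in>{j. j < t}. coeff1 t k l j x * snd z $ l $ j)" for l
  proof -
    have "(\<Sum>j\<in>UNIV. snd (S t k x) $ l $ j * snd z $ l $ j)
        = (\<Sum>j\<in>insert t {j. j < t}. snd (S t k x) $ l $ j * snd z $ l $ j)"
      using S_higher[OF k x] by (intro sum.mono_neutral_right) (auto simp: not_less)
    also have "\<dots> = snd (S t k x) $ l $ t * snd z $ l $ t + (\<Sum>j\<in>{j. j < t}. snd (S t k x) $ l $ j * snd z $ l $ j)"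
      by (rule sum.insert) auto
    also have "(\<Sum>j\<in>{j. j < t}. snd (S t k x) $ l $ j * snd z $ l $ j)
        = - (\<Sum>j\<in>{j. j < t}. coeff1 t k l j x * snd z $ l $ j)"
      unfolding sum_negf[symmetric] by (rule sum.cong) (use k np in \<open>auto simp: coeff1_def\<close>)
    also have "snd (S t k x) $ l $ t * snd z $ l $ t = (if l = k then snd z $ k $ t else 0)"
      using S_leading[OF k x] S_principal[OF k x, of l] np(2)[of l t] by auto
    finally show ?thesis by simp
  qed
  ultimately show ?thesis by (simp add: inner_jet1 sum_subtractf)
qed

text \<open>
  The correction \<open>g - f\<close> has zero data on the hyperplane and vanishing parametric components, and its
  inhomogeneous term is minus the residual of \<open>f\<close>.
\<close>

lemma solve_class:
  assumes f: "real_analytic_at (f :: 'n rvec \<Rightarrow> 'm rvec) x0"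
  obtains g where "real_analytic_at g x0" "\<forall>\<^sub>F x in nhds x0. x $ t = x0 $ t \<longrightarrow> g x = f x"
    "\<And>k x. \<not> principal \<beta> t k \<Longrightarrow> g x $ k = f x $ k"
    "\<And>k. principal \<beta> t k \<Longrightarrow> \<forall>\<^sub>F x in nhds x0. residual (S t k) g x = 0"
proof -
  define h where "h k x = (if principal \<beta> t k then - residual (S t k) f x else 0)" for k x
  have h: "real_analytic_at (h k) x0" for k
    unfolding h_def[abs_def]
    by (cases "principal \<beta> t k")
       (auto intro!: real_analytic_at_uminus real_analytic_at_residual f S_analytic x0 real_analytic_at_const)
  obtain w where w: "\<And>k. real_analytic_at (w k) x0"
    "\<And>k. \<forall>\<^sub>F x in nhds x0. x $ t = x0 $ t \<longrightarrow> w k x = 0"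
    "\<And>k. \<forall>\<^sub>F x in nhds x0. partial t (w k) x =
       (\<Sum>l\<in>UNIV. \<Sum>j\<in>{j. j < t}. coeff1 t k l j x * partial j (w l) x) + (\<Sum>l\<in>UNIV. coeff0 t k l x * w l x) + h k x"
    by (rule cauchy_kovalevskaya_zero_data[of "coeff1 t" x0 "coeff0 t" h t "{j. j < t}"])
       (use coeff0_analytic coeff1_analytic h in auto)
  define W :: "'n rvec \<Rightarrow> 'm rvec" where "W x = (\<chi> k. if principal \<beta> t k then w k x else 0)" for x
  have Wk: "(\<lambda>x. W x $ k) = (if principal \<beta> t k then w k else (\<lambda>_. 0))" for k by (auto simp: W_def)
  have W: "real_analytic_at W x0"
    unfolding real_analytic_at_vec Wk using w(1) by (auto intro: real_analytic_at_const)
  have dW: "\<forall>\<^sub>F x in nhds x0. \<forall>k j. partial j W x $ k = (if principal \<beta> t k then partial j (w k) x else 0)"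
    using real_analytic_at_differentiable[OF W]
  proof eventually_elim
    case (elim x)
    show ?case
    proof (intro allI)
      fix k j
      have "partial j W x $ k = partial j (\<lambda>x. W x $ k) x" using partial_vec_nth[OF elim] by simp
      then show "partial j W x $ k = (if principal \<beta> t k then partial j (w k) x else 0)"
        unfolding Wk by (simp add: partial_def)
    qed
  qed
  show thesis
  proof (rule that[of "\<lambda>x. f x + W x"])
    show "real_analytic_at (\<lambda>x. f x + W x) x0" using f W by (rule real_analytic_at_add)
    have "\<forall>\<^sub>F x in nhds x0. \<forall>k. x $ t = x0 $ t \<longrightarrow> w k x = 0"
      using w(2) by (intro eventually_all_finite) auto
    then show "\<forall>\<^sub>F x in nhds x0. x $ t = x0 $ t \<longrightarrow> f x + W x = f x"
      by eventually_elim (auto simp: W_def vec_eq_iff)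
    show "(f x + W x) $ k = f x $ k" if "\<not> principal \<beta> t k" for k x
      using that by (simp add: W_def)
    show "\<forall>\<^sub>F x in nhds x0. residual (S t k) (\<lambda>x. f x + W x) x = 0" if k: "principal \<beta> t k" for k
      using residual_add[OF f W, of "S t k"] w(3)[of k] dW eventually_U
    proof eventually_elim
      case (elim x)
      have "residual (S t k) W x = partial t W x $ k -
         ((\<Sum>l\<in>UNIV. \<Sum>j\<in>{j. j < t}. coeff1 t k l j x * partial j W x $ l) + (\<Sum>l\<in>UNIV. coeff0 t k l x * W x $ l))"
        unfolding residual_def
        by (subst S_inner_split[OF k \<open>x \<in> U\<close>]) (use elim in \<open>auto simp: fst_j1 snd_j1 W_def\<close>)
      also have "(\<Sum>l\<in>UNIV. \<Sum>j\<in>{j. j < t}. coeff1 t k l j x * partial j W x $ l)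
          = (\<Sum>l\<in>UNIV. \<Sum>j\<in>{j. j < t}. coeff1 t k l j x * partial j (w l) x)"
        by (intro sum.cong refl) (use elim in \<open>auto simp: coeff1_def\<close>)
      also have "(\<Sum>l\<in>UNIV. coeff0 t k l x * W x $ l) = (\<Sum>l\<in>UNIV. coeff0 t k l x * w l x)"
        by (intro sum.cong refl) (auto simp: coeff0_def W_def)
      finally show ?case using elim k by (simp add: h_def)
    qed
  qed
qed

text \<open>
  On the larger slice the parametric components of \<open>d\<close> are zero, and so are their tangential derivatives; the
  other components satisfy there a homogeneous Cauchy--Kovalevskaya system in \<open>t\<close> with zero data
  on the smaller slice.
\<close>

lemma unique_class:
  assumes d: "real_analytic_at (d :: 'n rvec \<Rightarrow> 'm rvec) x0"
    and eqs: "\<And>k. principal \<beta> t k \<Longrightarrow> ev_slice x0 (pos t) (\<lambda>x. residual (S t k) d x = 0)"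
    and np: "\<And>k. \<not> principal \<beta> t k \<Longrightarrow> ev_slice x0 (pos t) (\<lambda>x. d x $ k = 0)"
    and init: "ev_slice x0 (pos t - 1) (\<lambda>x. d x = 0)"
  shows "ev_slice x0 (pos t) (\<lambda>x. d x = 0)"
proof -
  let ?Z = "{j. pos t < pos j}"
  have comp: "real_analytic_at (\<lambda>x. d x $ k) x0" for k using d real_analytic_at_vec by blast
  have dnp: "ev_slice x0 (pos t) (\<lambda>x. \<forall>k. \<not> principal \<beta> t k \<longrightarrow> d x $ k = 0 \<and> (\<forall>j\<le>t. partial j (\<lambda>x. d x $ k) x = 0))"
  proof -
    have "ev_slice x0 (pos t) (\<lambda>x. \<not> principal \<beta> t k \<longrightarrow> d x $ k = 0 \<and> (\<forall>j. j \<le> t \<longrightarrow> partial j (\<lambda>x. d x $ k) x = 0))" for k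
    proof (cases "principal \<beta> t k")
      case False
      have "ev_slice x0 (pos t) (\<lambda>x. j \<le> t \<longrightarrow> partial j (\<lambda>x. d x $ k) x = 0)" for j
      proof (cases "j \<le> t")
        case True
        then show ?thesis
          using partial_vanishes_on_slice[OF comp np[OF False], of j] by (simp add: not_less pos_le_iff)
      qed auto
      then have "\<forall>\<^sub>F x in nhds x0. \<forall>j. (\<forall>j\<in>?Z. x $ j = x0 $ j) \<longrightarrow> j \<le> t \<longrightarrow> partial j (\<lambda>x. d x $ k) x = 0"
        by (intro eventually_all_finite) auto
      with np[OF False] show ?thesis by eventually_elim auto
    qed auto
    then have "\<forall>\<^sub>F x in nhds x0. \<forall>k. (\<forall>j\<in>?Z. x $ j = x0 $ j) \<longrightarrow>
       \<not> principal \<beta> t k \<longrightarrow> d x $ k = 0 \<and> (\<forall>j. j \<le> t \<longrightarrow> partial j (\<lambda>x. d x $ k) x = 0)"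
      by (intro eventually_all_finite) auto
    then show ?thesis by eventually_elim auto
  qed
  have "ev_slice x0 (pos t) (\<lambda>x. d x $ k = 0)" for k
  proof (rule cauchy_kovalevskaya_unique_on_slice[where A="coeff1 t" and B="coeff0 t" and t=t and J="{j. j < t}"])
    show "{j. j < t} \<inter> ?Z = {}" by (auto simp: pos_less_iff)
    show "ev_slice x0 (pos t) (\<lambda>x. partial t (\<lambda>x. d x $ k) x =
        (\<Sum>l\<in>UNIV. \<Sum>j\<in>{j. j < t}. coeff1 t k l j x * partial j (\<lambda>x. d x $ l) x) +
        (\<Sum>l\<in>UNIV. coeff0 t k l x * d x $ l))" for k
    proof (cases "principal \<beta> t k")
      case True
      from eqs[OF True] dnp eventually_U real_analytic_at_differentiable[OF d] show ?thesis
      proof eventually_elim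
        case (elim x)
        show ?case
        proof
          assume Z: "\<forall>j\<in>?Z. x $ j = x0 $ j"
          have p: "partial j (\<lambda>x. d x $ l) x = partial j d x $ l" for l j by (rule partial_vec_nth) fact
          have "residual (S t k) d x = 0" using elim Z by auto
          moreover have "residual (S t k) d x = partial t d x $ k -
            ((\<Sum>l\<in>UNIV. \<Sum>j\<in>{j. j < t}. coeff1 t k l j x * partial j d x $ l) + (\<Sum>l\<in>UNIV. coeff0 t k l x * d x $ l))"
            unfolding residual_def
            by (subst S_inner_split[OF True \<open>x \<in> U\<close>]) (use elim Z in \<open>auto simp: fst_j1 snd_j1 p\<close>)
          ultimately show "partial t (\<lambda>x. d x $ k) x =
            (\<Sum>l\<in>UNIV. \<Sum>j\<in>{j. j < t}. coeff1 t k l j x * partial j (\<lambda>x. d x $ l) x) +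
            (\<Sum>l\<in>UNIV. coeff0 t k l x * d x $ l)" by (simp add: p)
        qed
      qed
    next
      case False
      from dnp show ?thesis by eventually_elim (use False in \<open>auto simp: coeff1_def coeff0_def\<close>)
    qed
    show "\<forall>\<^sub>F x in nhds x0. (\<forall>j\<in>insert t ?Z. x $ j = x0 $ j) \<longrightarrow> d x $ k = 0" for k
      using init unfolding above_pred by eventually_elim auto
  qed (use coeff0_analytic coeff1_analytic comp in auto)
  then have "\<forall>\<^sub>F x in nhds x0. \<forall>k. (\<forall>j\<in>?Z. x $ j = x0 $ j) \<longrightarrow> d x $ k = 0"
    by (intro eventually_all_finite) auto
  then show ?thesis by eventually_elim (auto simp: vec_eq_iff)
qed

end

section \<open>The compatibility relations\<close>

text \<open>
  In the last component \<open>i\<close> is the inner and \<open>j\<close> the outer derivative, the order in which the formal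
  derivative \<open>d\<^sub>j\<close> of an equation produces them.
\<close>

definition j2 :: "('n::finite rvec \<Rightarrow> 'm::finite rvec) \<Rightarrow> 'n rvec \<Rightarrow> ('n, 'm) jet2" where
  "j2 g x = (g x, (\<chi> k j. partial j g x $ k), (\<chi> k i j. partial j (partial i g) x $ k))"

lemma j2_j1: "(fst (j2 g x), fst (snd (j2 g x))) = j1 g x"
  by (simp add: j2_def jet1_eq_iff fst_j1 snd_j1)

lemma formal_deriv_eq:
  "formal_deriv j C x z = partial j C x \<bullet> (fst z, fst (snd z))
     + C x \<bullet> (\<chi> k. fst (snd z) $ k $ j, \<chi> k i. snd (snd z) $ k $ i $ j)"
  by (simp add: formal_deriv_def partial_def split_beta)

lemma linear_formal_deriv: "linear (formal_deriv j C x)"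
  by (intro linearI) (simp_all add: formal_deriv_eq inner_jet1 algebra_simps sum.distrib sum_distrib_left)

lemma linear_inner_jet1: "linear (\<lambda>z :: ('n::finite, 'm::finite) jet2. C \<bullet> (fst z, fst (snd z)))"
  by (intro linearI) (simp_all add: inner_jet1 algebra_simps sum.distrib sum_distrib_left)

lemma real_analytic_at_formal_deriv:
  assumes "real_analytic_at C a"
  shows "real_analytic_at (\<lambda>x. formal_deriv j C x z) a"
  unfolding formal_deriv_eq
  by (intro real_analytic_at_add real_analytic_at_inner real_analytic_at_partial real_analytic_at_const assms)

lemma formal_deriv_j2:
  fixes C :: "('n::finite, 'm::finite) lin_eq"
  assumes C: "real_analytic_at C a" and g: "real_analytic_at g a"
  shows "\<forall>\<^sub>F x in nhds a. formal_deriv j C x (j2 g x) = partial j (residual C g) x"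
proof -
  have "\<forall>\<^sub>F x in nhds a. \<forall>i. partial i g differentiable (at x)"
    by (intro eventually_all_finite real_analytic_at_differentiable real_analytic_at_partial g)
  with real_analytic_at_differentiable[OF C] real_analytic_at_differentiable[OF real_analytic_at_j1[OF g]]
  show ?thesis
  proof eventually_elim
    case (elim x)
    have "fst (partial j (j1 g) x) = partial j (\<lambda>x. fst (j1 g x)) x"
      by (rule partial_linear[symmetric, OF bounded_linear_fst elim(2)])
    then have 1: "fst (partial j (j1 g) x) = partial j g x" by (simp add: fst_j1)
    have 2: "snd (partial j (j1 g) x) $ l $ i = partial j (partial i g) x $ l" for l i
    proof -
      have "snd (partial j (j1 g) x) $ l $ i = partial j (\<lambda>x. snd (j1 g x) $ l $ i) x"
        by (rule partial_linear[symmetric, OF _ elim(2)])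
           (intro bounded_linear_compose[OF bounded_linear_vec_nth] bounded_linear_snd)
      also have "\<dots> = partial j (partial i g) x $ l"
        using elim(3) by (simp add: snd_j1 partial_vec_nth)
      finally show ?thesis .
    qed
    have "partial j (j1 g) x = (\<chi> k. partial j g x $ k, \<chi> k i. partial j (partial i g) x $ k)"
      using 1 2 by (simp add: jet1_eq_iff)
    then have "partial j (residual C g) x
        = C x \<bullet> (\<chi> k. partial j g x $ k, \<chi> k i. partial j (partial i g) x $ k) + partial j C x \<bullet> j1 g x"
      unfolding residual_def[abs_def] using partial_inner[OF elim(1,2), of j] by simp
    then show ?case unfolding formal_deriv_eq j2_j1 by (simp add: j2_def)
  qed
qed

lemma sum_delta2:
  fixes f :: "'a::finite \<Rightarrow> 'b::finite \<Rightarrow> real"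
  shows "(\<Sum>k'\<in>UNIV. \<Sum>i\<in>UNIV. f k' i * (if k' = k \<and> i = l then 1 else 0)) = f k l"
proof -
  have "(\<Sum>i\<in>UNIV. f k' i * (if k' = k \<and> i = l then 1 else 0)) = (if k' = k then f k l else 0)" for k'
    by (cases "k' = k") (auto simp: if_distrib[of "\<lambda>x. _ * x"] cong: if_cong)
  then show ?thesis by simp
qed

lemma inner_jet1_axis:
  fixes C :: "('n::finite, 'm::finite) jet1"
  shows "C \<bullet> (0, axis k (axis l 1)) = snd C $ k $ l"
proof -
  have "axis k (axis l (1::real)) $ k' $ i = (if k' = k \<and> i = l then 1 else 0)" for k' :: 'm and i :: 'n
    by (auto simp: axis_def)
  then show ?thesis by (simp add: inner_jet1 sum_delta2)
qed

lemma formal_deriv_axis1: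
  fixes C :: "('n::finite, 'm::finite) lin_eq"
  shows "formal_deriv j C x (0, axis k (axis l 1), 0) = snd (partial j C x) $ k $ l + (if j = l then fst (C x) $ k else 0)"
proof -
  have "axis k (axis l (1::real)) $ k' $ j = (if k' = k then if j = l then 1 else 0 else 0)" for k' :: 'm
    by (auto simp: axis_def)
  then show ?thesis
    by (auto simp: formal_deriv_eq inner_jet1_axis) (auto simp: inner_jet1 if_distrib[of "\<lambda>x. _ * x"] cong: if_cong)
qed

text \<open>
  The unit vector of the symmetric second order jets in the direction of \<open>y\<^sup>k\<close> differentiated in \<open>l\<close> and \<open>j\<close>.
\<close>

definition sym_axis :: "'m \<Rightarrow> 'n \<Rightarrow> 'n \<Rightarrow> real^'n^'n^'m" where
  "sym_axis k l j = (\<chi> k' a b. if k' = k \<and> (a = l \<and> b = j \<or> a = j \<and> b = l) then 1 else 0)"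

lemma formal_deriv_axis2:
  fixes C :: "('n::finite, 'm::finite) lin_eq"
  shows "formal_deriv i C x (0, 0, sym_axis k l j) =
     (if i = j then snd (C x) $ k $ l else if i = l then snd (C x) $ k $ j else 0)"
proof -
  define m where "m = (if i = j then l else j)"
  define d :: real where "d = (if i = j \<or> i = l then 1 else 0)"
  have "formal_deriv i C x (0, 0, sym_axis k l j)
      = (\<Sum>k'\<in>UNIV. \<Sum>a\<in>UNIV. snd (C x) $ k' $ a * sym_axis k l j $ k' $ a $ i)"
    by (simp add: formal_deriv_eq inner_jet1)
  also have "\<dots> = (\<Sum>k'\<in>UNIV. \<Sum>a\<in>UNIV. (d * snd (C x) $ k' $ a) * (if k' = k \<and> a = m then 1 else 0))"
    by (intro sum.cong refl) (auto simp: sym_axis_def d_def m_def)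
  also have "\<dots> = d * snd (C x) $ k $ m" by (rule sum_delta2)
  finally show ?thesis by (auto simp: d_def m_def)
qed

text \<open>
  Ranks are pairs (class, direction) in lexicographic order, coded as numbers with base \<open>n + 1\<close>.
\<close>

lemma rank_le_cases:
  fixes a b n r r' :: nat
  assumes "a * Suc n + r \<le> b * Suc n + r'" "r' \<le> n"
  shows "a < b \<or> a = b \<and> r \<le> r'"
proof (rule ccontr)
  assume *: "\<not> ?thesis"
  show False
  proof (cases "a > b")
    case True
    then have "Suc b * Suc n \<le> a * Suc n" by (intro mult_right_mono) auto
    then show False using assms by simp
  qed (use * assms in auto)
qed

context solved_system
begin

text \<open>
  A coefficient that vanishes identically on the open set \<open>U\<close> has vanishing derivatives there.
\<close>

lemma S_higher_partial:
  assumes "principal \<beta> l k" "x \<in> U" "l < l'"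
  shows "snd (partial j (S l k) x) $ k' $ l' = 0"
proof -
  have "S l k differentiable (at x)"
    using real_analytic_at_differentiable[OF S_analytic[OF assms(1,2)]] by (rule eventually_nhds_x_imp_x)
  then have "snd (partial j (S l k) x) $ k' $ l' = partial j (\<lambda>x. snd (S l k x) $ k' $ l') x"
    by (intro partial_linear[symmetric] bounded_linear_compose[OF bounded_linear_vec_nth] bounded_linear_snd)
  also have "\<forall>\<^sub>F y in nhds x. snd (S l k y) $ k' $ l' = 0"
    using eventually_nhds_in_open[OF open_U assms(2)]
    by eventually_elim (use S_higher[OF assms(1) _ assms(3)] in auto)
  then have "partial j (\<lambda>x. snd (S l k x) $ k' $ l') x = partial j (\<lambda>_. 0) x" by (rule partial_cong)
  finally show ?thesis by (simp add: partial_def)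
qed

text \<open>
  Indices of the equations together with their multiplicative derivatives: \<open>((l, k), None)\<close> stands for
  the equation of class \<open>l\<close> with leading unknown \<open>k\<close>, and \<open>((l, k), Some j)\<close> for its derivative in \<open>j\<close>.
  They are triangular with respect to their leading jets if they are ordered by class, and
  within a class by the direction of differentiation, with the equation itself first.
\<close>

definition mult_index :: "(('n \<times> 'm) \<times> 'n option) set" where
  "mult_index = {((l, k), jo). principal \<beta> l k \<and> (\<forall>j. jo = Some j \<longrightarrow> j \<le> l)}"

fun mult_eq :: "('n \<times> 'm) \<times> 'n option \<Rightarrow> 'n rvec \<Rightarrow> ('n, 'm) jet2 \<Rightarrow> real" where
  "mult_eq ((l, k), None) x z = S l k x \<bullet> (fst z, fst (snd z))"
| "mult_eq ((l, k), Some j) x z = formal_deriv j (S l k) x z"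

fun mult_lead :: "('n \<times> 'm) \<times> 'n option \<Rightarrow> ('n, 'm) jet2" where
  "mult_lead ((l, k), None) = (0, axis k (axis l 1), 0)"
| "mult_lead ((l, k), Some j) = (0, 0, sym_axis k l j)"

fun mult_rank :: "('n \<times> 'm) \<times> 'n option \<Rightarrow> nat" where
  "mult_rank ((l, k), None) = pos l * Suc CARD('n)"
| "mult_rank ((l, k), Some j) = pos l * Suc CARD('n) + pos j"

definition sym_jets :: "('n, 'm) jet2 set" where
  "sym_jets = {z. \<forall>k i j. snd (snd z) $ k $ i $ j = snd (snd z) $ k $ j $ i}"

lemma mult_eq_lead_diag:
  assumes "\<tau> \<in> mult_index" "x \<in> U"
  shows "mult_eq \<tau> x (mult_lead \<tau>) = 1"
proof -
  obtain l k jo where \<tau>: "\<tau> = ((l, k), jo)" by (metis surj_pair)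
  then show ?thesis
    using assms S_leading[of l k x]
    by (cases jo) (auto simp: mult_index_def inner_jet1_axis formal_deriv_axis2)
qed

text \<open>
  If the class of \<open>\<sigma>\<close> is smaller than that of \<open>\<tau>\<close>, the leading jet of \<open>\<tau>\<close> does not occur, because no index
  in a multiplicative derivative exceeds the class of the equation.  If both classes are \<open>l\<close>, the leading
  jet \<open>y\<^sub>l\<^sub>j\<close> of \<open>\<tau>\<close> does not come from a direction less than \<open>j\<close>, and in the direction \<open>j\<close> its coefficient
  is that of a leading derivative of another equation of the class, which is \<open>0\<close> in solved form.
\<close>

lemma mult_eq_lead_off:
  assumes \<sigma>: "\<sigma> \<in> mult_index" and \<tau>: "\<tau> \<in> mult_index" and ne: "\<sigma> \<noteq> \<tau>"
    and rank: "mult_rank \<sigma> \<le> mult_rank \<tau>" and x: "x \<in> U"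
  shows "mult_eq \<sigma> x (mult_lead \<tau>) = 0"
proof -
  obtain l' k' io where s: "\<sigma> = ((l', k'), io)" by (metis surj_pair)
  obtain l k jo where t: "\<tau> = ((l, k), jo)" by (metis surj_pair)
  have pr: "principal \<beta> l' k'" "principal \<beta> l k" using \<sigma> \<tau> by (auto simp: s t mult_index_def)
  have r: "l' < l \<or> l' = l \<and> (case io of None \<Rightarrow> 0 | Some i \<Rightarrow> pos i) \<le> (case jo of None \<Rightarrow> 0 | Some j \<Rightarrow> pos j)"
  proof -
    have "mult_rank ((l, k), jo) = pos l * Suc CARD('n) + (case jo of None \<Rightarrow> 0 | Some j \<Rightarrow> pos j)" for l k and jo :: "'n option"
      by (cases jo) auto
    moreover have "(case jo of None \<Rightarrow> 0 | Some j \<Rightarrow> pos j) \<le> CARD('n)"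
      using pos_bounds(2) by (auto split: option.split)
    ultimately show ?thesis using rank rank_le_cases unfolding s t by (metis pos_less_iff pos_eq_iff)
  qed
  have zero: "snd (S l' k' x) $ k $ l = 0" if "l' < l \<or> l' = l \<and> k' \<noteq> k"
    using that S_higher[OF pr(1) x, of l k] S_principal[OF pr(1) x, of k] pr by auto
  show ?thesis
  proof (cases jo)
    case None
    show ?thesis
    proof (cases io)
      case None
      then show ?thesis using \<open>jo = None\<close> zero r ne by (auto simp: s t inner_jet1_axis)
    next
      case (Some i)
      have "l' < l" using r pos_bounds(1)[of i] by (simp add: Some \<open>jo = None\<close>)
      moreover have "i \<le> l'" using \<sigma> by (simp add: s Some mult_index_def)
      ultimately show ?thesis
        using S_higher_partial[OF pr(1) x, of l i k] by (auto simp: s t Some None formal_deriv_axis1)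
    qed
  next
    case (Some j)
    have jl: "j \<le> l" using \<tau> by (simp add: t Some mult_index_def)
    show ?thesis
    proof (cases io)
      case None
      then show ?thesis using Some by (auto simp: s t simp flip: zero_prod_def)
    next
      case io: (Some i)
      have il: "i \<le> l'" using \<sigma> by (simp add: s io mult_index_def)
      from r consider "l' < l" | "l' = l" "i \<le> j" by (auto simp: io Some pos_le_iff)
      then show ?thesis
      proof cases
        case 1
        then show ?thesis using il zero by (auto simp: s t io Some formal_deriv_axis2)
      next
        case 2
        then show ?thesis using ne zero jl by (auto simp: s t io Some formal_deriv_axis2)
      qed
    qed
  qed
qed

text \<open>
  Involutivity says that the form on the left vanishes on the common kernel of the multiplicative ones,
  so that it is a combination of these.  Classes above \<open>t\<close> do not occur, because a derivative in \<open>t\<close> of an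
  equation of class below \<open>t\<close> contains no jet with an index above \<open>t\<close>.
\<close>

lemma compatibility_relation:
  assumes inv: "involutive U \<beta> S" and lk: "principal \<beta> l k" "l < t"
  obtains c where "\<And>\<tau>. real_analytic_at (c \<tau>) x0"
    "\<And>x z. x \<in> U \<Longrightarrow> z \<in> sym_jets \<Longrightarrow> formal_deriv t (S l k) x z =
       (\<Sum>\<tau>\<in>{\<tau> \<in> mult_index. fst (fst \<tau>) \<le> t}. c \<tau> x * mult_eq \<tau> x z)"
proof -
  have "\<exists>c. (\<forall>\<tau>\<in>mult_index. real_analytic_at (c \<tau>) x0) \<and>
     (\<forall>\<tau>\<in>mult_index. \<forall>x\<in>U. mult_rank \<tau> > pos t * Suc CARD('n) + CARD('n) \<longrightarrow> c \<tau> x = 0) \<and>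
     (\<forall>x\<in>U. \<forall>z\<in>sym_jets. formal_deriv t (S l k) x z = (\<Sum>\<tau>\<in>mult_index. c \<tau> x * mult_eq \<tau> x z))"
  proof (rule triangular_combination[where w=mult_lead and rank=mult_rank])
    show "finite mult_index" by simp
    show "subspace sym_jets" by (auto simp: subspace_def sym_jets_def)
    show "mult_lead \<tau> \<in> sym_jets" for \<tau>
      by (cases \<tau> rule: mult_lead.cases) (auto simp: sym_jets_def sym_axis_def)
    show "linear (mult_eq \<tau> x)" for \<tau> x
      by (cases \<tau> rule: mult_lead.cases)
         (auto simp: mult_eq.simps[abs_def] linear_formal_deriv linear_inner_jet1)
    show "real_analytic_at (\<lambda>x. mult_eq \<tau> x z) x0" if "\<tau> \<in> mult_index" for \<tau> z
      using that by (cases \<tau> rule: mult_lead.cases)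
        (auto simp: mult_index_def intro!: real_analytic_at_formal_deriv real_analytic_at_inner real_analytic_at_const S_analytic x0)
    show "linear (formal_deriv t (S l k) x)" for x by (rule linear_formal_deriv)
    show "real_analytic_at (\<lambda>x. formal_deriv t (S l k) x z) x0" for z
      by (intro real_analytic_at_formal_deriv S_analytic lk x0)
    show "formal_deriv t (S l k) x z = 0"
      if x: "x \<in> U" and z: "z \<in> sym_jets" and 0: "\<And>\<tau>. \<tau> \<in> mult_index \<Longrightarrow> mult_eq \<tau> x z = 0" for x z
    proof -
      obtain y p q where ypq: "z = (y, p, q)" by (metis surj_pair)
      have 1: "S i k x \<bullet> (y, p) = 0" if "principal \<beta> i k" for i k
        using 0[of "((i, k), None)"] that by (simp add: mult_index_def ypq)
      have 2: "formal_deriv j (S i k) x (y, p, q) = 0" if "principal \<beta> i k" "j \<le> i" for i j k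
        using 0[of "((i, k), Some j)"] that by (simp add: mult_index_def ypq)
      have "z \<in> prolonged_by (\<lambda>i j. j \<le> i) \<beta> S x"
        using z 1 2 by (simp add: prolonged_by_def ypq sym_jets_def)
      then have "z \<in> prolonged_by (\<lambda>i j. True) \<beta> S x"
        using inv x unfolding involutive_def by blast
      then show ?thesis using lk(1) by (simp add: prolonged_by_def ypq)
    qed
    show "formal_deriv t (S l k) x (mult_lead \<tau>) = 0"
      if \<tau>: "\<tau> \<in> mult_index" and r: "mult_rank \<tau> > pos t * Suc CARD('n) + CARD('n)" and x: "x \<in> U" for \<tau> x
    proof -
      obtain l' k' jo where t: "\<tau> = ((l', k'), jo)" by (metis surj_pair)
      have "t < l'"
      proof (rule ccontr)
        assume "\<not> t < l'"
        then have "pos l' * Suc CARD('n) \<le> pos t * Suc CARD('n)"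
          by (intro mult_right_mono) (auto simp: pos_le_iff)
        moreover have "mult_rank \<tau> \<le> pos l' * Suc CARD('n) + CARD('n)"
          using pos_bounds(2) by (cases jo) (auto simp: t)
        ultimately show False using r by linarith
      qed
      then have "l < l'" using lk by simp
      then show ?thesis
        using \<open>t < l'\<close> S_higher[OF lk(1) x \<open>l < l'\<close>] S_higher_partial[OF lk(1) x \<open>l < l'\<close>]
        by (cases jo) (auto simp: t formal_deriv_axis1 formal_deriv_axis2)
    qed
  qed (use mult_eq_lead_diag mult_eq_lead_off in auto)
  then obtain c where c: "\<And>\<tau>. \<tau> \<in> mult_index \<Longrightarrow> real_analytic_at (c \<tau>) x0"
     "\<And>\<tau> x. \<tau> \<in> mult_index \<Longrightarrow> x \<in> U \<Longrightarrow> mult_rank \<tau> > pos t * Suc CARD('n) + CARD('n) \<Longrightarrow> c \<tau> x = 0"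
     "\<And>x z. x \<in> U \<Longrightarrow> z \<in> sym_jets \<Longrightarrow> formal_deriv t (S l k) x z = (\<Sum>\<tau>\<in>mult_index. c \<tau> x * mult_eq \<tau> x z)"
    by blast
  show thesis
  proof (rule that[of "\<lambda>\<tau>. if \<tau> \<in> mult_index then c \<tau> else (\<lambda>_. 0)"])
    show "real_analytic_at (if \<tau> \<in> mult_index then c \<tau> else (\<lambda>_. 0)) x0" for \<tau>
      using c(1) by (auto intro: real_analytic_at_const)
    fix x z assume x: "x \<in> U" and z: "z \<in> sym_jets"
    have "c \<tau> x = 0" if "\<tau> \<in> mult_index" "\<not> fst (fst \<tau>) \<le> t" for \<tau>
    proof (rule c(2)[OF that(1) x])
      obtain l' k' jo where t: "\<tau> = ((l', k'), jo)" by (metis surj_pair)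
      have "pos t < pos l'" using that(2) by (simp add: t pos_less_iff not_le)
      then have "Suc (pos t) * Suc CARD('n) \<le> pos l' * Suc CARD('n)" by (intro mult_right_mono) auto
      moreover have "pos l' * Suc CARD('n) \<le> mult_rank \<tau>" by (cases jo) (auto simp: t)
      ultimately show "mult_rank \<tau> > pos t * Suc CARD('n) + CARD('n)" by simp
    qed
    then have "(\<Sum>\<tau>\<in>mult_index. c \<tau> x * mult_eq \<tau> x z)
        = (\<Sum>\<tau>\<in>{\<tau> \<in> mult_index. fst (fst \<tau>) \<le> t}. c \<tau> x * mult_eq \<tau> x z)"
      by (intro sum.mono_neutral_right) auto
    also have "\<dots> = (\<Sum>\<tau>\<in>{\<tau> \<in> mult_index. fst (fst \<tau>) \<le> t}. (if \<tau> \<in> mult_index then c \<tau> else (\<lambda>_. 0)) x * mult_eq \<tau> x z)"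
      by (rule sum.cong) auto
    finally show "formal_deriv t (S l k) x z =
        (\<Sum>\<tau>\<in>{\<tau> \<in> mult_index. fst (fst \<tau>) \<le> t}. (if \<tau> \<in> mult_index then c \<tau> else (\<lambda>_. 0)) x * mult_eq \<tau> x z)"
      using c(3)[OF x z] by simp
  qed
qed

lemma j2_sym:
  assumes "real_analytic_at (g :: 'n rvec \<Rightarrow> 'm rvec) x0"
  shows "\<forall>\<^sub>F x in nhds x0. j2 g x \<in> sym_jets"
proof -
  have "\<forall>\<^sub>F x in nhds x0. \<forall>i j. partial i (partial j g) x = partial j (partial i g) x"
    by (intro eventually_all_finite partial_commute assms)
  then show ?thesis by eventually_elim (simp add: sym_jets_def j2_def)
qed

lemma mult_eq_j2:
  assumes g: "real_analytic_at (g :: 'n rvec \<Rightarrow> 'm rvec) x0"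
  shows "\<forall>\<^sub>F x in nhds x0. \<forall>\<tau>\<in>mult_index. mult_eq \<tau> x (j2 g x) =
     (case \<tau> of ((l, k), None) \<Rightarrow> residual (S l k) g x | ((l, k), Some j) \<Rightarrow> partial j (residual (S l k) g) x)"
proof (rule eventually_ball_finite)
  show "\<forall>\<tau>\<in>mult_index. \<forall>\<^sub>F x in nhds x0. mult_eq \<tau> x (j2 g x) =
     (case \<tau> of ((l, k), None) \<Rightarrow> residual (S l k) g x | ((l, k), Some j) \<Rightarrow> partial j (residual (S l k) g) x)"
  proof
    fix \<tau> assume \<tau>: "\<tau> \<in> mult_index"
    obtain l k jo where t: "\<tau> = ((l, k), jo)" by (metis surj_pair)
    have lk: "principal \<beta> l k" using \<tau> by (simp add: t mult_index_def)
    show "\<forall>\<^sub>F x in nhds x0. mult_eq \<tau> x (j2 g x) =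
     (case \<tau> of ((l, k), None) \<Rightarrow> residual (S l k) g x | ((l, k), Some j) \<Rightarrow> partial j (residual (S l k) g) x)"
    proof (cases jo)
      case None
      then show ?thesis by (simp add: t j2_j1 residual_def)
    next
      case (Some j)
      then show ?thesis using formal_deriv_j2[OF S_analytic[OF lk x0] g, of j] by (simp add: t)
    qed
  qed
qed simp

text \<open>
  On the 2-jet of \<open>g\<close> the compatibility relations become a homogeneous system
  \<open>\<partial>\<^sub>t e = \<Sum> A \<partial>\<^sub>j e + B e\<close> for the residuals \<open>e\<close> of the equations of class below \<open>t\<close>: the
  contributions of class \<open>t\<close> vanish near \<open>x\<^sub>0\<close>, and the remaining multiplicative directions \<open>j\<close> are less
  than \<open>t\<close>.
\<close>

lemma residuals_vanish:
  assumes inv: "involutive U \<beta> S" and g: "real_analytic_at (g :: 'n rvec \<Rightarrow> 'm rvec) x0"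
    and cls: "\<And>k. principal \<beta> t k \<Longrightarrow> \<forall>\<^sub>F x in nhds x0. residual (S t k) g x = 0"
    and low: "\<And>l k. principal \<beta> l k \<Longrightarrow> l < t \<Longrightarrow> ev_slice x0 (pos t - 1) (\<lambda>x. residual (S l k) g x = 0)"
    and lk: "principal \<beta> l k" "l < t"
  shows "ev_slice x0 (pos t) (\<lambda>x. residual (S l k) g x = 0)"
proof -
  define good where "good s \<longleftrightarrow> principal \<beta> (fst s) (snd s) \<and> fst s < t" for s :: "'n \<times> 'm"
  let ?rel = "\<lambda>s c. (\<forall>\<tau>. real_analytic_at (c \<tau>) x0) \<and>
    (\<forall>x\<in>U. \<forall>z\<in>sym_jets. formal_deriv t (S (fst s) (snd s)) x z =
       (\<Sum>\<tau>\<in>{\<tau> \<in> mult_index. fst (fst \<tau>) \<le> t}. c \<tau> x * mult_eq \<tau> x z))"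
  have "\<forall>s. \<exists>c. good s \<longrightarrow> ?rel s c"
  proof
    fix s
    show "\<exists>c. good s \<longrightarrow> ?rel s c"
    proof (cases "good s")
      case True
      then have s: "principal \<beta> (fst s) (snd s)" "fst s < t" by (auto simp: good_def)
      obtain c where "\<And>\<tau>. real_analytic_at (c \<tau>) x0"
        "\<And>x z. x \<in> U \<Longrightarrow> z \<in> sym_jets \<Longrightarrow> formal_deriv t (S (fst s) (snd s)) x z =
           (\<Sum>\<tau>\<in>{\<tau> \<in> mult_index. fst (fst \<tau>) \<le> t}. c \<tau> x * mult_eq \<tau> x z)"
        by (rule compatibility_relation[OF inv s]) (rule that)
      then show ?thesis by blast
    qed simp
  qed
  then obtain c where rel: "\<And>s. good s \<Longrightarrow> ?rel s (c s)" by (rule choice[THEN exE]) blast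
  have c: "real_analytic_at (c s \<tau>) x0" if "good s" for s \<tau>
    using rel[OF that] by (elim conjE) (erule spec)
  have c': "formal_deriv t (S (fst s) (snd s)) x z =
       (\<Sum>\<tau>\<in>{\<tau> \<in> mult_index. fst (fst \<tau>) \<le> t}. c s \<tau> x * mult_eq \<tau> x z)"
    if "good s" "x \<in> U" "z \<in> sym_jets" for s x z
    using rel[OF that(1)] that(2,3) by (elim conjE) (drule (1) bspec, drule (1) bspec)
  define A where "A s s' j = (if good s \<and> good s' \<and> j \<le> fst s' then c s (s', Some j) else (\<lambda>_. 0))" for s s' j
  define B where "B s s' = (if good s \<and> good s' then c s (s', None) else (\<lambda>_. 0))" for s s'
  define u where "u s = (if good s then residual (S (fst s) (snd s)) g else (\<lambda>_. 0))" for s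
  have res: "real_analytic_at (residual (S l k) g) x0" if "principal \<beta> l k" for l k
    by (intro real_analytic_at_residual S_analytic that x0 g)
  have clsd: "\<forall>\<^sub>F x in nhds x0. \<forall>k. principal \<beta> t k \<longrightarrow> residual (S t k) g x = 0 \<and> (\<forall>j. partial j (residual (S t k) g) x = 0)"
  proof (rule eventually_all_finite)
    fix k
    show "\<forall>\<^sub>F x in nhds x0. principal \<beta> t k \<longrightarrow> residual (S t k) g x = 0 \<and> (\<forall>j. partial j (residual (S t k) g) x = 0)"
    proof (cases "principal \<beta> t k")
      case True
      have "\<forall>\<^sub>F x in nhds x0. partial j (residual (S t k) g) x = 0" for j
        using partial_vanishes_on_slice[OF res[OF True], of "{}" j] cls[OF True] by simp
      then have "\<forall>\<^sub>F x in nhds x0. \<forall>j. partial j (residual (S t k) g) x = 0" by (rule eventually_all_finite)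
      with cls[OF True] show ?thesis by eventually_elim auto
    qed auto
  qed
  have "ev_slice x0 (pos t) (\<lambda>x. u (l, k) x = 0)"
  proof (rule cauchy_kovalevskaya_unique_on_slice[where A=A and B=B and t=t and J="{j. j < t}"])
    show "real_analytic_at (A s s' j) x0" for s s' j
      using c by (auto simp: A_def intro: real_analytic_at_const)
    show "real_analytic_at (B s s') x0" for s s'
      using c by (auto simp: B_def intro: real_analytic_at_const)
    show "real_analytic_at (u s) x0" for s
      using res by (auto simp: u_def good_def intro: real_analytic_at_const)
    show "{j. j < t} \<inter> {j. pos t < pos j} = {}" by (auto simp: pos_less_iff)
    show "\<forall>\<^sub>F x in nhds x0. (\<forall>j\<in>insert t {j. pos t < pos j}. x $ j = x0 $ j) \<longrightarrow> u s x = 0" for s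
      using low[of "fst s" "snd s"] unfolding above_pred by (auto simp: u_def good_def)
    show "ev_slice x0 (pos t) (\<lambda>x. partial t (u s) x =
         (\<Sum>s'\<in>UNIV. \<Sum>j\<in>{j. j < t}. A s s' j x * partial j (u s') x) + (\<Sum>s'\<in>UNIV. B s s' x * u s' x))" for s
    proof (cases "good s")
      case False
      then show ?thesis by (simp add: A_def B_def u_def partial_def)
    next
      case True
      have s: "principal \<beta> (fst s) (snd s)" using True by (simp add: good_def)
      show ?thesis
        using eventually_U j2_sym[OF g] mult_eq_j2[OF g] clsd formal_deriv_j2[OF S_analytic[OF s x0] g, of t]
      proof eventually_elim
        case (elim x)
        \<comment> \<open>The sum over multiplicative indices, extended by zero to all indices and reduced to class below \<open>t\<close>.\<close>
        define G where "G s' jo = (if good s' \<and> (\<forall>j. jo = Some j \<longrightarrow> j \<le> fst s')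
           then c s (s', jo) x * (case jo of None \<Rightarrow> u s' x | Some j \<Rightarrow> partial j (u s') x) else 0)" for s' jo
        have G: "(if \<tau> \<in> {\<tau> \<in> mult_index. fst (fst \<tau>) \<le> t} then c s \<tau> x * mult_eq \<tau> x (j2 g x) else 0) = G (fst \<tau>) (snd \<tau>)" for \<tau>
        proof -
          obtain l k jo where \<tau>: "\<tau> = ((l, k), jo)" by (metis surj_pair)
          consider "\<tau> \<notin> mult_index" | "\<tau> \<in> mult_index" "l < t" | "\<tau> \<in> mult_index" "l = t" | "\<tau> \<in> mult_index" "\<not> l \<le> t"
            by fastforce
          then show ?thesis
          proof cases
            case 1
            then show ?thesis by (auto simp: G_def good_def \<tau> mult_index_def)
          next
            case 2
            then have lk: "good (l, k)" by (auto simp: good_def mult_index_def \<tau>)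
            then have "mult_eq \<tau> x (j2 g x) = (case jo of None \<Rightarrow> u (l, k) x | Some j \<Rightarrow> partial j (u (l, k)) x)"
              using bspec[OF elim(3) 2(1)] by (cases jo) (auto simp: \<tau> u_def simp del: mult_eq.simps)
            then show ?thesis using 2 lk by (auto simp: G_def \<tau> mult_index_def simp del: mult_eq.simps)
          next
            case 3
            then have "principal \<beta> t k" by (auto simp: mult_index_def \<tau>)
            then have "mult_eq \<tau> x (j2 g x) = 0" using 3 elim(3,4) by (cases jo) (auto simp: \<tau>)
            then show ?thesis using 3 by (simp add: G_def good_def \<tau>)
          next
            case 4
            then show ?thesis by (auto simp: G_def good_def \<tau>)
          qed
        qed
        have "partial t (u s) x = formal_deriv t (S (fst s) (snd s)) x (j2 g x)"
          using elim(5) True by (simp add: u_def)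
        also have "\<dots> = (\<Sum>\<tau>\<in>{\<tau> \<in> mult_index. fst (fst \<tau>) \<le> t}. c s \<tau> x * mult_eq \<tau> x (j2 g x))"
          by (rule c'[OF True elim(1,2)])
        also have "\<dots> = (\<Sum>\<tau>\<in>UNIV. G (fst \<tau>) (snd \<tau>))"
          unfolding G[symmetric] by (simp add: sum.If_cases)
        also have "\<dots> = (\<Sum>s'\<in>UNIV. \<Sum>jo\<in>UNIV. G s' jo)"
          unfolding sum.cartesian_product by (simp add: split_beta)
        also have "\<dots> = (\<Sum>s'\<in>UNIV. G s' None + (\<Sum>j\<in>UNIV. G s' (Some j)))"
          by (simp add: UNIV_option_conv sum.reindex)
        also have "\<dots> = (\<Sum>s'\<in>UNIV. B s s' x * u s' x + (\<Sum>j\<in>{j. j < t}. A s s' j x * partial j (u s') x))"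
        proof (rule sum.cong[OF refl], rule arg_cong2[where f="(+)"])
          fix s'
          show "G s' None = B s s' x * u s' x" using True by (simp add: G_def B_def)
          have "(\<Sum>j\<in>UNIV. G s' (Some j)) = (\<Sum>j\<in>{j. j < t}. G s' (Some j))"
            by (rule sum.mono_neutral_right) (auto simp: G_def good_def)
          also have "\<dots> = (\<Sum>j\<in>{j. j < t}. A s s' j x * partial j (u s') x)"
            by (rule sum.cong) (use True in \<open>auto simp: G_def A_def\<close>)
          finally show "(\<Sum>j\<in>UNIV. G s' (Some j)) = (\<Sum>j\<in>{j. j < t}. A s s' j x * partial j (u s') x)" .
        qed
        finally show ?case by (simp add: sum.distrib)
      qed
    qed
  qed auto
  then show ?thesis using lk by (simp add: u_def good_def)
qed

end

section \<open>Initial conditions\<close>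

lemma ex_crossing:
  fixes \<beta> :: "nat \<Rightarrow> nat"
  assumes "a \<le> n" "\<beta> a < m" "m \<le> \<beta> n"
  obtains i where "a \<le> i" "i < n" "\<beta> i < m" "m \<le> \<beta> (i + 1)"
  using assms
proof (induction n arbitrary: thesis rule: dec_induct)
  case (step n)
  show ?case
  proof (cases "m \<le> \<beta> n")
    case True
    show ?thesis by (rule step.IH) (use step True in \<open>auto intro: less_SucI\<close>)
  next
    case False
    then show ?thesis using step by (intro step.prems(1)[of n]) auto
  qed
qed auto

lemma mono_on_range:
  fixes \<beta> :: "nat \<Rightarrow> nat"
  assumes "\<forall>i\<in>{1..<n}. \<beta> i \<le> \<beta> (i + 1)" "1 \<le> a" "a \<le> b" "b \<le> n"
  shows "\<beta> a \<le> \<beta> b"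
  using assms(3,4)
proof (induction b rule: dec_induct)
  case (step b)
  then have "\<beta> b \<le> \<beta> (b + 1)" using assms(1,2) by auto
  then show ?case using step by simp
qed simp

text \<open>
  An unknown that is parametric for class \<open>i\<close> is prescribed on a slice that contains the one of index \<open>i\<close>.
\<close>

lemma initial_conditions_agree:
  fixes f g :: "'n::{finite,linorder} rvec \<Rightarrow> 'm::{finite,linorder} rvec"
  assumes f: "initial_conditions x0 \<beta> c \<phi> \<psi> f" and g: "initial_conditions x0 \<beta> c \<phi> \<psi> g"
    and i: "1 \<le> i" "i \<le> CARD('n)" "\<beta> i < pos k"
  shows "ev_slice x0 i (\<lambda>x. f x $ k = g x $ k)"
proof (cases "pos k \<le> \<beta> CARD('n)")
  case False
  then have "\<forall>\<^sub>F x in nhds x0. f x $ k = \<psi> k x" "\<forall>\<^sub>F x in nhds x0. g x $ k = \<psi> k x"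
    using f g unfolding initial_conditions_def by auto
  then show ?thesis by eventually_elim auto
next
  case True
  obtain i' where i': "i \<le> i'" "i' < CARD('n)" "\<beta> i' < pos k" "pos k \<le> \<beta> (i' + 1)"
    using ex_crossing[of i "CARD('n)" \<beta> "pos k"] i True by auto
  then have "i' \<in> {1..<CARD('n)}" using i by auto
  then have "\<forall>\<^sub>F x in nhds x0. (\<forall>j. i' < pos j \<longrightarrow> x $ j = x0 $ j) \<longrightarrow> f x $ k = \<phi> k x"
    "\<forall>\<^sub>F x in nhds x0. (\<forall>j. i' < pos j \<longrightarrow> x $ j = x0 $ j) \<longrightarrow> g x $ k = \<phi> k x"
    using f g i'(3,4) unfolding initial_conditions_def by blast+
  then show ?thesis by eventually_elim (use i'(1) in auto)
qed

text \<open>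
  The data of an unknown which \<open>solve_class\<close> changes are given on a slice of smaller index, hence inside
  the hyperplane on which nothing is changed.
\<close>

lemma initial_conditions_modify:
  fixes f g :: "'n::{finite,linorder} rvec \<Rightarrow> 'm::{finite,linorder} rvec"
  assumes mono: "\<forall>i\<in>{1..<CARD('n)}. \<beta> i \<le> \<beta> (i + 1)"
    and f: "initial_conditions x0 \<beta> c \<phi> \<psi> f"
    and hyp: "\<forall>\<^sub>F x in nhds x0. x $ t = x0 $ t \<longrightarrow> g x = f x"
    and np: "\<And>k x. \<not> principal \<beta> t k \<Longrightarrow> g x $ k = f x $ k"
  shows "initial_conditions x0 \<beta> c \<phi> \<psi> g"
  unfolding initial_conditions_def
proof (intro conjI ballI allI impI)
  fix k :: 'm assume "pos k \<le> \<beta> 1"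
  moreover have "g x0 = f x0" using eventually_nhds_x_imp_x[OF hyp] by simp
  ultimately show "g x0 $ k = c k" using f by (simp add: initial_conditions_def)
next
  fix i and k :: 'm assume i: "i \<in> {1..<CARD('n)}" and k: "\<beta> i < pos k \<and> pos k \<le> \<beta> (i + 1)"
  then have "\<forall>\<^sub>F x in nhds x0. (\<forall>j. i < pos j \<longrightarrow> x $ j = x0 $ j) \<longrightarrow> f x $ k = \<phi> k x"
    using f unfolding initial_conditions_def by blast
  with hyp show "\<forall>\<^sub>F x in nhds x0. (\<forall>j. i < pos j \<longrightarrow> x $ j = x0 $ j) \<longrightarrow> g x $ k = \<phi> k x"
  proof eventually_elim
    case (elim x)
    show ?case
    proof
      assume sl: "\<forall>j. i < pos j \<longrightarrow> x $ j = x0 $ j"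
      have "g x $ k = f x $ k"
      proof (cases "i < pos t")
        case True
        then show ?thesis using elim sl by simp
      next
        case False
        then have "\<beta> (pos t) \<le> \<beta> i"
          using i pos_bounds(1)[of t] by (intro mono_on_range[OF mono]) auto
        then show ?thesis using k np by (simp add: principal_def)
      qed
      then show "g x $ k = \<phi> k x" using elim sl by simp
    qed
  qed
next
  fix k :: 'm assume k: "\<beta> CARD('n) < pos k"
  then have "\<forall>\<^sub>F x in nhds x0. f x $ k = \<psi> k x" using f unfolding initial_conditions_def by blast
  moreover have "\<beta> (pos t) \<le> \<beta> CARD('n)"
    using pos_bounds[of t] by (intro mono_on_range[OF mono]) auto
  then have "g x $ k = f x $ k" for x using k np by (simp add: principal_def)
  ultimately show "\<forall>\<^sub>F x in nhds x0. g x $ k = \<psi> k x" by simp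
qed

text \<open>
  The data themselves, extended to all variables, are the initial approximation.
\<close>

lemma ex_initial_conditions:
  fixes \<phi> \<psi> :: "'m::{finite,linorder} \<Rightarrow> 'n::{finite,linorder} rvec \<Rightarrow> real"
  assumes mono: "\<forall>i\<in>{1..<CARD('n)}. \<beta> i \<le> \<beta> (i + 1)"
    and \<phi>: "\<forall>i\<in>{1..<CARD('n)}. \<forall>k. \<beta> i < pos k \<and> pos k \<le> \<beta> (i + 1) \<longrightarrow> real_analytic_at (\<phi> k) x0"
    and \<psi>: "\<forall>k. \<beta> CARD('n) < pos k \<longrightarrow> real_analytic_at (\<psi> k) x0"
  obtains f :: "'n rvec \<Rightarrow> 'm rvec" where "real_analytic_at f x0" "initial_conditions x0 \<beta> c \<phi> \<psi> f"
proof (rule that)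
  let ?f = "\<lambda>x. \<chi> k. if pos k \<le> \<beta> 1 then c k else if pos k \<le> \<beta> CARD('n) then \<phi> k x else \<psi> k x"
  have 1: "1 \<le> CARD('n)" by (simp add: Suc_le_eq)
  show "real_analytic_at ?f x0"
    unfolding real_analytic_at_vec
  proof
    fix k :: 'm
    consider "pos k \<le> \<beta> 1" | "\<beta> 1 < pos k" "pos k \<le> \<beta> CARD('n)" | "\<beta> 1 < pos k" "\<beta> CARD('n) < pos k"
      by linarith
    then show "real_analytic_at (\<lambda>x. ?f x $ k) x0"
    proof cases
      case 1
      then show ?thesis by (simp add: real_analytic_at_const)
    next
      case 2
      then obtain i where "1 \<le> i" "i < CARD('n)" "\<beta> i < pos k" "pos k \<le> \<beta> (i + 1)"
        using ex_crossing[of 1 "CARD('n)" \<beta> "pos k"] 1 by auto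
      then have "real_analytic_at (\<phi> k) x0" using \<phi> by auto
      then show ?thesis using 2 by simp
    next
      case 3
      then show ?thesis using \<psi> by simp
    qed
  qed
  have "\<beta> 1 \<le> \<beta> CARD('n)" by (rule mono_on_range[OF mono]) (use 1 in auto)
  moreover have "\<beta> 1 \<le> \<beta> i" "\<beta> (i + 1) \<le> \<beta> CARD('n)" if "i \<in> {1..<CARD('n)}" for i
    using that by (auto intro!: mono_on_range[OF mono])
  ultimately show "initial_conditions x0 \<beta> c \<phi> \<psi> ?f"
    unfolding initial_conditions_def by (fastforce intro!: always_eventually)
qed

context solved_system
begin

text \<open>
  An equation of class below \<open>t\<close> involves only derivatives tangential to the hyperplane.
\<close>

lemma residual_hyperplane_cong:
  assumes lk: "principal \<beta> l k" "l < t"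
    and f: "real_analytic_at (f :: 'n rvec \<Rightarrow> 'm rvec) x0" and g: "real_analytic_at g x0"
    and hyp: "\<forall>\<^sub>F x in nhds x0. x $ t = x0 $ t \<longrightarrow> g x = f x"
  shows "\<forall>\<^sub>F x in nhds x0. x $ t = x0 $ t \<longrightarrow> residual (S l k) g x = residual (S l k) f x"
proof -
  define w where "w x = g x - f x" for x
  have w: "real_analytic_at w x0" unfolding w_def[abs_def] by (rule real_analytic_at_diff[OF g f])
  have w0: "\<forall>\<^sub>F x in nhds x0. (\<forall>j\<in>{t}. x $ j = x0 $ j) \<longrightarrow> w x = 0"
    using hyp by eventually_elim (simp add: w_def)
  have "\<forall>\<^sub>F x in nhds x0. j \<noteq> t \<longrightarrow> x $ t = x0 $ t \<longrightarrow> partial j w x = 0" for j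
    using partial_vanishes_on_slice[OF w w0, of j] by (cases "j = t") auto
  then have "\<forall>\<^sub>F x in nhds x0. \<forall>j. j \<noteq> t \<longrightarrow> x $ t = x0 $ t \<longrightarrow> partial j w x = 0"
    by (rule eventually_all_finite)
  with w0 residual_add[OF f w, of "S l k"] eventually_U show ?thesis
  proof eventually_elim
    case (elim x)
    show ?case
    proof
      assume xt: "x $ t = x0 $ t"
      have "snd (S l k x) $ i $ j * partial j w x $ i = 0" for i j
        using elim xt S_higher[OF lk(1) _ lk(2), of x i] by (cases "j = t") auto
      then have "(\<Sum>i\<in>UNIV. \<Sum>j\<in>UNIV. snd (S l k x) $ i $ j * partial j w x $ i) = 0"
        by (intro sum.neutral ballI)
      then have "residual (S l k) w x = 0"
        using elim(1) xt by (simp add: residual_def inner_jet1 fst_j1 snd_j1)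
      moreover have "(\<lambda>x. f x + w x) = g" by (simp add: w_def)
      ultimately show "residual (S l k) g x = residual (S l k) f x" using elim(2) by simp
    qed
  qed
qed

text \<open>
  The climb from \<open>V\<^sub>0\<close> to \<open>V\<^sub>n\<close>; at index \<open>0\<close> there is no equation to satisfy.
\<close>

lemma partial_solution:
  fixes \<phi> \<psi> :: "'m \<Rightarrow> 'n rvec \<Rightarrow> real"
  assumes inv: "involutive U \<beta> S"
    and mono: "\<forall>i\<in>{1..<CARD('n)}. \<beta> i \<le> \<beta> (i + 1)"
    and \<phi>: "\<forall>i\<in>{1..<CARD('n)}. \<forall>k. \<beta> i < pos k \<and> pos k \<le> \<beta> (i + 1) \<longrightarrow> real_analytic_at (\<phi> k) x0"
    and \<psi>: "\<forall>k. \<beta> CARD('n) < pos k \<longrightarrow> real_analytic_at (\<psi> k) x0"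
    and "i \<le> CARD('n)"
  shows "\<exists>f :: 'n rvec \<Rightarrow> 'm rvec. real_analytic_at f x0 \<and> initial_conditions x0 \<beta> c \<phi> \<psi> f \<and>
     (\<forall>l k. principal \<beta> l k \<longrightarrow> pos l \<le> i \<longrightarrow> ev_slice x0 i (\<lambda>x. residual (S l k) f x = 0))"
  using \<open>i \<le> CARD('n)\<close>
proof (induction i)
  case 0
  have "\<not> pos l \<le> 0" for l :: 'n using pos_bounds(1)[of l] by simp
  then show ?case using ex_initial_conditions[OF mono \<phi> \<psi>, of c] by metis
next
  case (Suc i)
  then obtain f :: "'n rvec \<Rightarrow> 'm rvec" where f: "real_analytic_at f x0" "initial_conditions x0 \<beta> c \<phi> \<psi> f"
    "\<And>l k. principal \<beta> l k \<Longrightarrow> pos l \<le> i \<Longrightarrow> ev_slice x0 i (\<lambda>x. residual (S l k) f x = 0)"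
    by auto
  obtain t :: 'n where t: "pos t = Suc i" by (rule ex_pos[of "Suc i"]) (use Suc.prems in auto)
  obtain g where g: "real_analytic_at g x0" "\<forall>\<^sub>F x in nhds x0. x $ t = x0 $ t \<longrightarrow> g x = f x"
    "\<And>k x. \<not> principal \<beta> t k \<Longrightarrow> g x $ k = f x $ k"
    "\<And>k. principal \<beta> t k \<Longrightarrow> \<forall>\<^sub>F x in nhds x0. residual (S t k) g x = 0"
    by (rule solve_class[OF f(1), of t]) (rule that)
  have low: "ev_slice x0 (pos t - 1) (\<lambda>x. residual (S l k) g x = 0)" if lk: "principal \<beta> l k" "l < t" for l k
  proof -
    have "pos l \<le> i" using lk(2) t pos_less_iff[of l t] by simp
    from residual_hyperplane_cong[OF lk f(1) g(1,2)] f(3)[OF lk(1) this] show ?thesis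
      by eventually_elim (use t in auto)
  qed
  have "ev_slice x0 (Suc i) (\<lambda>x. residual (S l k) g x = 0)" if lk: "principal \<beta> l k" "pos l \<le> Suc i" for l k
  proof (cases "l = t")
    case True
    then show ?thesis using g(4)[of k] lk by (auto elim: eventually_mono)
  next
    case False
    then have "l < t" using lk t pos_le_iff[of l t] by simp
    show ?thesis using residuals_vanish[OF inv g(1,4) low lk(1) \<open>l < t\<close>] by (simp add: t)
  qed
  moreover have "initial_conditions x0 \<beta> c \<phi> \<psi> g"
    by (rule initial_conditions_modify[OF mono f(2) g(2,3)])
  ultimately show ?case using g(1) by blast
qed

lemma analytic_solution_near_iff:
  "analytic_solution_near x0 R f \<longleftrightarrow>
     real_analytic_at f x0 \<and> (\<forall>\<^sub>F x in nhds x0. \<forall>l k. principal \<beta> l k \<longrightarrow> residual (S l k) f x = 0)"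
proof -
  have "(\<forall>\<^sub>F x in nhds x0. j1 f x \<in> R x) \<longleftrightarrow>
      (\<forall>\<^sub>F x in nhds x0. \<forall>l k. principal \<beta> l k \<longrightarrow> residual (S l k) f x = 0)"
    by (rule eventually_cong[OF eventually_U]) (simp add: R_iff residual_def)
  then show ?thesis by (simp add: analytic_solution_near_def)
qed

lemma solution_unique:
  assumes mono: "\<forall>i\<in>{1..<CARD('n)}. \<beta> i \<le> \<beta> (i + 1)"
    and f: "analytic_solution_near x0 R f" "initial_conditions x0 \<beta> c \<phi> \<psi> f"
    and g: "analytic_solution_near x0 R g" "initial_conditions x0 \<beta> c \<phi> \<psi> g"
  shows "\<forall>\<^sub>F x in nhds x0. g x = f x"
proof -
  define d where "d x = g x - f x" for x
  have an: "real_analytic_at f x0" "real_analytic_at g x0" using f g by (auto simp: analytic_solution_near_iff)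
  then have d: "real_analytic_at d x0" unfolding d_def[abs_def] by (intro real_analytic_at_diff)
  have res: "\<forall>\<^sub>F x in nhds x0. residual (S l k) d x = 0" if lk: "principal \<beta> l k" for l k
  proof -
    have "\<forall>\<^sub>F x in nhds x0. residual (S l k) f x = 0" "\<forall>\<^sub>F x in nhds x0. residual (S l k) g x = 0"
      using f(1) g(1) lk unfolding analytic_solution_near_iff by (auto elim: eventually_mono)
    with residual_add[OF an(1) d, of "S l k"] show ?thesis
      by eventually_elim (simp add: d_def)
  qed
  have "ev_slice x0 i (\<lambda>x. d x = 0)" if "i \<le> CARD('n)" for i
    using that
  proof (induction i)
    case 0
    have "g x0 $ k = f x0 $ k" for k
    proof (cases "pos k \<le> \<beta> 1")
      case True
      then show ?thesis using f(2) g(2) by (simp add: initial_conditions_def)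
    next
      case False
      then have "ev_slice x0 1 (\<lambda>x. g x $ k = f x $ k)"
        by (intro initial_conditions_agree[OF g(2) f(2)]) (auto simp: Suc_le_eq)
      from eventually_nhds_x_imp_x[OF this] show ?thesis by simp
    qed
    then have "d x0 = 0" by (simp add: d_def vec_eq_iff)
    moreover have "x = x0" if "\<forall>j\<in>{j. 0 < pos j}. x $ j = x0 $ j" for x
      using that pos_bounds(1) by (auto simp: vec_eq_iff Suc_le_eq)
    ultimately show ?case by (metis (mono_tags, lifting) always_eventually)
  next
    case (Suc i)
    obtain t :: 'n where t: "pos t = Suc i" by (rule ex_pos[of "Suc i"]) (use Suc.prems in auto)
    have "ev_slice x0 (pos t) (\<lambda>x. d x = 0)"
    proof (rule unique_class[OF d])
      show "ev_slice x0 (pos t) (\<lambda>x. residual (S t k) d x = 0)" if "principal \<beta> t k" for k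
        using res[OF that] by (auto elim: eventually_mono)
      show "ev_slice x0 (pos t) (\<lambda>x. d x $ k = 0)" if "\<not> principal \<beta> t k" for k
      proof -
        have "ev_slice x0 (pos t) (\<lambda>x. g x $ k = f x $ k)"
          by (rule initial_conditions_agree[OF g(2) f(2)]) (use that pos_bounds in \<open>auto simp: principal_def\<close>)
        then show ?thesis by eventually_elim (simp add: d_def)
      qed
      show "ev_slice x0 (pos t - 1) (\<lambda>x. d x = 0)" using Suc by (simp add: t)
    qed
    then show ?case by (simp add: t)
  qed
  moreover have "\<not> CARD('n) < pos j" for j :: 'n using pos_bounds(2)[of j] by simp
  ultimately have "\<forall>\<^sub>F x in nhds x0. d x = 0" using order_refl[of "CARD('n)"]
    by fastforce
  then show ?thesis by eventually_elim (simp add: d_def)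
qed

end

theorem corollary2p22:
  fixes U :: "'n::{finite,linorder} rvec set"
    and R :: "'n rvec \<Rightarrow> ('n, 'm::{finite,linorder}) jet1 set"
    and \<beta> :: "nat \<Rightarrow> nat"
    and S :: "'n \<Rightarrow> 'm \<Rightarrow> ('n, 'm) lin_eq"
    and x0 :: "'n rvec"
    and c :: "'m \<Rightarrow> real"
    and \<phi> \<psi> :: "'m \<Rightarrow> 'n rvec \<Rightarrow> real"
  assumes "open U" and "x0 \<in> U"
    and "analytic_linear_system U R"
    and epi: "\<forall>x\<in>U. fst ` R x = UNIV"
    and "solved_form U R \<beta> S"
    and "involutive U \<beta> S"
    and "\<forall>i\<in>{1..<CARD('n)}. \<beta> i \<le> \<beta> (i + 1)"
    and "\<forall>i\<in>{1..<CARD('n)}. \<forall>k. \<beta> i < pos k \<and> pos k \<le> \<beta> (i + 1) \<longrightarrow>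
           real_analytic_at (\<phi> k) x0 \<and> depends_on_first i (\<phi> k)"
    and "\<forall>k. \<beta> CARD('n) < pos k \<longrightarrow> real_analytic_at (\<psi> k) x0"
  shows "\<exists>f :: 'n rvec \<Rightarrow> 'm rvec.
           analytic_solution_near x0 R f \<and> initial_conditions x0 \<beta> c \<phi> \<psi> f \<and>
           (\<forall>g. analytic_solution_near x0 R g \<and> initial_conditions x0 \<beta> c \<phi> \<psi> g \<longrightarrow>
              (\<forall>\<^sub>F x in nhds x0. g x = f x))"
proof -
  interpret solved_system U R \<beta> S x0 by unfold_locales fact+
  have mono: "\<forall>i\<in>{1..<CARD('n)}. \<beta> i \<le> \<beta> (i + 1)" by fact
  have "\<forall>i\<in>{1..<CARD('n)}. \<forall>k. \<beta> i < pos k \<and> pos k \<le> \<beta> (i + 1) \<longrightarrow> real_analytic_at (\<phi> k) x0"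
    using assms(8) by blast
  from partial_solution[OF assms(6) mono this assms(9) order_refl, of c]
  obtain f :: "'n rvec \<Rightarrow> 'm rvec" where f: "real_analytic_at f x0" "initial_conditions x0 \<beta> c \<phi> \<psi> f"
    and res: "\<And>l k. principal \<beta> l k \<Longrightarrow> pos l \<le> CARD('n) \<Longrightarrow> ev_slice x0 CARD('n) (\<lambda>x. residual (S l k) f x = 0)"
    by blast
  have "\<not> CARD('n) < pos j" for j :: 'n using pos_bounds(2)[of j] by simp
  then have "\<forall>\<^sub>F x in nhds x0. principal \<beta> l k \<longrightarrow> residual (S l k) f x = 0" for l k
    using res[of l k] pos_bounds(2)[of l] by (cases "principal \<beta> l k") simp_all
  then have "\<forall>\<^sub>F x in nhds x0. \<forall>l k. principal \<beta> l k \<longrightarrow> residual (S l k) f x = 0"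
    by (intro eventually_all_finite)
  then have "analytic_solution_near x0 R f" using f(1) by (simp add: analytic_solution_near_iff)
  then show ?thesis using f(2) solution_unique[OF mono] by blast
qed

end
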